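(* There exists a computable function $B:\mathbb{N}\to\mathbb{N}$ with the following property: if $l\in\mathbb{N}$ and $g,h\in\mathbb{C}[x]$ are non-constant polynomials such that $g(h(x))$ has at most $l$ terms, then $h(x)$ has at most $B(l)$ terms.
   Context: The number of terms of a polynomial in $\mathbb{C}[x]$ is the number of monomials $x^m$ that occur in it with non-zero coefficient. *)

theory Defs
  imports Complex_Main "HOL-Computational_Algebra.Polynomial"
begin

definition num_terms :: "'a::zero poly \<Rightarrow> nat" where
  "num_terms p = card {m. coeff p m \<noteq> 0}"

text \<open>
  General recursive functions: the least class of total functions that contains the zero
  functions, the successor and the projections and is closed under composition, primitive
  recursion and minimisation of regular functions. An \<open>n\<close>-ary function is represented by a
  function on lists; only its values on lists of length \<open>n\<close> matter.
\<close>

inductive general_recursive :: "nat \<Rightarrow> (nat list \<Rightarrow> nat) \<Rightarrow> bool" where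
  zero: "general_recursive n (\<lambda>xs. 0)"
| succ: "general_recursive 1 (\<lambda>xs. Suc (hd xs))"
| proj: "i < n \<Longrightarrow> general_recursive n (\<lambda>xs. xs ! i)"
| comp: "general_recursive (length gs) f \<Longrightarrow> (\<forall>g\<in>set gs. general_recursive n g) \<Longrightarrow>
    general_recursive n (\<lambda>xs. f (map (\<lambda>g. g xs) gs))"
| prim_rec: "general_recursive n f \<Longrightarrow> general_recursive (Suc (Suc n)) g \<Longrightarrow>
    general_recursive (Suc n)
      (\<lambda>xs. rec_nat (f (tl xs)) (\<lambda>k r. g (k # r # tl xs)) (hd xs))"
| minimize: "general_recursive (Suc n) f \<Longrightarrow>
    (\<forall>xs. length xs = n \<longrightarrow> (\<exists>y. f (y # xs) = 0)) \<Longrightarrow>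
    general_recursive n (\<lambda>xs. LEAST y. f (y # xs) = 0)"

definition computable :: "(nat \<Rightarrow> nat) \<Rightarrow> bool" where
  "computable B \<longleftrightarrow> (\<exists>f. general_recursive 1 f \<and> (\<forall>n. B n = f [n]))"

end

theory Submission
  imports Defs
    "HOL-Computational_Algebra.Computational_Algebra"
    "HOL-Computational_Algebra.Field_as_Ring"
    "HOL-Library.FuncSet"
begin

text \<open>
  The degree \<open>d\<close> of \<open>g\<close> is bounded first, unless \<open>h\<close> is of the form \<open>a x\<^sup>m + b\<close>: below a large gap in
  the exponents of \<open>f = g(h)\<close> the terms can be cut off without leaving \<open>\<complex>[h]\<close>, as a comparison of
  \<open>f(x)\<close> and \<open>f(y)\<close> on the curve \<open>h(x) = h(y)\<close> at infinity shows, and then the multiplicity of a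
  lacunary polynomial at a nonzero root is less than its number of terms.

  After a shift of \<open>h\<close>, the reversed polynomial \<open>\<eta>(t) = t\<^sup>m h(1/t)\<close> agrees to order \<open>2 m\<close> with the
  \<open>d\<close>-th root of the reversed \<open>f\<close>. Split the latter as \<open>\<phi> + \<epsilon>\<close> such that the exponents in \<open>\<phi>\<close> are
  negligible and those in \<open>\<epsilon>\<close> comparable to \<open>m\<close> or larger, and expand in powers of \<open>\<epsilon>\<close>. A linear
  differential operator that kills the expansion shows that it is exact: \<open>\<phi> = \<psi>\<^sup>d\<close> for a polynomial
  \<open>\<psi>\<close>, and \<open>\<eta> = \<psi> T / \<phi>\<^sup>J\<close> with \<open>J\<close> bounded and the exponents of \<open>T\<close> in a \<open>J\<close>-fold sumset. By
  induction on the number of exponents, those of \<open>\<psi>\<close> are bounded combinations of those of \<open>\<phi>\<close>.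

  Choose generators of all these exponents without small integer relations. Then \<open>\<psi> T / \<phi>\<^sup>J\<close>
  lifts to a quotient of Laurent polynomials in several variables which still satisfies the
  lifted equation, so it is integral in each variable and hence a Laurent polynomial with bounded
  exponents. Restricting it to the curve \<open>t \<mapsto> (t\<^bsup>M i\<^esup>)\<close>, where \<open>M i\<close> are the generators, bounds the
  exponents of \<open>\<eta>\<close>.
\<close>

unbundle fps_syntax

section \<open>Roots of polynomials as power series\<close>

text \<open>The order \<open>2 * m\<close> comes from completing the \<open>d\<close>-th power: once
  \<open>g\<close> has no coefficient at \<open>d - 1\<close>, the equation for
  \<open>\<eta>\<close> has no term with \<open>k = 1\<close>. The image under the operator has a
  numerator of degree barely above \<open>m\<close>, so vanishing to order \<open>2 * m\<close>
  kills it, while order \<open>m\<close> would not suffice. What counts as negligible depends on the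
  cut: a lower threshold for \<open>\<epsilon>\<close> means a longer expansion, a larger sumset and
  a stricter demand on \<open>\<phi>\<close>. A pigeonhole over the exponents finds a consistent
  cut, at the price of an iterated exponential. Several variables enter because a quotient of sparse
  polynomials need not be sparse, as \<open>(1 - t ^ n) / (1 - t)\<close> shows. Degrees in the
  lifted variables are measured by small exponent vectors, not by the large exponents themselves. An
  identity on the curve lifts only if the generators have no relation as small as the exponent
  vectors involved. Eliminating a relation enlarges these vectors and hence the independence
  required, so elimination is iterated, at most once per generator. For \<open>a x^m + b\<close> the
  degree of \<open>g\<close> has no bound, but \<open>h\<close> has at most two terms.\<close>

lemma fps_root_unique:
  fixes a b :: "complex fps"
  assumes "a ^ d = b ^ d" "a $ 0 = 1" "b $ 0 = 1" "d > 0"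
  shows "a = b"
proof -
  let ?S = "\<Sum>i<d. b ^ (d - Suc i) * a ^ i"
  have "(a - b) * ?S = 0"
    using power_diff_sumr2[of a d b] assms(1) by simp
  \<comment> \<open>With both constant terms equal to 1, the cofactor of \<open>a - b\<close> has
    constant term \<open>d\<close>, nonzero in characteristic 0.\<close>
  moreover have "?S $ 0 = of_nat d"
    using assms by (simp add: fps_sum_nth fps_nth_power_0)
  then have "?S \<noteq> 0" using assms(4) by (metis fps_zero_nth of_nat_eq_0_iff neq0_conv)
  ultimately show ?thesis by simp
qed

lemma fps_root_exists:
  fixes a :: "complex fps"
  assumes "a $ 0 = 1" "d > 0"
  obtains b where "b ^ d = a" "b $ 0 = 1"
proof -
  obtain k where k: "d = Suc k" using assms(2) by (cases d) auto
  let ?b = "fps_radical (\<lambda>_ _. 1) d a"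
  have "?b ^ d = a"
    using power_radical[of a "\<lambda>_ _. 1" k] assms(1) by (simp add: k)
  moreover have "?b $ 0 = 1" by (simp add: k)
  ultimately show ?thesis by (rule that)
qed

lemma fps_X_power_dvd_iff: "fps_X ^ K dvd u \<longleftrightarrow> (\<forall>n<K. (u::complex fps) $ n = 0)"
proof
  assume "fps_X ^ K dvd u"
  then show "\<forall>n<K. u $ n = 0" by (auto elim!: dvdE simp: fps_X_power_mult_nth)
next
  assume "\<forall>n<K. u $ n = 0"
  then have "u = fps_X ^ K * fps_shift K u"
    by (intro fps_ext) (auto simp: fps_X_power_mult_nth)
  then show "fps_X ^ K dvd u" by (metis dvd_triv_left)
qed

lemma fps_of_poly_X_power_dvd:
  "[:0, 1:] ^ K dvd p \<Longrightarrow> fps_X ^ K dvd fps_of_poly (p :: complex poly)"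
  by (auto elim!: dvdE simp: fps_of_poly_mult fps_of_poly_power fps_of_poly_pCons)

lemma power_cong_dvd:
  fixes a b :: "'a::comm_ring_1"
  assumes "k dvd a - b"
  shows "k dvd a ^ n - b ^ n"
  using assms by (metis dvd_mult2 power_diff_sumr2)

text \<open>\<open>\<eta> / \<theta>\<close> is the binomial series of \<open>(1 + v)^(1/d)\<close>
  at \<open>v = \<eta>^d / \<phi> - 1\<close>, and \<open>v\<close> is
  \<open>\<epsilon> / \<phi>\<close> up to order \<open>K\<close>. Since \<open>v\<close> has order
  at least \<open>q\<close> and \<open>K \<le> Suc J * q\<close>, the terms up to \<open>J\<close>
  suffice; the factor \<open>\<phi> ^ J\<close> clears their denominators.\<close>

lemma root_expansion:
  fixes \<eta> \<phi> \<epsilon> \<theta> :: "complex fps"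
  assumes d: "d > 0" and \<theta>: "\<theta> ^ d = \<phi>" "\<theta> $ 0 = 1" and \<eta>: "\<eta> $ 0 = 1"
    and cong: "fps_X ^ K dvd \<eta> ^ d - \<phi> - \<epsilon>"
    and \<epsilon>: "fps_X ^ q dvd \<epsilon>" "q \<le> K" "q > 0" "K \<le> Suc J * q"
  obtains b where "fps_X ^ K dvd \<eta> * \<phi> ^ J * inverse \<theta> - (\<Sum>j\<le>J. fps_const (b j) * \<epsilon> ^ j * \<phi> ^ (J - j))"
proof -
  have \<phi>0: "\<phi> $ 0 = 1" using \<theta> d by (metis fps_nth_power_0 power_one)
  have inv\<phi>: "inverse \<phi> * \<phi> = 1" using \<phi>0 by (simp add: inverse_mult_eq_1)
  have inv\<theta>: "inverse \<theta> * \<theta> = 1" using \<theta> by (simp add: inverse_mult_eq_1)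
  define v where "v = (\<eta> ^ d - \<phi>) * inverse \<phi>"
  define w where "w = \<epsilon> * inverse \<phi>"
  have vw: "fps_X ^ K dvd v - w"
    using cong by (simp add: v_def w_def flip: left_diff_distrib)
  have w: "fps_X ^ q dvd w" using \<epsilon>(1) by (simp add: w_def)
  have v: "fps_X ^ q dvd v"
    using dvd_add[OF dvd_trans[OF le_imp_power_dvd[OF \<epsilon>(2)] vw] w] by simp
  then have v0: "v $ 0 = 0" using \<epsilon>(3) by (simp add: fps_X_power_dvd_iff)
  have "(1 + fps_X :: complex fps) $ 0 = 1" by simp
  then obtain B :: "complex fps" where B: "B ^ d = 1 + fps_X" "B $ 0 = 1"
    using fps_root_exists[OF _ d] by blast
  have "B oo v = \<eta> * inverse \<theta>"
  proof (rule fps_root_unique[OF _ _ _ d])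
    have "(B oo v) ^ d = (1 + fps_X) oo v"
      unfolding fps_compose_power[OF v0] B(1) ..
    also have "\<dots> = 1 + v" using v0 by (simp add: fps_compose_add_distrib)
    also have "\<dots> = \<eta> ^ d * inverse \<phi>"
      using inv\<phi> by (simp add: v_def left_diff_distrib mult.commute[of \<phi>])
    also have "inverse \<phi> = inverse \<theta> ^ d" unfolding \<theta>(1)[symmetric] by (rule fps_inverse_power)
    finally show "(B oo v) ^ d = (\<eta> * inverse \<theta>) ^ d" by (simp only: power_mult_distrib)
  qed (use B \<theta> \<eta> in auto)
  moreover have "fps_X ^ K dvd (B oo v) - (\<Sum>j\<le>J. fps_const (B $ j) * w ^ j)"
  proof -
    define B1 where "B1 = (\<Sum>j\<le>J. fps_const (B $ j) * fps_X ^ j)"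
    have "fps_X ^ Suc J dvd B - B1"
      unfolding fps_X_power_dvd_iff B1_def by (auto simp: fps_sum_nth fps_X_power_nth if_distrib cong: if_cong)
    then obtain R where R: "B - B1 = fps_X ^ Suc J * R" by (elim dvdE)
    have "(B oo v) - (B1 oo v) = (fps_X ^ Suc J * R) oo v"
      by (simp add: fps_compose_sub_distrib[symmetric] R del: power_Suc)
    also have "\<dots> = v ^ Suc J * (R oo v)"
      unfolding fps_compose_mult_distrib[OF v0] fps_compose_power[OF v0, symmetric] using v0 by simp
    finally have "(B oo v) - (B1 oo v) = v ^ Suc J * (R oo v)" .
    moreover have "fps_X ^ K dvd v ^ Suc J"
    proof -
      have "fps_X ^ K dvd (fps_X ^ (Suc J * q) :: complex fps)" by (rule le_imp_power_dvd[OF \<epsilon>(4)])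
      also have "\<dots> = (fps_X ^ q) ^ Suc J" by (simp only: power_mult[symmetric] mult.commute)
      also have "\<dots> dvd v ^ Suc J" by (rule dvd_power_same[OF v])
      finally show ?thesis .
    qed
    ultimately have 1: "fps_X ^ K dvd (B oo v) - (B1 oo v)" by simp
    have "B1 oo v = (\<Sum>j\<le>J. fps_const (B $ j) * v ^ j)"
      unfolding B1_def fps_compose_sum_distrib fps_compose_mult_distrib[OF v0]
        fps_compose_power[OF v0, symmetric] using v0 by simp
    then have "(B1 oo v) - (\<Sum>j\<le>J. fps_const (B $ j) * w ^ j) = (\<Sum>j\<le>J. fps_const (B $ j) * (v ^ j - w ^ j))"
      by (simp add: sum_subtractf right_diff_distrib)
    moreover have "fps_X ^ K dvd (\<Sum>j\<le>J. fps_const (B $ j) * (v ^ j - w ^ j))"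
      by (intro dvd_sum dvd_mult power_cong_dvd vw)
    ultimately have "fps_X ^ K dvd (B1 oo v) - (\<Sum>j\<le>J. fps_const (B $ j) * w ^ j)" by simp
    from dvd_add[OF 1 this] show ?thesis by simp
  qed
  ultimately have "fps_X ^ K dvd (\<eta> * inverse \<theta> - (\<Sum>j\<le>J. fps_const (B $ j) * w ^ j)) * \<phi> ^ J"
    by simp
  moreover have "(\<Sum>j\<le>J. fps_const (B $ j) * w ^ j) * \<phi> ^ J = (\<Sum>j\<le>J. fps_const (B $ j) * \<epsilon> ^ j * \<phi> ^ (J - j))"
    unfolding sum_distrib_right
  proof (intro sum.cong refl)
    fix j assume "j \<in> {..J}"
    then have "\<phi> ^ J = \<phi> ^ j * \<phi> ^ (J - j)" by (simp flip: power_add)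
    moreover have "w ^ j * \<phi> ^ j = \<epsilon> ^ j"
      unfolding power_mult_distrib[symmetric] w_def using inv\<phi> by (simp add: mult.assoc)
    ultimately show "fps_const (B $ j) * w ^ j * \<phi> ^ J = fps_const (B $ j) * \<epsilon> ^ j * \<phi> ^ (J - j)"
      by (metis mult.assoc)
  qed
  ultimately have "fps_X ^ K dvd \<eta> * inverse \<theta> * \<phi> ^ J - (\<Sum>j\<le>J. fps_const (B $ j) * \<epsilon> ^ j * \<phi> ^ (J - j))"
    unfolding left_diff_distrib by simp
  also have "\<eta> * inverse \<theta> * \<phi> ^ J = \<eta> * \<phi> ^ J * inverse \<theta>" by (simp only: mult_ac)
  finally show ?thesis by (rule that)
qed

text \<open>Multiplying the \<open>n\<close>-th coefficient by \<open>\<Prod>e\<in>E. (n - e)\<close> is the differential operator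
  \<open>\<Prod>e\<in>E. (t d/dt - e)\<close>.\<close>

lemma euler_operator_root:
  fixes \<theta> :: "complex fps" and \<phi> A :: "complex poly"
  assumes d: "d > 0" and \<theta>: "\<theta> ^ d = fps_of_poly \<phi>" "\<theta> $ 0 = 1" and "finite E"
    and Y: "Y * \<theta> = fps_of_poly A" and deg: "degree \<phi> \<le> \<delta>"
  shows "\<exists>P. degree P \<le> degree A + card E * \<delta> \<and>
    Abs_fps (\<lambda>n. (\<Prod>e\<in>E. of_nat n - of_nat e) * Y $ n) * \<theta> * fps_of_poly \<phi> ^ card E = fps_of_poly P"
  using assms(4)
proof (induction E rule: finite_induct)
  case empty
  have "Abs_fps (($) Y) = Y" by (intro fps_ext) simp
  then show ?case by (intro exI[of _ A]) (simp add: Y)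
next
  case (insert e E)
  define \<Phi> where "\<Phi> = fps_of_poly \<phi>"
  define U where "U = Abs_fps (\<lambda>n. (\<Prod>e\<in>E. of_nat n - of_nat e) * Y $ n)"
  define k where "k = card E"
  from insert.IH obtain P where P: "degree P \<le> degree A + k * \<delta>" "U * \<theta> * \<Phi> ^ k = fps_of_poly P"
    unfolding U_def[symmetric] k_def[symmetric] \<Phi>_def[symmetric] by blast
  have \<theta>': "of_nat d * \<Phi> * fps_deriv \<theta> = fps_deriv \<Phi> * \<theta>"
  proof -
    have "fps_deriv \<Phi> = of_nat d * fps_deriv \<theta> * \<theta> ^ (d - 1)"
      unfolding \<Phi>_def \<theta>(1)[symmetric] by (simp only: fps_deriv_power fps_of_nat)
    then have "fps_deriv \<Phi> * \<theta> = of_nat d * fps_deriv \<theta> * (\<theta> ^ (d - 1) * \<theta>)" by (simp add: mult_ac)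
    also have "\<theta> ^ (d - 1) * \<theta> = \<Phi>" using d \<theta>(1) by (simp add: \<Phi>_def power_eq_if mult.commute)
    finally show ?thesis by (simp add: mult_ac)
  qed
  have \<Phi>k': "\<Phi> * fps_deriv (\<Phi> ^ k) = of_nat k * fps_deriv \<Phi> * \<Phi> ^ k"
  proof (cases k)
    case (Suc k')
    then have "fps_deriv (\<Phi> ^ k) = of_nat k * fps_deriv \<Phi> * \<Phi> ^ k'"
      by (simp only: fps_deriv_power fps_of_nat) simp
    then show ?thesis using Suc by (simp add: mult_ac)
  qed simp
  have of_nat_d: "fps_const (inverse (of_nat d)) * of_nat d = (1 :: complex fps)"
    using d by (simp add: fps_of_nat[symmetric] fps_const_mult del: fps_of_nat)
  have d\<theta>: "\<Phi> * fps_deriv \<theta> = fps_const (inverse (of_nat d)) * (fps_deriv \<Phi> * \<theta>)"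
  proof -
    have "\<Phi> * fps_deriv \<theta> = (fps_const (inverse (of_nat d)) * of_nat d) * (\<Phi> * fps_deriv \<theta>)"
      using of_nat_d by simp
    then show ?thesis unfolding \<theta>'[symmetric] by (simp only: mult_ac)
  qed
  define U' where "U' = fps_X * fps_deriv U - of_nat e * U"
  have U': "U' = Abs_fps (\<lambda>n. (\<Prod>e\<in>insert e E. of_nat n - of_nat e) * Y $ n)"
  proof (intro fps_ext)
    fix n
    have "(fps_X * fps_deriv U) $ n = of_nat n * U $ n" by (cases n) simp_all
    moreover have "(of_nat e * U) $ n = of_nat e * U $ n" by (simp flip: fps_of_nat)
    ultimately show "U' $ n = Abs_fps (\<lambda>n. (\<Prod>e\<in>insert e E. of_nat n - of_nat e) * Y $ n) $ n"
      using insert.hyps by (simp add: U'_def U_def algebra_simps)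
  qed
  \<comment> \<open>With \<open>U = P / (\<theta> * \<phi> ^ k)\<close>, the logarithmic derivative
    of the denominator is \<open>\<kappa>\<close> times that of \<open>\<phi>\<close>: the root
    contributes \<open>1 / d\<close>, the power \<open>k\<close>.\<close>
  define \<kappa> where "\<kappa> = inverse (of_nat d) + (of_nat k :: complex)"
  define P' where "P' = [:0, 1:] * (\<phi> * pderiv P - smult \<kappa> (pderiv \<phi> * P)) - smult (of_nat e) (\<phi> * P)"
  have "fps_deriv (fps_of_poly P) = fps_deriv U * \<theta> * \<Phi> ^ k + U * fps_deriv \<theta> * \<Phi> ^ k + U * \<theta> * fps_deriv (\<Phi> ^ k)"
    unfolding P(2)[symmetric] by (simp add: algebra_simps)
  then have "\<Phi> * fps_deriv (fps_of_poly P)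
      = fps_deriv U * \<theta> * \<Phi> ^ Suc k + U * \<Phi> ^ k * (\<Phi> * fps_deriv \<theta>) + U * \<theta> * (\<Phi> * fps_deriv (\<Phi> ^ k))"
    by (simp add: algebra_simps)
  also have "\<dots> = fps_deriv U * \<theta> * \<Phi> ^ Suc k
      + fps_const \<kappa> * fps_deriv \<Phi> * (U * \<theta> * \<Phi> ^ k)"
    unfolding d\<theta> \<Phi>k' \<kappa>_def fps_const_add[symmetric] fps_of_nat[symmetric]
    by (simp add: algebra_simps del: fps_const_add fps_const_mult)
  finally have 1: "fps_deriv U * \<theta> * \<Phi> ^ Suc k
      = \<Phi> * fps_deriv (fps_of_poly P) - fps_const \<kappa> * fps_deriv \<Phi> * fps_of_poly P"
    unfolding P(2) by simp
  have "U' * \<theta> * \<Phi> ^ Suc k = fps_X * (fps_deriv U * \<theta> * \<Phi> ^ Suc k) - of_nat e * \<Phi> * (U * \<theta> * \<Phi> ^ k)"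
    by (simp add: U'_def algebra_simps)
  also have "\<dots> = fps_of_poly P'"
    unfolding 1 P(2) unfolding P'_def \<Phi>_def
    by (simp add: fps_of_poly_mult fps_of_poly_diff fps_of_poly_pderiv fps_of_poly_smult
        fps_of_poly_pCons fps_of_nat mult_ac)
  finally have "U' * \<theta> * \<Phi> ^ Suc k = fps_of_poly P'" .
  \<comment> \<open>The factor \<open>t\<close> restores the degree lost by differentiation, so one
    more operator costs only the degree of \<open>\<phi>\<close>.\<close>
  moreover have "degree P' \<le> degree A + Suc k * \<delta>"
  proof -
    have X: "degree ([:0, 1:] * p) \<le> degree A + Suc k * \<delta>" if "p = 0 \<or> degree p < degree A + Suc k * \<delta>" for p :: "complex poly"
      using that by (auto simp: degree_pCons_eq_if)
    have PP: "degree (\<phi> * P) \<le> degree A + Suc k * \<delta>"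
      using order_trans[OF degree_mult_le, of \<phi> P] P(1) deg by simp
    have "degree ([:0,1:] * (\<phi> * pderiv P)) \<le> degree A + Suc k * \<delta>"
    proof (cases "pderiv P = 0 \<or> \<phi> = 0")
      case False
      then have "degree P > 0" by (auto simp: pderiv_eq_0_iff)
      then have "degree (\<phi> * pderiv P) < degree A + Suc k * \<delta>"
        using order_trans[OF degree_mult_le[of \<phi> "pderiv P"]] P(1) deg False
        by (simp add: degree_mult_eq degree_pderiv)
      then show ?thesis by (intro X) simp
    qed auto
    moreover have "degree ([:0,1:] * smult \<kappa> (pderiv \<phi> * P)) \<le> degree A + Suc k * \<delta>"
    proof (cases "pderiv \<phi> = 0 \<or> P = 0")
      case False
      then have "degree \<phi> > 0" by (auto simp: pderiv_eq_0_iff)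
      then have "degree (pderiv \<phi> * P) < degree A + Suc k * \<delta>"
        using P(1) deg False by (simp add: degree_mult_eq degree_pderiv)
      then have "degree (smult \<kappa> (pderiv \<phi> * P)) < degree A + Suc k * \<delta>"
        using degree_smult_le le_less_trans by blast
      then show ?thesis by (intro X) simp
    qed auto
    ultimately show ?thesis unfolding P'_def right_diff_distrib
      by (intro degree_diff_le order_trans[OF degree_smult_le PP])
  qed
  ultimately show ?case using insert.hyps
    unfolding U' \<Phi>_def k_def by (intro exI[of _ P']) simp
qed

text \<open>The operator with zeros in \<open>E\<close> kills the truncated expansion, hence maps \<open>\<eta> \<phi>\<^sup>J / \<theta>\<close> to a
  series of order at least \<open>2 m\<close>. Up to a unit this image is a polynomial of degree less than
  \<open>2 m\<close>, so it vanishes and \<open>\<eta> \<phi>\<^sup>J / \<theta>\<close> is a polynomial with support in \<open>E\<close>.\<close>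

lemma root_expansion_exact:
  fixes \<eta> \<phi> \<epsilon> :: "complex poly"
  assumes d: "d > 0" and \<phi>: "coeff \<phi> 0 = 1" "degree \<phi> \<le> \<delta>" and \<eta>: "coeff \<eta> 0 = 1" "degree \<eta> \<le> m"
    and cong: "[:0, 1:] ^ (2 * m) dvd \<eta> ^ d - \<phi> - \<epsilon>"
    and \<epsilon>: "[:0, 1:] ^ q dvd \<epsilon>" "q \<le> 2 * m" "q > 0" "2 * m \<le> Suc J * q"
    and E: "finite E" "\<And>j n. j \<le> J \<Longrightarrow> coeff (\<epsilon> ^ j * \<phi> ^ (J - j)) n \<noteq> 0 \<Longrightarrow> n \<in> E"
    and gap: "(J + card E) * \<delta> < m"
  obtains T where "coeff T 0 = 1" "\<And>n. coeff T n \<noteq> 0 \<Longrightarrow> n \<in> E" "T ^ d * \<phi> = (\<eta> * \<phi> ^ J) ^ d"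
proof -
  have \<phi>0: "fps_of_poly \<phi> $ 0 = 1" using \<phi> by simp
  obtain \<theta> where \<theta>: "\<theta> ^ d = fps_of_poly \<phi>" "\<theta> $ 0 = 1"
    using fps_root_exists[OF \<phi>0 d] by blast
  have inv\<theta>: "inverse \<theta> * \<theta> = 1" using \<theta> by (simp add: inverse_mult_eq_1)
  define Y where "Y = fps_of_poly (\<eta> * \<phi> ^ J) * inverse \<theta>"
  have Y\<theta>: "Y * \<theta> = fps_of_poly (\<eta> * \<phi> ^ J)" using inv\<theta> by (simp add: Y_def mult.assoc)
  have "fps_X ^ (2 * m) dvd fps_of_poly \<eta> ^ d - fps_of_poly \<phi> - fps_of_poly \<epsilon>"
    using fps_of_poly_X_power_dvd[OF cong] by (simp add: fps_of_poly_diff fps_of_poly_power)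
  from root_expansion[OF d \<theta> _ this fps_of_poly_X_power_dvd[OF \<epsilon>(1)] \<epsilon>(2-4)] \<eta>(1)
  obtain b where b: "fps_X ^ (2 * m) dvd fps_of_poly \<eta> * fps_of_poly \<phi> ^ J * inverse \<theta> -
      (\<Sum>j\<le>J. fps_const (b j) * fps_of_poly \<epsilon> ^ j * fps_of_poly \<phi> ^ (J - j))" by auto
  define S where "S = (\<Sum>j\<le>J. smult (b j) (\<epsilon> ^ j * \<phi> ^ (J - j)))"
  have "fps_X ^ (2 * m) dvd Y - fps_of_poly S"
    using b by (simp add: Y_def S_def fps_of_poly_mult fps_of_poly_power fps_of_poly_sum fps_of_poly_smult mult.assoc)
  then have YS: "Y $ n = coeff S n" if "n < 2 * m" for n
    using that by (simp add: fps_X_power_dvd_iff)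
  have SE: "n \<in> E" if "coeff S n \<noteq> 0" for n
  proof -
    have "\<exists>j\<le>J. coeff (\<epsilon> ^ j * \<phi> ^ (J - j)) n \<noteq> 0"
    proof (rule ccontr)
      assume "\<not> ?thesis"
      then have "coeff S n = 0" by (simp add: S_def coeff_sum)
      with that show False by simp
    qed
    then show ?thesis using E(2) by blast
  qed
  let ?L = "Abs_fps (\<lambda>n. (\<Prod>e\<in>E. of_nat n - of_nat e) * Y $ n)"
  obtain P where P: "degree P \<le> degree (\<eta> * \<phi> ^ J) + card E * \<delta>"
    "?L * \<theta> * fps_of_poly \<phi> ^ card E = fps_of_poly P"
    using euler_operator_root[OF d \<theta> E(1) Y\<theta> \<phi>(2)] by blast
  have "fps_X ^ (2 * m) dvd ?L"
    unfolding fps_X_power_dvd_iff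
  proof (intro allI impI)
    fix n assume "n < 2 * m"
    then have "n \<in> E \<or> Y $ n = 0" using YS SE by metis
    then show "?L $ n = 0" using E(1) by (auto simp: prod_zero_iff)
  qed
  then have "fps_X ^ (2 * m) dvd fps_of_poly P"
    unfolding P(2)[symmetric] by (simp add: mult.assoc)
  then have "coeff P n = 0" if "n < 2 * m" for n
    using that by (simp add: fps_X_power_dvd_iff)
  \<comment> \<open>\<open>\<eta>\<close> contributes at most \<open>m\<close>; the powers of
    \<open>\<phi>\<close> contribute at most \<open>(J + card E) * \<delta>\<close>, which is less
    than \<open>m\<close>.\<close>
  moreover have "degree P < 2 * m"
  proof -
    have "degree (\<phi> ^ J) \<le> J * \<delta>"
      using order_trans[OF degree_power_le mult_right_mono[OF \<phi>(2)]] by (simp add: mult.commute)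
    then have "degree (\<eta> * \<phi> ^ J) \<le> m + J * \<delta>"
      using order_trans[OF degree_mult_le] \<eta>(2) by (metis add_mono)
    then show ?thesis using P(1) gap by (simp add: distrib_right)
  qed
  ultimately have "P = 0" by (metis leading_coeff_0_iff)
  moreover have "\<theta> \<noteq> 0" "fps_of_poly \<phi> \<noteq> 0" using \<theta>(2) \<phi>0 by auto
  ultimately have L0: "?L = 0" using P(2) by simp
  have YE: "n \<in> E" if "Y $ n \<noteq> 0" for n
  proof -
    have "(\<Prod>e\<in>E. of_nat n - of_nat e) * Y $ n = 0"
      using arg_cong[OF L0, of "\<lambda>f. f $ n"] by simp
    then show ?thesis using that E(1) by (auto simp: prod_zero_iff)
  qed
  define T where "T = (\<Sum>n\<in>E. monom (Y $ n) n)"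
  have T: "coeff T n = Y $ n" for n
    using E(1) YE by (auto simp: T_def coeff_sum sum.delta)
  then have TY: "fps_of_poly T = Y" by (intro fps_ext) simp
  show ?thesis
  proof
    show "coeff T 0 = 1" using \<theta> \<phi> \<eta> by (simp add: T Y_def coeff_mult_0 coeff_0_power)
    show "n \<in> E" if "coeff T n \<noteq> 0" for n using that T YE by simp
    have "fps_of_poly (T ^ d * \<phi>) = (Y * \<theta>) ^ d"
      by (simp add: fps_of_poly_mult fps_of_poly_power TY \<theta> power_mult_distrib)
    also have "\<dots> = fps_of_poly ((\<eta> * \<phi> ^ J) ^ d)" unfolding Y\<theta> by (simp add: fps_of_poly_power)
    finally show "T ^ d * \<phi> = (\<eta> * \<phi> ^ J) ^ d" by simp
  qed
qed

text \<open>Divisibility of \<open>d\<close>-th powers of polynomials descends to their bases, so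
  \<open>\<psi> = Z / T\<close> is a polynomial. This makes the formal root of \<open>\<phi>\<close>
  an honest polynomial root.\<close>

lemma root_of_small_part:
  fixes T \<phi> Z :: "complex poly"
  assumes d: "d > 0" and "T ^ d * \<phi> = Z ^ d" "coeff T 0 = 1" "coeff Z 0 = 1"
  obtains \<psi> where "\<psi> * T = Z" "\<psi> ^ d = \<phi>" "coeff \<psi> 0 = 1"
proof -
  have "T ^ d dvd Z ^ d" using assms(2) by (metis dvd_triv_left)
  then have "T dvd Z" using d by (simp add: pow_divides_pow_iff)
  then obtain \<psi> where \<psi>: "Z = T * \<psi>" by (elim dvdE)
  show ?thesis
  proof
    show "\<psi> * T = Z" using \<psi> by (simp add: mult.commute)
    have "T \<noteq> 0" using assms(3) by auto
    then show "\<psi> ^ d = \<phi>" using assms(2) \<psi> by (simp add: power_mult_distrib)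
    show "coeff \<psi> 0 = 1" using assms(3,4) \<psi> by (simp add: coeff_mult_0)
  qed
qed

section \<open>Bounding the degree of the outer polynomial\<close>

lemma finite_support: "finite {m. coeff (p :: 'a::zero poly) m \<noteq> 0}"
  by (rule finite_subset[of _ "{..degree p}"]) (auto intro: le_degree)

section \<open>Polynomials evaluated at Laurent series\<close>

definition pev :: "complex poly \<Rightarrow> complex fls \<Rightarrow> complex fls" where
  "pev p z = poly (map_poly fls_const p) z"

lemma pev_pCons [simp]: "pev (pCons a p) z = fls_const a + z * pev p z"
  by (simp add: pev_def map_poly_pCons)

lemma pev_0 [simp]: "pev 0 z = 0"
  by (simp add: pev_def)

lemma pev_add [simp]: "pev (p + q) z = pev p z + pev q z"
proof (induction p arbitrary: q)
  case (pCons a p)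
  then show ?case by (cases q) (simp add: algebra_simps fls_plus_const)
qed simp

lemma pev_smult [simp]: "pev (smult c p) z = fls_const c * pev p z"
  by (induction p) (simp_all add: algebra_simps)

lemma pev_uminus [simp]: "pev (- p) z = - pev p z"
  using pev_smult[of "-1" p z] by (simp del: pev_smult add: fls_const_uminus)

lemma pev_diff [simp]: "pev (p - q) z = pev p z - pev q z"
  using pev_add[of p "- q" z] by simp

lemma pev_mult [simp]: "pev (p * q) z = pev p z * pev q z"
  by (induction p) (simp_all add: algebra_simps)

lemma pev_1 [simp]: "pev 1 z = 1"
  by (simp add: one_pCons)

lemma pev_power [simp]: "pev (p ^ n) z = pev p z ^ n"
  by (induction n) simp_all

lemma pev_sum [simp]: "pev (\<Sum>i\<in>I. p i) z = (\<Sum>i\<in>I. pev (p i) z)"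
  by (induction I rule: infinite_finite_induct) simp_all

lemma pev_monom [simp]: "pev (monom c n) z = fls_const c * z ^ n"
  by (induction n) (simp_all add: monom_0 monom_Suc mult_ac)

lemma pev_pcompose [simp]: "pev (p \<circ>\<^sub>p q) z = pev p (pev q z)"
  by (induction p) (simp_all add: pcompose_pCons)

lemma pev_altdef: "degree p \<le> n \<Longrightarrow> pev p z = (\<Sum>i\<le>n. fls_const (coeff p i) * z ^ i)"
  using arg_cong[OF poly_as_sum_of_monoms'[of p n], of "\<lambda>p. pev p z"] by simp

lemma pev_reflect: "z \<noteq> 0 \<Longrightarrow> pev (reflect_poly p) z = z ^ degree p * pev p (inverse z)"
proof -
  assume z: "z \<noteq> 0"
  have "pev (reflect_poly p) z = (\<Sum>i\<le>degree p. fls_const (coeff p (degree p - i)) * z ^ i)"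
    by (subst pev_altdef[of _ "degree p"]) (auto simp: degree_reflect_poly_le coeff_reflect_poly intro!: sum.cong)
  also have "\<dots> = (\<Sum>i\<le>degree p. fls_const (coeff p i) * z ^ (degree p - i))"
    by (rule sum.reindex_bij_witness[of _ "\<lambda>i. degree p - i" "\<lambda>i. degree p - i"]) auto
  also have "\<dots> = (\<Sum>i\<le>degree p. z ^ degree p * (fls_const (coeff p i) * inverse z ^ i))"
    using z by (intro sum.cong refl) (simp add: power_diff power_inverse field_simps)
  also have "\<dots> = z ^ degree p * pev p (inverse z)"
    by (simp add: pev_altdef[OF order_refl] sum_distrib_left)
  finally show ?thesis .
qed

lemma pev_fps: "s $ 0 = 0 \<Longrightarrow> fps_to_fls (fps_of_poly p oo s) = pev p (fps_to_fls s)"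
  by (induction p)
     (simp_all add: fps_of_poly_pCons fps_compose_add_distrib fps_compose_mult_distrib
        fls_times_fps_to_fls mult.commute)

lemma pev_deriv: "fls_deriv (pev p z) = pev (pderiv p) z * fls_deriv z"
  by (induction p) (simp_all add: pderiv_pCons algebra_simps)

text \<open>\<open>lead z i c\<close>: the series \<open>z\<close> is \<open>c t\<^sup>i\<close> plus terms of higher order; \<open>c\<close> may vanish.\<close>

definition lead :: "complex fls \<Rightarrow> int \<Rightarrow> complex \<Rightarrow> bool" where
  "lead z i c \<longleftrightarrow> (\<forall>n<i. z $$ n = 0) \<and> z $$ i = c"

lemma lead_0 [simp]: "lead 0 i c \<longleftrightarrow> c = 0"
  by (auto simp: lead_def)

lemma lead_add: "lead a i c \<Longrightarrow> lead b i c' \<Longrightarrow> lead (a + b) i (c + c')"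
  by (simp add: lead_def)

lemma lead_diff: "lead a i c \<Longrightarrow> lead b i c' \<Longrightarrow> lead (a - b) i (c - c')"
  by (simp add: lead_def)

lemma lead_sum: "(\<And>k. k \<in> I \<Longrightarrow> lead (a k) i (c k)) \<Longrightarrow> lead (\<Sum>k\<in>I. a k) i (\<Sum>k\<in>I. c k)"
  by (induction I rule: infinite_finite_induct) (auto intro: lead_add)

lemma lead_weaken: "lead a i c \<Longrightarrow> j < i \<Longrightarrow> lead a j 0"
  by (simp add: lead_def)

lemma lead_zero_iff: "lead a i 0 \<longleftrightarrow> a = 0 \<or> fls_subdegree a > i"
proof
  assume a: "lead a i 0"
  show "a = 0 \<or> fls_subdegree a > i"
  proof (cases "a = 0")
    case False
    then have "i + 1 \<le> fls_subdegree a"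
      using a by (intro fls_subdegree_geI) (auto simp: lead_def order_le_less)
    then show ?thesis by simp
  qed simp
qed (auto simp: lead_def)

lemma lead_nonzero_iff: "c \<noteq> 0 \<Longrightarrow> lead a i c \<longleftrightarrow> a \<noteq> 0 \<and> fls_subdegree a = i \<and> a $$ i = c"
  by (auto simp: lead_def intro: fls_subdegree_eqI)

lemma lead_ge: "lead a i c \<Longrightarrow> a = 0 \<or> fls_subdegree a \<ge> i"
  using fls_subdegree_geI by (auto simp: lead_def)

lemma lead_mult:
  assumes "lead a i c" "lead b j c'"
  shows "lead (a * b) (i + j) (c * c')"
proof (cases "c = 0 \<or> c' = 0 \<or> a = 0 \<or> b = 0")
  case True
  then have "a = 0 \<or> b = 0 \<or> fls_subdegree a + fls_subdegree b > i + j"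
    using lead_ge[OF assms(1)] lead_ge[OF assms(2)] lead_zero_iff[of a i] lead_zero_iff[of b j] assms
    by fastforce
  then have "lead (a * b) (i + j) 0" unfolding lead_zero_iff
    by (cases "a = 0"; cases "b = 0") auto
  moreover have "c * c' = 0" using True assms by auto
  ultimately show ?thesis by (simp only:)
next
  case False
  then have "fls_subdegree a = i" "a $$ i = c" "fls_subdegree b = j" "b $$ j = c'"
    using assms by (auto simp: lead_nonzero_iff)
  then show ?thesis using False fls_times_base[of a b] by (simp add: lead_nonzero_iff)
qed

lemma lead_power: "lead a i c \<Longrightarrow> lead (a ^ n) (int n * i) (c ^ n)"
proof (induction n)
  case 0
  show ?case by (simp add: lead_def)
next
  case (Suc n)
  from lead_mult[OF Suc.prems Suc.IH[OF Suc.prems]] show ?case by (simp add: algebra_simps)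
qed

lemma lead_const: "lead (fls_const c) 0 c"
  by (simp add: lead_def)

lemma lead_deriv: "lead a i c \<Longrightarrow> lead (fls_deriv a) (i - 1) (of_int i * c)"
  by (simp add: lead_def)

lemma lead_inverse:
  assumes "lead a i c" "c \<noteq> 0"
  shows "lead (inverse a) (- i) (inverse c)"
proof -
  have a: "a \<noteq> 0" "fls_subdegree a = i" using assms by (auto simp: lead_nonzero_iff)
  then have "lead (inverse a) (- i) (inverse a $$ (- i))"
    by (simp add: lead_def)
  from lead_mult[OF this assms(1)] a have "inverse a $$ (- i) * c = 1" by (simp add: lead_def)
  then have "inverse a $$ (- i) = inverse c" using assms(2) by (simp add: field_simps)
  then show ?thesis using a by (simp add: lead_def)
qed

lemma lead_pev:
  assumes "lead y (- 1) \<zeta>" "degree p \<le> n"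
  shows "lead (pev p y) (- int n) (coeff p n * \<zeta> ^ n)"
proof -
  have "lead (fls_const (coeff p i) * y ^ i) (- int n) (if i = n then coeff p n * \<zeta> ^ n else 0)" if "i \<le> n" for i
  proof -
    have "lead (fls_const (coeff p i) * y ^ i) (- int i) (coeff p i * \<zeta> ^ i)"
      using lead_mult[OF lead_const lead_power[OF assms(1), of i], of "coeff p i"] by simp
    then show ?thesis using that lead_weaken by (cases "i = n") (auto simp: order_less_le)
  qed
  then have "lead (\<Sum>i\<le>n. fls_const (coeff p i) * y ^ i) (- int n) (\<Sum>i\<le>n. if i = n then coeff p n * \<zeta> ^ n else 0)"
    by (intro lead_sum) auto
  then show ?thesis using assms(2) by (simp add: pev_altdef)
qed

section \<open>Conjugate roots at infinity and the top part of a composition\<close>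

lemma conjugate_root_exists:
  fixes h :: "complex poly"
  assumes h: "lead_coeff h = 1" "degree h > 0" and \<zeta>: "\<zeta> ^ degree h = 1"
  obtains y where "lead y (- 1) \<zeta>" "pev h y = pev h fls_X_inv"
proof -
  define m where "m = degree h"
  have \<zeta>0: "\<zeta> \<noteq> 0" using \<zeta> h(2) by (auto simp: power_0_left)
  define H where "H = fps_of_poly (reflect_poly h)"
  have H0: "H $ 0 = 1" using h(1) by (simp add: H_def)
  obtain R where R: "R ^ m = H" "R $ 0 = 1"
    using fps_root_exists[OF H0 h(2)] by (auto simp: m_def)
  \<comment> \<open>\<open>k ^ m = 1 / h(1/t)\<close>: \<open>k\<close> is a local parameter at
    infinity, and conjugation multiplies it by a root of unity.\<close>
  define k where "k = fps_X * inverse R"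
  have k: "k $ 0 = 0" "k $ 1 = 1" using R(2) by (simp_all add: k_def)
  have kH: "k ^ m * H = fps_X ^ m"
  proof -
    have "k ^ m * H = fps_X ^ m * (inverse R * R) ^ m"
      unfolding k_def R(1)[symmetric] power_mult_distrib by (simp only: mult_ac)
    also have "inverse R * R = 1" using R(2) by (intro inverse_mult_eq_1) simp
    finally show ?thesis by simp
  qed
  define c where "c = fps_const (inverse \<zeta>) * k"
  have c: "c $ 0 = 0" "c $ 1 = inverse \<zeta>" using k by (simp_all add: c_def)
  define s where "s = fps_inv k oo c"
  \<comment> \<open>\<open>s\<close> solves \<open>k(s) = k(t) / \<zeta>\<close>. Taking
    \<open>m\<close>-th powers gives \<open>h(1/s) = h(1/t)\<close>, so \<open>y = 1/s\<close> is
    the conjugate.\<close>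
  have inv0: "fps_inv k $ 0 = 0" by (simp add: fps_inv_def)
  have s0: "s $ 0 = 0" using inv0 by (simp add: s_def)
  have ks: "k oo s = c"
  proof -
    have "k oo s = (k oo fps_inv k) oo c" unfolding s_def by (rule fps_compose_assoc[OF c(1) inv0])
    also have "\<dots> = c" using k c by (subst fps_inv_right) auto
    finally show ?thesis .
  qed
  have s1: "s $ 1 = inverse \<zeta>"
    using arg_cong[OF ks, of "\<lambda>f. f $ 1"] k c by (simp add: fps_compose_nth)
  have "s ^ m = k ^ m * (H oo s)"
  proof -
    have "s ^ m = fps_X ^ m oo s" using s0 by (simp add: fps_compose_power[symmetric])
    also have "\<dots> = c ^ m * (H oo s)"
      unfolding kH[symmetric] fps_compose_mult_distrib[OF s0] fps_compose_power[OF s0, symmetric] ks ..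
    also have "c ^ m = k ^ m"
    proof -
      have "fps_const (inverse \<zeta>) ^ m = fps_const (inverse \<zeta> ^ m)" by (simp add: fps_const_power)
      also have "inverse \<zeta> ^ m = 1" using \<zeta> by (simp add: m_def power_inverse)
      finally show ?thesis by (simp add: c_def power_mult_distrib)
    qed
    finally show ?thesis .
  qed
  then have "s ^ m * H = (k ^ m * H) * (H oo s)" by (simp add: mult_ac)
  then have eq: "s ^ m * H = fps_X ^ m * (H oo s)" unfolding kH .
  define S where "S = fps_to_fls s"
  have S: "lead S 1 (inverse \<zeta>)"
    unfolding lead_def
  proof (intro conjI allI impI)
    fix n :: int assume "n < 1"
    then show "S $$ n = 0" using s0 by (cases "n = 0") (auto simp: S_def)
  qed (use s1 in \<open>simp add: S_def\<close>)
  then have Snz: "S \<noteq> 0" using \<zeta>0 by (simp add: lead_nonzero_iff)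
  have HX: "fps_to_fls H = pev (reflect_poly h) fls_X"
    using pev_fps[of fps_X "reflect_poly h"] by (simp add: H_def)
  have HS: "fps_to_fls (H oo s) = pev (reflect_poly h) S"
    using pev_fps[OF s0, of "reflect_poly h"] by (simp add: H_def S_def)
  have "S ^ m * pev (reflect_poly h) fls_X = fls_X ^ m * pev (reflect_poly h) S"
    using arg_cong[OF eq, of fps_to_fls] HX HS
    by (simp add: fls_times_fps_to_fls fps_to_fls_power S_def)
  then have "S ^ m * (fls_X ^ m * pev h fls_X_inv) = fls_X ^ m * (S ^ m * pev h (inverse S))"
    using Snz by (simp add: pev_reflect m_def fls_inverse_X)
  then have "pev h (inverse S) = pev h fls_X_inv" using Snz by (simp add: mult_ac)
  moreover have "lead (inverse S) (- 1) \<zeta>" using lead_inverse[OF S] \<zeta>0 by simp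
  ultimately show ?thesis using that by blast
qed

lemma lead_X_inv: "lead fls_X_inv (- 1) 1"
  by (simp add: lead_def)

text \<open>If some \<open>r s\<close> were nonzero, the part of highest total degree
  \<open>k\<close> in \<open>x\<close> and \<open>y\<close> would contribute, as coefficient of
  \<open>t\<close> to the power \<open>- k\<close>, the value at \<open>\<zeta>\<close> of a nonzero
  polynomial of degree below \<open>m\<close>. That polynomial cannot vanish at all \<open>m\<close>
  roots of unity.\<close>

lemma normal_form_zero:
  fixes r :: "nat \<Rightarrow> complex poly"
  assumes m: "m > 0" and Y: "\<And>\<zeta>. \<zeta> ^ m = 1 \<Longrightarrow> lead (Y \<zeta>) (- 1) \<zeta>"
    and small: "\<And>\<zeta>. \<zeta> ^ m = 1 \<Longrightarrow> lead (\<Sum>s<m. pev (r s) fls_X_inv * Y \<zeta> ^ s) 0 0"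
    and s: "s < m"
  shows "r s = 0"
proof (rule ccontr)
  assume nz: "r s \<noteq> 0"
  define K where "K = (\<lambda>s. degree (r s) + s) ` {s. s < m \<and> r s \<noteq> 0}"
  define k where "k = Max K"
  have K: "finite K" "K \<noteq> {}" using nz s by (auto simp: K_def)
  have le: "degree (r s) + s \<le> k" if "s < m" "r s \<noteq> 0" for s
    unfolding k_def using K that by (intro Max_ge) (auto simp: K_def)
  have "k \<in> K" unfolding k_def using K by (rule Max_in)
  then obtain s0 where s0: "s0 < m" "r s0 \<noteq> 0" "k = degree (r s0) + s0" by (auto simp: K_def)
  define q where "q = (\<Sum>s<m. monom (if s \<le> k then coeff (r s) (k - s) else 0) s)"
  have q: "coeff q i = (if i < m \<and> i \<le> k then coeff (r i) (k - i) else 0)" for i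
  proof -
    have "coeff q i = (\<Sum>s<m. if s = i then (if s \<le> k then coeff (r s) (k - s) else 0) else 0)"
      unfolding q_def coeff_sum by (intro sum.cong) auto
    then show ?thesis by simp
  qed
  have "coeff q s0 \<noteq> 0" using s0 by (simp add: q)
  then have q0: "q \<noteq> 0" by auto
  have "degree q < m" using m by (intro degree_lessI) (auto simp: q)
  have "poly q \<zeta> = 0" if \<zeta>: "\<zeta> ^ m = 1" for \<zeta>
  proof -
    have "lead (pev (r s) fls_X_inv * Y \<zeta> ^ s) (- int k) ((if s \<le> k then coeff (r s) (k - s) else 0) * \<zeta> ^ s)" if s: "s < m" for s
    proof (cases "r s = 0")
      case False
      then have "degree (r s) \<le> k - s" "s \<le> k" using le[OF s] by auto
      then show ?thesis
        using lead_mult[OF lead_pev[OF lead_X_inv, of "r s" "k - s"] lead_power[OF Y[OF \<zeta>], of s]] by simp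
    qed simp
    then have "lead (\<Sum>s<m. pev (r s) fls_X_inv * Y \<zeta> ^ s) (- int k)
        (\<Sum>s<m. (if s \<le> k then coeff (r s) (k - s) else 0) * \<zeta> ^ s)"
      by (intro lead_sum) auto
    moreover have "lead (\<Sum>s<m. pev (r s) fls_X_inv * Y \<zeta> ^ s) (- int k) 0"
      using small[OF \<zeta>] by (cases "k = 0") (auto simp: lead_def)
    ultimately have "(\<Sum>s<m. (if s \<le> k then coeff (r s) (k - s) else 0) * \<zeta> ^ s) = 0"
      by (simp add: lead_def)
    then show ?thesis by (simp add: q_def poly_sum poly_monom)
  qed
  then have "{z. z ^ m = 1} \<subseteq> {z. poly q z = 0}" by auto
  then have "card {z :: complex. z ^ m = 1} \<le> card {z. poly q z = 0}"
    by (intro card_mono poly_roots_finite q0)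
  also have "\<dots> \<le> degree q" by (rule card_poly_roots_bound[OF q0])
  finally show False using card_roots_unity_eq[OF m] \<open>degree q < m\<close> by simp
qed

text \<open>Division with remainder yields the digits of \<open>f\<close> in base \<open>h\<close>.
  Where \<open>h(y) = h(x)\<close> the digits agree at \<open>x\<close> and \<open>y\<close>, so
  \<open>f(y)\<close> becomes an expression of \<open>y\<close>-degree below \<open>degree h\<close>
  with polynomial coefficients in \<open>x\<close>, as \<open>normal_form_zero\<close>
  demands.\<close>

lemma base_expansion:
  fixes h f :: "complex poly"
  assumes "degree h > 0"
  shows "\<exists>c. f = (\<Sum>s<degree h. monom 1 s * (c s \<circ>\<^sub>p h))"
proof (induction "degree f" arbitrary: f rule: less_induct)
  case less
  have r: "f mod h = (\<Sum>s<degree h. monom 1 s * ([:coeff (f mod h) s:] \<circ>\<^sub>p h))"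
  proof -
    have "degree (f mod h) < degree h \<or> f mod h = 0" using degree_mod_less[of h f] assms by fastforce
    then have "degree (f mod h) \<le> degree h - 1" using assms by auto
    then have "f mod h = (\<Sum>s\<le>degree h - 1. monom (coeff (f mod h) s) s)"
      by (rule poly_as_sum_of_monoms'[symmetric])
    also have "{..degree h - 1} = {..<degree h}" using assms by auto
    finally show ?thesis by (simp add: pcompose_pCons smult_monom mult.commute)
  qed
  show ?case
  proof (cases "degree f < degree h")
    case True
    then show ?thesis using r by (metis mod_poly_less)
  next
    case False': False
    have "degree (f div h) < degree f"
    proof (cases "f div h = 0")
      case False
      have "f mod h = 0 \<or> degree (f mod h) < degree h" using degree_mod_less[of h f] assms by fastforce
      then have "degree (f mod h) < degree h" using assms by auto
      moreover have "degree (h * (f div h)) = degree h + degree (f div h)"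
        using False assms by (intro degree_mult_eq) auto
      moreover have "degree f = degree (h * (f div h) + f mod h)" by simp
      ultimately show ?thesis using assms by (simp only: degree_add_eq_left)
    qed (use False' assms in simp)
    from less[OF this] obtain c where c: "f div h = (\<Sum>s<degree h. monom 1 s * (c s \<circ>\<^sub>p h))" by blast
    have "f = h * (f div h) + f mod h" by simp
    also have "\<dots> = (\<Sum>s<degree h. monom 1 s * (pCons (coeff (f mod h) s) (c s) \<circ>\<^sub>p h))"
      by (subst r, subst c) (simp add: sum_distrib_left pcompose_pCons sum.distrib[symmetric] algebra_simps)
    finally show ?thesis by (intro exI)
  qed
qed


text \<open>With \<open>x = 1/t\<close> and \<open>y\<close> a conjugate root of \<open>h y = h x\<close>, the Wronskian of \<open>f1(x)\<close> and
  \<open>f1(y)\<close> is small by the gap, but divisible by \<open>(x y)\<^sup>N\<close>.\<close>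

lemma top_part_in_image:
  fixes g h a f2 :: "complex poly"
  assumes h: "lead_coeff h = 1" "degree h > 0"
    and f: "g \<circ>\<^sub>p h = monom 1 N * a + f2" and a: "a \<noteq> 0"
    and gap: "N + degree a + degree f2 + degree h < 2 * N"
  shows "\<exists>g1. monom 1 N * a = g1 \<circ>\<^sub>p h"
proof -
  define m where "m = degree h"
  define f1 where "f1 = monom 1 N * a"
  define n1 where "n1 = N + degree a"
  define n2 where "n2 = degree f2"
  have f1: "f1 \<noteq> 0" "degree f1 = n1"
    using a by (simp_all add: f1_def n1_def degree_mult_eq degree_monom_eq monom_eq_0_iff)
  have "\<exists>y. lead y (- 1) \<zeta> \<and> pev h y = pev h fls_X_inv" if "\<zeta> ^ m = 1" for \<zeta>
    using conjugate_root_exists[OF h, of \<zeta>] that by (auto simp: m_def)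
  then obtain Y where Y: "\<And>\<zeta>. \<zeta> ^ m = 1 \<Longrightarrow> lead (Y \<zeta>) (- 1) \<zeta>" "\<And>\<zeta>. \<zeta> ^ m = 1 \<Longrightarrow> pev h (Y \<zeta>) = pev h fls_X_inv"
    by metis
  let ?x = "fls_X_inv :: complex fls" and ?D = "fls_deriv :: complex fls \<Rightarrow> complex fls"
  \<comment> \<open>\<open>b\<close> is \<open>x * f1'\<close> stripped of \<open>x ^ N\<close>. The
    factor \<open>x * h'\<close> in \<open>P\<close> serves to eliminate the derivative of
    \<open>y\<close> by means of \<open>h'(y) * y' = h'(x) * x'\<close>.\<close>
  define b where "b = smult (of_nat N) a + [:0, 1:] * pderiv a"
  define P where "P = [:0, 1:] * pderiv h * a"
  have f1': "[:0, 1:] * pderiv f1 = monom 1 N * b"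
  proof -
    define X where "X = [:0, 1 :: complex:]"
    have "X * pderiv (monom 1 N) = smult (of_nat N) (monom 1 N)"
    proof (cases N)
      case (Suc k)
      have "pderiv (monom 1 (Suc k)) = (monom (of_nat (Suc k)) k :: complex poly)"
        by (simp only: pderiv_monom diff_Suc_1 mult_1_right)
      then show ?thesis unfolding Suc by (simp add: X_def smult_monom monom_Suc)
    qed simp
    then have "X * pderiv f1 = monom 1 N * (X * pderiv a) + a * smult (of_nat N) (monom 1 N)"
      unfolding f1_def pderiv_mult distrib_left by (metis mult.left_commute)
    also have "\<dots> = monom 1 N * b" by (simp add: b_def X_def[symmetric] algebra_simps)
    finally show ?thesis by (simp only: X_def)
  qed
  have nonzero: "Y \<zeta> \<noteq> 0" "\<zeta> \<noteq> 0" if "\<zeta> ^ m = 1" for \<zeta>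
  proof -
    show "\<zeta> \<noteq> 0" using that h(2) by (auto simp: m_def power_0_left)
    then show "Y \<zeta> \<noteq> 0" using Y(1)[OF that] by (auto simp: lead_def)
  qed
  have Dx: "?D ?x = - (?x ^ 2)"
    by (intro fls_eqI) (auto simp: fls_X_inv_power_nth)
  define F where "F = pev f1 ?x"
  have F: "lead F (- int n1) (lead_coeff f1)"
    using lead_pev[OF lead_X_inv order_refl, of f1] by (simp add: F_def f1)
  define u where "u \<zeta> = F - pev f1 (Y \<zeta>)" for \<zeta>
  define R where "R \<zeta> = pev P ?x * pev b (Y \<zeta>) - pev b ?x * pev P (Y \<zeta>)" for \<zeta>
  define W where "W \<zeta> = u \<zeta> * ?D F - F * ?D (u \<zeta>)" for \<zeta>
  have u: "\<exists>c. lead (u \<zeta>) (- int n2) c" if \<zeta>: "\<zeta> ^ m = 1" for \<zeta>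
  proof -
    \<comment> \<open>\<open>g(h)\<close> takes the same value at \<open>x\<close> and
      \<open>y\<close>, so the difference of the values of \<open>f1\<close> is that of
      \<open>f2\<close> up to sign and has a pole of order at most \<open>n2\<close>.\<close>
    have "pev (g \<circ>\<^sub>p h) (Y \<zeta>) = pev (g \<circ>\<^sub>p h) ?x" using Y(2)[OF \<zeta>] by simp
    then have "u \<zeta> = pev f2 (Y \<zeta>) - pev f2 ?x"
      unfolding f f1_def[symmetric] by (simp add: u_def F_def algebra_simps)
    then show ?thesis
      using lead_diff[OF lead_pev[OF Y(1)[OF \<zeta>], of f2 n2] lead_pev[OF lead_X_inv, of f2 n2]]
      by (auto simp: n2_def)
  qed
  have W: "(?x * Y \<zeta> * pev (pderiv h) (Y \<zeta>)) * W \<zeta> = ?D ?x * ?x ^ N * Y \<zeta> ^ N * R \<zeta>"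
    if \<zeta>: "\<zeta> ^ m = 1" for \<zeta>
  proof -
    define y where "y = Y \<zeta>"
    have hy: "pev (pderiv h) y * ?D y = pev (pderiv h) ?x * ?D ?x"
      using arg_cong[OF Y(2)[OF \<zeta>], of ?D] by (simp only: pev_deriv y_def)
    have bx: "z * pev (pderiv f1) z = z ^ N * pev b z" for z
      using arg_cong[OF f1', of "\<lambda>p. pev p z"] by simp
    have ax: "pev f1 z = z ^ N * pev a z" for z by (simp add: f1_def)
    have "W \<zeta> = F * ?D (pev f1 y) - pev f1 y * ?D F"
      by (simp add: W_def u_def y_def algebra_simps)
    also have "\<dots> = F * pev (pderiv f1) y * ?D y - pev f1 y * pev (pderiv f1) ?x * ?D ?x"
      by (simp add: F_def pev_deriv)
    finally have "(?x * y * pev (pderiv h) y) * W \<zeta>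
        = F * ?x * (y * pev (pderiv f1) y) * (pev (pderiv h) y * ?D y)
          - pev f1 y * y * (?x * pev (pderiv f1) ?x) * pev (pderiv h) y * ?D ?x"
      by (simp add: algebra_simps)
    also have "\<dots> = ?D ?x * ?x ^ N * y ^ N * R \<zeta>"
      unfolding hy bx F_def ax R_def P_def y_def[symmetric] by (simp add: algebra_simps)
    finally show ?thesis by (simp only: y_def)
  qed
  have small: "lead (R \<zeta>) 0 0" if \<zeta>: "\<zeta> ^ m = 1" for \<zeta>
  proof -
    obtain c where c: "lead (u \<zeta>) (- int n2) c" using u[OF \<zeta>] by blast
    have "\<exists>c. lead (W \<zeta>) (- int n2 + (- int n1 - 1)) c"
    proof -
      have "lead (F * ?D (u \<zeta>)) (- int n2 + (- int n1 - 1)) (lead_coeff f1 * (of_int (- int n2) * c))"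
        using lead_mult[OF F lead_deriv[OF c]] by (simp add: algebra_simps)
      from lead_diff[OF lead_mult[OF c lead_deriv[OF F]] this] show ?thesis unfolding W_def by blast
    qed
    then obtain c1 where c1: "lead (W \<zeta>) (- int n2 + (- int n1 - 1)) c1" by blast
    have "degree (pderiv h) \<le> m - 1" by (simp add: degree_pderiv m_def)
    note c2 = lead_pev[OF Y(1)[OF \<zeta>] this]
    have ix: "lead (inverse ?x) 1 1" using lead_inverse[OF lead_X_inv] by simp
    have iy: "lead (inverse (Y \<zeta>)) 1 (inverse \<zeta>)" using lead_inverse[OF Y(1)[OF \<zeta>]] nonzero[OF \<zeta>] by simp
    have "R \<zeta> = - ((?x * Y \<zeta> * pev (pderiv h) (Y \<zeta>)) * W \<zeta> * inverse ?x ^ (N + 2) * inverse (Y \<zeta>) ^ N)"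
    proof -
      have "r = - ((- (x ^ 2) * x ^ N * y ^ N * r) * inverse x ^ (N + 2) * inverse y ^ N)"
        if "x \<noteq> 0" "y \<noteq> 0" for x y r :: "complex fls"
        using that by (simp add: field_simps power_add power2_eq_square)
      then show ?thesis unfolding W[OF \<zeta>] Dx using nonzero[OF \<zeta>] fls_X_inv_nonzero by blast
    qed
    then have R: "R \<zeta> = 0 - (?x * Y \<zeta> * pev (pderiv h) (Y \<zeta>)) * W \<zeta> * inverse ?x ^ (N + 2) * inverse (Y \<zeta>) ^ N" by simp
    \<comment> \<open>The orders add up to \<open>2 * N - n1 - n2 - m\<close>, which the gap makes
      positive.\<close>
    let ?i = "(- 1 + - 1 + - int (m - 1)) + (- int n2 + (- int n1 - 1)) + int (N + 2) * 1 + int N * 1"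
    note L = lead_mult[OF lead_mult[OF lead_mult[OF lead_mult[OF lead_mult[OF lead_X_inv Y(1)[OF \<zeta>]] c2] c1]
      lead_power[OF ix, of "N + 2"]] lead_power[OF iy, of N]]
    have "lead 0 ?i 0" by simp
    from lead_diff[OF this L] have "\<exists>c. lead (R \<zeta>) ?i c" unfolding R[symmetric] by blast
    then obtain c3 where "lead (R \<zeta>) ?i c3" by blast
    moreover have "0 < ?i" using gap h(2) by (simp add: n1_def n2_def m_def algebra_simps)
    ultimately show ?thesis by (rule lead_weaken)
  qed
  have R0: "R \<zeta> = 0" if \<zeta>: "\<zeta> ^ m = 1" for \<zeta>
  proof -
    obtain cb where cb: "b = (\<Sum>s<m. monom 1 s * (cb s \<circ>\<^sub>p h))"
      using base_expansion[OF h(2)] by (auto simp: m_def)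
    obtain cP where cP: "P = (\<Sum>s<m. monom 1 s * (cP s \<circ>\<^sub>p h))"
      using base_expansion[OF h(2)] by (auto simp: m_def)
    define r where "r s = P * (cb s \<circ>\<^sub>p h) - b * (cP s \<circ>\<^sub>p h)" for s
    have Rr: "R \<zeta> = (\<Sum>s<m. pev (r s) ?x * Y \<zeta> ^ s)" if \<zeta>: "\<zeta> ^ m = 1" for \<zeta>
    proof -
      have "pev b (Y \<zeta>) = (\<Sum>s<m. pev (cb s \<circ>\<^sub>p h) ?x * Y \<zeta> ^ s)"
        by (subst cb) (simp add: Y(2)[OF \<zeta>] mult.commute)
      moreover have "pev P (Y \<zeta>) = (\<Sum>s<m. pev (cP s \<circ>\<^sub>p h) ?x * Y \<zeta> ^ s)"
        by (subst cP) (simp add: Y(2)[OF \<zeta>] mult.commute)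
      ultimately show ?thesis
        by (simp add: R_def r_def sum_distrib_left sum_subtractf[symmetric] left_diff_distrib mult.assoc)
    qed
    have "r s = 0" if "s < m" for s
    proof (rule normal_form_zero[OF _ Y(1) _ that])
      show "m > 0" using h by (simp add: m_def)
      show "lead (\<Sum>s<m. pev (r s) ?x * Y \<zeta> ^ s) 0 0" if "\<zeta> ^ m = 1" for \<zeta>
        using small[OF that] Rr[OF that] by simp
    qed
    then show ?thesis unfolding Rr[OF \<zeta>] by simp
  qed
  \<comment> \<open>A vanishing Wronskian makes \<open>u\<close> proportional to \<open>F\<close>.
    But \<open>F\<close> has a pole of order \<open>n1\<close>, and that of \<open>u\<close> has
    order at most \<open>n2 < n1\<close>; comparing leading coefficients gives the
    contradiction.\<close>
  have u0: "u \<zeta> = 0" if \<zeta>: "\<zeta> ^ m = 1" for \<zeta>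
  proof (rule ccontr)
    assume nz: "u \<zeta> \<noteq> 0"
    have "lead (pev (pderiv h) (Y \<zeta>)) (- int (m - 1)) (of_nat m * \<zeta> ^ (m - 1))"
    proof -
      have "degree (pderiv h) \<le> m - 1" by (simp add: degree_pderiv m_def)
      moreover have "coeff (pderiv h) (m - 1) = of_nat m"
        using h by (simp add: coeff_pderiv m_def)
      ultimately show ?thesis using lead_pev[OF Y(1)[OF \<zeta>], of "pderiv h" "m - 1"] by simp
    qed
    moreover have "of_nat m * \<zeta> ^ (m - 1) \<noteq> 0" using nonzero[OF \<zeta>] h by (simp add: m_def)
    ultimately have "pev (pderiv h) (Y \<zeta>) \<noteq> 0" by (auto simp: lead_def)
    then have W0: "W \<zeta> = 0" using W[OF \<zeta>] R0[OF \<zeta>] nonzero[OF \<zeta>] by simp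
    obtain c where c: "lead (u \<zeta>) (- int n2) c" using u[OF \<zeta>] by blast
    define k where "k = fls_subdegree (u \<zeta>)"
    define uk where "uk = u \<zeta> $$ k"
    have uk: "uk \<noteq> 0" "lead (u \<zeta>) k uk" using nz by (auto simp: uk_def k_def lead_def)
    have "k \<ge> - int n2" using lead_ge[OF c] nz by (simp add: k_def)
    moreover have "n2 < n1" using gap by (simp add: n1_def n2_def)
    ultimately have kn: "k + int n1 \<noteq> 0" by simp
    have "lead (F * ?D (u \<zeta>)) (k + (- int n1 - 1)) (lead_coeff f1 * (of_int k * uk))"
      using lead_mult[OF F lead_deriv[OF uk(2)]] by (simp add: algebra_simps)
    from lead_diff[OF lead_mult[OF uk(2) lead_deriv[OF F]] this]
    have "uk * (of_int (- int n1) * lead_coeff f1) - lead_coeff f1 * (of_int k * uk) = 0"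
      using W0 by (simp add: W_def)
    moreover have "uk * lead_coeff f1 * of_int (k + int n1)
        = - (uk * (of_int (- int n1) * lead_coeff f1) - lead_coeff f1 * (of_int k * uk))"
      by (simp add: algebra_simps)
    ultimately have "uk * lead_coeff f1 * of_int (k + int n1) = 0" by simp
    moreover have "lead_coeff f1 \<noteq> 0" using f1(1) by simp
    ultimately show False using uk(1) kn by (metis mult_eq_0_iff of_int_eq_0_iff)
  qed
  obtain c where c: "f1 = (\<Sum>s<m. monom 1 s * (c s \<circ>\<^sub>p h))"
    using base_expansion[OF h(2)] by (auto simp: m_def)
  \<comment> \<open>The normal form of \<open>f1(y) - f1(x)\<close> as an expression in
    \<open>y\<close>: its vanishing identifies \<open>f1\<close> with its digit \<open>0\<close>, a
    polynomial in \<open>h\<close>.\<close>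
  define r where "r s = (c s \<circ>\<^sub>p h) - (if s = 0 then f1 else 0)" for s
  have m0: "m > 0" using h by (simp add: m_def)
  have "r 0 = 0"
  proof (rule normal_form_zero[OF m0 Y(1) _ m0])
    fix \<zeta> :: complex assume \<zeta>: "\<zeta> ^ m = 1"
    have "pev f1 (Y \<zeta>) = (\<Sum>s<m. pev (c s \<circ>\<^sub>p h) ?x * Y \<zeta> ^ s)"
      by (subst c) (simp add: Y(2)[OF \<zeta>] mult.commute)
    moreover have "pev f1 ?x = (\<Sum>s<m. pev (if s = 0 then f1 else 0) ?x * Y \<zeta> ^ s)"
      using m0 by (simp add: if_distrib[of "\<lambda>p. pev p _"] if_distrib[of "\<lambda>p. p * _"] sum.delta' cong: if_cong)
    ultimately have "(\<Sum>s<m. pev (r s) ?x * Y \<zeta> ^ s) = pev f1 (Y \<zeta>) - pev f1 ?x"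
      by (simp add: r_def sum_subtractf left_diff_distrib del: pev_pcompose)
    also have "\<dots> = 0" using u0[OF \<zeta>] by (simp add: u_def F_def)
    finally show "lead (\<Sum>s<m. pev (r s) ?x * Y \<zeta> ^ s) 0 0" by simp
  qed
  then have "f1 = c 0 \<circ>\<^sub>p h" by (simp add: r_def)
  then show ?thesis by (auto simp: f1_def)
qed

section \<open>Multiplicities and gaps of lacunary polynomials\<close>

lemma num_terms_mono: "(\<And>m. coeff p m \<noteq> 0 \<Longrightarrow> coeff q m \<noteq> 0) \<Longrightarrow> num_terms p \<le> num_terms (q :: 'a::zero poly)"
  unfolding num_terms_def by (intro card_mono finite_support) auto

text \<open>Removing a factor \<open>x\<close> does not change the order at a nonzero point. Once
  there is a constant term, differentiation kills it and lowers a positive order by only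
  one.\<close>

lemma order_less_num_terms:
  fixes p :: "complex poly"
  assumes "a \<noteq> 0" "p \<noteq> 0"
  shows "order a p < num_terms p"
  using assms(2)
proof (induction "degree p" arbitrary: p rule: less_induct)
  case less
  show ?case
  proof (cases "coeff p 0 = 0")
    case True
    then obtain q where q: "p = pCons 0 q" by (cases p) auto
    with less.prems have q0: "q \<noteq> 0" by auto
    have "degree q < degree p" using q0 q by simp
    from less.hyps[OF this q0] have "order a q < num_terms q" .
    moreover have "order a p = order a q"
    proof -
      have "p = [:0, 1:] * q" using q by simp
      moreover have "order a [:0, 1:] = 0" using assms(1) by (intro order_0I) simp
      ultimately show ?thesis using less.prems order_mult[of "[:0, 1:]" q a] by simp
    qed
    moreover have "num_terms q = num_terms p"
      unfolding num_terms_def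
    proof (rule bij_betw_same_card[of Suc], rule bij_betwI')
      show "\<exists>x\<in>{m. coeff q m \<noteq> 0}. y = Suc x" if "y \<in> {m. coeff p m \<noteq> 0}" for y
        using that q by (cases y) auto
    qed (use q in auto)
    ultimately show ?thesis by simp
  next
    case False
    show ?thesis
    proof (cases "pderiv p = 0 \<or> order a p = 0")
      case True
      have "order a p = 0" if "pderiv p = 0"
      proof -
        have "degree p = 0" using that by (simp add: pderiv_eq_0_iff)
        then obtain c where "p = [:c:]" by (rule degree_eq_zeroE)
        then show ?thesis using less.prems by (intro order_0I) simp
      qed
      then have "order a p = 0" using True by blast
      moreover have "num_terms p > 0"
        using False unfolding num_terms_def by (auto simp: card_gt_0_iff finite_support)
      ultimately show ?thesis by simp
    next
      case F: False
      then have "degree (pderiv p) < degree p" by (auto simp: degree_pderiv pderiv_eq_0_iff)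
      moreover have "pderiv p \<noteq> 0" using F by blast
      ultimately have "order a (pderiv p) < num_terms (pderiv p)" by (rule less.hyps)
      moreover have "order a p = Suc (order a (pderiv p))" 
        using F less.prems by (intro order_pderiv) (auto simp: order_root)
      moreover have "num_terms (pderiv p) < num_terms p"
      proof -
        have "num_terms (pderiv p) = card (Suc ` {m. coeff (pderiv p) m \<noteq> 0})"
          by (simp add: num_terms_def card_image)
        also have "\<dots> < num_terms p"
          unfolding num_terms_def
        proof (intro psubset_card_mono finite_support psubsetI)
          show "Suc ` {m. coeff (pderiv p) m \<noteq> 0} \<subseteq> {m. coeff p m \<noteq> 0}"
            by (auto simp: coeff_pderiv)
          show "Suc ` {m. coeff (pderiv p) m \<noteq> 0} \<noteq> {m. coeff p m \<noteq> 0}"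
            using False by blast
        qed
        finally show ?thesis .
      qed
      ultimately show ?thesis by simp
    qed
  qed
qed

lemma pcompose_power: "(p ^ n) \<circ>\<^sub>p q = (p \<circ>\<^sub>p q :: 'a::comm_ring_1 poly) ^ n"
  by (induction n) (simp_all add: pcompose_mult pcompose_1)

lemma order_power: "p \<noteq> 0 \<Longrightarrow> order a (p ^ n) = n * order a (p :: complex poly)"
  by (induction n) (simp_all add: order_mult)

text \<open>\<open>A k\<close> collects the exponents within \<open>(2 ^ k - 1) * m\<close> of
  \<open>n1\<close>. If its minimum has no gap below, an offending exponent is at most twice as far
  away plus \<open>m\<close>, hence new in \<open>A (Suc k)\<close>. So one of the levels
  \<open>0\<close> to \<open>l\<close> succeeds.\<close>

lemma gap_exists:
  fixes E :: "nat set"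
  assumes E: "finite E" "card E \<le> l" "n1 \<in> E" "\<And>n. n \<in> E \<Longrightarrow> n \<le> n1"
  obtains N where "N \<in> E" "n1 \<le> N + 2 ^ l * m" "\<And>n. n \<in> E \<Longrightarrow> n < N \<Longrightarrow> n1 + n + m < 2 * N"
proof -
  define A where "A k = {n \<in> E. n1 + m \<le> n + 2 ^ k * m}" for k :: nat
  define N where "N k = Min (A k)" for k
  have A: "finite (A k)" "n1 \<in> A k" for k
    using E by (auto simp: A_def)
  have N: "N k \<in> A k" "\<And>n. n \<in> A k \<Longrightarrow> N k \<le> n" for k
    using A[of k] by (auto simp: N_def intro!: Min_in)
  have "\<exists>k\<le>l. \<forall>n\<in>E. n < N k \<longrightarrow> n1 + n + m < 2 * N k"
  proof (rule ccontr)
    assume bad: "\<not> ?thesis"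
    have "k \<le> Suc l \<Longrightarrow> card (A k) > k" for k
    proof (induction k)
      case 0
      have "A 0 \<noteq> {}" using A by auto
      then show ?case using A(1)[of 0] by (simp add: card_gt_0_iff)
    next
      case (Suc k)
      then obtain n where n: "n \<in> E" "n < N k" "2 * N k \<le> n1 + n + m"
        using bad by (metis Suc_le_mono not_less)
      have "n1 + m \<le> N k + 2 ^ k * m" using N(1)[of k] by (simp add: A_def)
      then have "n \<in> A (Suc k)" using n by (simp add: A_def)
      moreover have "n \<notin> A k" using N(2)[of n k] n(2) by auto
      moreover have "A k \<subseteq> A (Suc k)" by (auto simp: A_def intro: order_trans)
      ultimately have "card (A k) < card (A (Suc k))" by (intro psubset_card_mono A) auto
      then show ?case using Suc by simp
    qed
    from this[of "Suc l"] have "l < card (A (Suc l))" by simp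
    also have "\<dots> \<le> card E" by (intro card_mono E) (auto simp: A_def)
    finally show False using E by simp
  qed
  then obtain k where k: "k \<le> l" "\<And>n. n \<in> E \<Longrightarrow> n < N k \<Longrightarrow> n1 + n + m < 2 * N k" by blast
  show ?thesis
  proof (rule that[of "N k"])
    show "N k \<in> E" using N(1)[of k] by (simp add: A_def)
    have "n1 \<le> N k + 2 ^ k * m" using N(1)[of k] by (simp add: A_def)
    also have "2 ^ k * m \<le> 2 ^ l * m" using k(1) by (intro mult_right_mono power_increasing) auto
    finally show "n1 \<le> N k + 2 ^ l * m" by simp
  qed (use k in auto)
qed

text \<open>The top part is \<open>g1(h)\<close> with \<open>g1\<close> of the same degree as \<open>g\<close>, and almost divisible by its leading
  monomial. So \<open>0\<close> is a root of \<open>g1\<close> of multiplicity close to the degree, and the lacunary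
  polynomial \<open>g1(h)\<close> inherits this multiplicity at a nonzero root of \<open>h\<close>.\<close>

lemma outer_degree_bound:
  fixes g h :: "complex poly"
  assumes h: "lead_coeff h = 1" "degree h > 0" "coeff h 0 = 0" "h \<noteq> monom 1 (degree h)"
    and g: "degree g > 0" and l: "num_terms (g \<circ>\<^sub>p h) \<le> l"
  shows "degree g \<le> l + 2 ^ l"
proof -
  define m where "m = degree h"
  define f where "f = g \<circ>\<^sub>p h"
  define E where "E = {n. coeff f n \<noteq> 0}"
  have degf: "degree f = degree g * m" by (simp add: f_def m_def degree_pcompose)
  have f0: "f \<noteq> 0" using degf g h by (auto simp: m_def)
  obtain N where N: "N \<in> E" "degree f \<le> N + 2 ^ l * m" "\<And>n. n \<in> E \<Longrightarrow> n < N \<Longrightarrow> degree f + n + m < 2 * N"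
  proof -
    have "finite E" unfolding E_def by (rule finite_support)
    moreover have "card E \<le> l" using l by (simp add: E_def f_def num_terms_def)
    moreover have "degree f \<in> E" using f0 by (simp add: E_def)
    moreover have "n \<le> degree f" if "n \<in> E" for n using that by (auto simp: E_def intro: le_degree)
    ultimately show ?thesis using gap_exists[of E l "degree f" m] that by metis
  qed
  have Nle: "N \<le> degree f" using N(1) by (auto simp: E_def intro: le_degree)
  define a where "a = poly_shift N f"
  define f2 where "f2 = poly_cutoff N f"
  have split: "f = monom 1 N * a + f2"
    by (intro poly_eqI) (auto simp: a_def f2_def coeff_monom_mult coeff_poly_shift coeff_poly_cutoff)
  have ca: "coeff a n = coeff f (n + N)" for n by (simp add: a_def coeff_poly_shift)
  have dega: "degree a = degree f - N"
  proof (rule antisym)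
    show "degree a \<le> degree f - N" by (intro degree_le) (auto simp: ca coeff_eq_0)
    show "degree f - N \<le> degree a" using f0 Nle by (intro le_degree) (simp add: ca)
  qed
  have a0: "a \<noteq> 0" using N(1) ca[of 0] by (auto simp: E_def)
  define f1 where "f1 = monom 1 N * a"
  have "\<exists>g1. f1 = g1 \<circ>\<^sub>p h"
  proof (cases "f2 = 0")
    case True
    then have "f1 = g \<circ>\<^sub>p h" using split by (simp add: f1_def f_def)
    then show ?thesis by (rule exI)
  next
    case False
    then have "coeff f2 (degree f2) \<noteq> 0" by simp
    then have "degree f2 \<in> E" "degree f2 < N"
      by (auto simp: f2_def coeff_poly_cutoff E_def split: if_splits)
    from N(3)[OF this] show ?thesis
      using top_part_in_image[OF h(1,2), of g N a f2] split a0 Nle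
      by (auto simp: f1_def f_def dega m_def)
  qed
  then obtain g1 where g1: "f1 = g1 \<circ>\<^sub>p h" by blast
  have f1: "f1 \<noteq> 0" using a0 by (simp add: f1_def monom_eq_0_iff)
  then have g1nz: "g1 \<noteq> 0" using g1 by auto
  have h0: "h \<noteq> 0" using h by auto
  obtain gt where gt: "g1 = [:0, 1:] ^ order 0 g1 * gt" "poly gt 0 \<noteq> 0"
    using order_decomp[OF g1nz, of 0] by (auto simp: dvd_iff_poly_eq_0)
  obtain ht where ht: "h = [:0, 1:] ^ order 0 h * ht" "poly ht 0 \<noteq> 0"
    using order_decomp[OF h0, of 0] by (auto simp: dvd_iff_poly_eq_0)
  define \<mu> where "\<mu> = order 0 g1"
  have f1h: "f1 = h ^ \<mu> * (gt \<circ>\<^sub>p h)"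
    unfolding g1 by (subst gt(1)) (simp add: pcompose_mult pcompose_power pcompose_pCons \<mu>_def)
  \<comment> \<open>As \<open>h(0) = 0\<close> and \<open>gt(0)\<close> is nonzero,
    \<open>f1\<close> owes its whole multiplicity at \<open>0\<close> to
    \<open>h ^ \<mu>\<close>.\<close>
  have "N \<le> \<mu> * m"
  proof -
    have "[:- 0, 1:] ^ N dvd f1" by (simp add: f1_def monom_altdef)
    then have "N \<le> order 0 f1" using f1 order_divides[of 0 N f1] by blast
    also have "\<dots> = \<mu> * order 0 h + order 0 (gt \<circ>\<^sub>p h)"
      using f1 f1h by (simp add: order_mult order_power h0)
    also have "order 0 (gt \<circ>\<^sub>p h) = 0"
      using gt(2) h(3) by (intro order_0I) (simp add: poly_pcompose poly_0_coeff_0)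
    also have "order 0 h \<le> m" using order_degree[OF h0] by (simp add: m_def)
    finally show ?thesis by simp
  qed
  moreover have "\<mu> < l"
  proof -
    \<comment> \<open>Otherwise \<open>h\<close> would be the excluded monomial. A root of
      \<open>ht\<close> is a nonzero root of \<open>h\<close>.\<close>
    have "degree ht \<noteq> 0"
    proof
      assume "degree ht = 0"
      then obtain c where c: "ht = [:c:]" by (rule degree_eq_zeroE)
      have hm: "h = monom c (order 0 h)"
        by (subst ht(1)) (simp add: c monom_altdef)
      then have "c \<noteq> 0" using h0 by auto
      then have "degree h = order 0 h" "c = 1"
        using arg_cong[OF hm, of degree] arg_cong[OF hm, of lead_coeff] h(1) by (simp_all add: degree_monom_eq)
      then show False using hm h(4) by simp
    qed
    then obtain \<beta> where \<beta>: "poly ht \<beta> = 0"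
      using fundamental_theorem_of_algebra_alt[of ht] by (metis degree_pCons_0 pCons_0_0)
    then have "\<beta> \<noteq> 0" using ht(2) by auto
    have "poly h \<beta> = 0" by (subst ht(1)) (simp add: \<beta>)
    then have "[:-\<beta>, 1:] dvd h" by (simp add: dvd_iff_poly_eq_0)
    then have "[:-\<beta>, 1:] ^ \<mu> dvd f1" unfolding f1h by (intro dvd_mult2 dvd_power_same)
    then have "\<mu> \<le> order \<beta> f1" using f1 by (simp add: order_divides)
    also have "\<dots> < num_terms f1" by (rule order_less_num_terms[OF \<open>\<beta> \<noteq> 0\<close> f1])
    also have "\<dots> \<le> num_terms f"
      by (rule num_terms_mono) (auto simp: f1_def coeff_monom_mult ca split: if_splits)
    finally show ?thesis using l by (simp add: f_def)
  qed
  moreover have "degree g * m \<le> N + 2 ^ l * m" using N(2) by (simp add: degf)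
  ultimately have "degree g * m \<le> (\<mu> + 2 ^ l) * m" by (simp add: algebra_simps)
  then have "degree g \<le> \<mu> + 2 ^ l" using h(2) by (simp add: m_def)
  then show ?thesis using \<open>\<mu> < l\<close> by simp
qed

section \<open>Laurent polynomials\<close>

text \<open>Divided by the largest power with nonzero coefficient, the sum tends to that
  coefficient. Exponents are real because the generators become fractions.\<close>

lemma generalized_poly_eventually_nonzero:
  fixes c :: "real \<Rightarrow> complex"
  assumes "finite V" "v \<in> V" "c v \<noteq> 0"
  shows "\<forall>\<^sub>F t in at_top. (\<Sum>v\<in>V. c v * of_real (t powr v)) \<noteq> 0"
proof -
  define W where "W = {v \<in> V. c v \<noteq> 0}"
  define w where "w = Max W"
  have W: "finite W" "v \<in> W" using assms by (auto simp: W_def)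
  have "W \<noteq> {}" using W(2) by auto
  then have w: "w \<in> W" "\<And>u. u \<in> W \<Longrightarrow> u \<le> w"
    using W(1) Max_in[OF W(1)] unfolding w_def by auto
  have "((\<lambda>t. \<Sum>v\<in>W. c v * of_real (t powr (v - w))) \<longlongrightarrow> (\<Sum>v\<in>W. if v = w then c w else 0)) at_top"
  proof (rule tendsto_sum)
    fix v assume v: "v \<in> W"
    show "((\<lambda>t. c v * of_real (t powr (v - w))) \<longlongrightarrow> (if v = w then c w else 0)) at_top"
    proof (cases "v = w")
      case True
      have "\<forall>\<^sub>F t in at_top. c v * of_real (t powr (v - w)) = c w"
        using eventually_gt_at_top[of 0] by eventually_elim (simp add: True)
      then show ?thesis using True by (simp add: tendsto_eventually)
    next
      case False
      then have "v - w < 0" using w(2)[OF v] by simp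
      then have "((\<lambda>t. t powr (v - w)) \<longlongrightarrow> 0) at_top"
        by (rule tendsto_neg_powr) (rule filterlim_ident)
      from tendsto_mult_left[OF tendsto_of_real[OF this, where 'a=complex], of "c v"] False
      show ?thesis by simp
    qed
  qed
  moreover have "(\<Sum>v\<in>W. if v = w then c w else 0) = c w" using W w(1) by simp
  moreover have "c w \<noteq> 0" using w(1) by (simp add: W_def)
  ultimately have "\<forall>\<^sub>F t in at_top. (\<Sum>v\<in>W. c v * of_real (t powr (v - w))) \<noteq> 0"
    by (simp add: tendsto_imp_eventually_ne)
  then show ?thesis using eventually_gt_at_top[of 0]
  proof eventually_elim
    case (elim t)
    have "(\<Sum>v\<in>V. c v * of_real (t powr v)) = (\<Sum>v\<in>W. c v * of_real (t powr v))"
      using assms(1) by (intro sum.mono_neutral_right) (auto simp: W_def)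
    also have "\<dots> = of_real (t powr w) * (\<Sum>v\<in>W. c v * of_real (t powr (v - w)))"
      using elim by (simp add: sum_distrib_left powr_diff mult_ac divide_simps
          flip: of_real_mult of_real_divide)
    finally show ?case using elim by simp
  qed
qed

text \<open>A Laurent polynomial in \<open>s\<close> variables is represented by its function on the torus, where
  \<open>unital\<close> points have nonzero coordinates; \<open>curve j M a\<close> specialises the first \<open>j\<close> variables
  of \<open>a\<close> to the powers \<open>t\<^bsup>M i\<^esup>\<close>.\<close>

definition Box :: "nat \<Rightarrow> nat \<Rightarrow> (nat \<Rightarrow> int) set" where
  "Box s C = {e. (\<forall>j<s. \<bar>e j\<bar> \<le> int C) \<and> (\<forall>j\<ge>s. e j = 0)}"

lemma finite_Box: "finite (Box s C)"
proof -
  have "Box s C \<subseteq> {e. \<forall>j. (j \<in> {..<s} \<longrightarrow> e j \<in> {- int C..int C}) \<and> (j \<notin> {..<s} \<longrightarrow> e j = 0)}"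
    by (auto simp: Box_def abs_le_iff minus_le_iff)
  then show ?thesis
    by (rule finite_subset) (intro finite_set_of_finite_funs finite_atLeastAtMost_int finite_lessThan)
qed

definition mon :: "nat \<Rightarrow> (nat \<Rightarrow> complex) \<Rightarrow> (nat \<Rightarrow> int) \<Rightarrow> complex" where
  "mon s a e = (\<Prod>j<s. a j powi e j)"

text \<open>The exponent of \<open>t\<close> that a monomial acquires on the curve.\<close>

definition wt :: "nat \<Rightarrow> (nat \<Rightarrow> real) \<Rightarrow> (nat \<Rightarrow> int) \<Rightarrow> real" where
  "wt s M e = (\<Sum>j<s. of_int (e j) * M j)"

definition unital :: "nat \<Rightarrow> (nat \<Rightarrow> complex) \<Rightarrow> bool" where
  "unital s a \<longleftrightarrow> (\<forall>j<s. a j \<noteq> 0)"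

definition laurent :: "nat \<Rightarrow> nat \<Rightarrow> ((nat \<Rightarrow> complex) \<Rightarrow> complex) \<Rightarrow> bool" where
  "laurent s C q \<longleftrightarrow> (\<exists>c. \<forall>a. unital s a \<longrightarrow> q a = (\<Sum>e\<in>Box s C. c e * mon s a e))"

lemma mon_add: "unital s a \<Longrightarrow> mon s a (\<lambda>j. e j + e' j) = mon s a e * mon s a e'"
  by (auto simp: mon_def unital_def power_int_add prod.distrib[symmetric] intro!: prod.cong)

lemma mon_zero [simp]: "mon s a (\<lambda>_. 0) = 1"
  by (simp add: mon_def)

lemma Box_mono: "C \<le> C' \<Longrightarrow> Box s C \<subseteq> Box s C'"
  by (auto simp: Box_def)

lemma zero_in_Box [simp]: "(\<lambda>_. 0) \<in> Box s C"
  by (simp add: Box_def)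

lemma laurent_mono:
  assumes "laurent s C q" "C \<le> C'"
  shows "laurent s C' q"
proof -
  from assms(1) obtain c where c: "\<And>a. unital s a \<Longrightarrow> q a = (\<Sum>e\<in>Box s C. c e * mon s a e)"
    by (auto simp: laurent_def)
  show ?thesis unfolding laurent_def
  proof (intro exI allI impI)
    fix a assume "unital s a"
    then have "q a = (\<Sum>e\<in>Box s C. c e * mon s a e)" by (rule c)
    also have "\<dots> = (\<Sum>e\<in>Box s C'. (if e \<in> Box s C then c e else 0) * mon s a e)"
      using Box_mono[OF assms(2)] by (intro sum.mono_neutral_cong_left) (auto simp: finite_Box)
    finally show "q a = (\<Sum>e\<in>Box s C'. (if e \<in> Box s C then c e else 0) * mon s a e)" .
  qed
qed

lemma laurent_mon:
  assumes "e \<in> Box s C"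
  shows "laurent s C (\<lambda>a. mon s a e)"
  unfolding laurent_def
proof (intro exI allI impI)
  fix a
  have "(\<Sum>e'\<in>Box s C. (if e' = e then 1 else 0) * mon s a e') = (\<Sum>e'\<in>Box s C. if e' = e then mon s a e' else 0)"
    by (intro sum.cong) auto
  then show "mon s a e = (\<Sum>e'\<in>Box s C. (if e' = e then 1 else 0) * mon s a e')"
    using assms by (simp add: finite_Box)
qed

lemma laurent_cmult: "laurent s C q \<Longrightarrow> laurent s C (\<lambda>a. k * q a)"
proof -
  assume "laurent s C q"
  then obtain c where c: "\<And>a. unital s a \<Longrightarrow> q a = (\<Sum>e\<in>Box s C. c e * mon s a e)"
    by (auto simp: laurent_def)
  show ?thesis unfolding laurent_def
    by (rule exI[of _ "\<lambda>e. k * c e"]) (simp add: c sum_distrib_left mult.assoc)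
qed

lemma laurent_const: "laurent s C (\<lambda>a. k)"
  using laurent_cmult[OF laurent_mon[OF zero_in_Box], of s C k] by simp

lemma laurent_add:
  assumes "laurent s C p" "laurent s C q"
  shows "laurent s C (\<lambda>a. p a + q a)"
proof -
  from assms obtain c c' where "\<And>a. unital s a \<Longrightarrow> p a = (\<Sum>e\<in>Box s C. c e * mon s a e)"
    "\<And>a. unital s a \<Longrightarrow> q a = (\<Sum>e\<in>Box s C. c' e * mon s a e)"
    by (auto simp: laurent_def)
  then show ?thesis unfolding laurent_def
    by (intro exI[of _ "\<lambda>e. c e + c' e"]) (simp add: sum.distrib ring_distribs)
qed

lemma laurent_sum:
  assumes "\<And>i. i \<in> I \<Longrightarrow> laurent s C (q i)"
  shows "laurent s C (\<lambda>a. \<Sum>i\<in>I. q i a)"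
  using assms by (induction I rule: infinite_finite_induct) (auto intro: laurent_const laurent_add)

lemma laurent_mult:
  assumes "laurent s C p" "laurent s C' q"
  shows "laurent s (C + C') (\<lambda>a. p a * q a)"
proof -
  from assms obtain c c' where c: "\<And>a. unital s a \<Longrightarrow> p a = (\<Sum>e\<in>Box s C. c e * mon s a e)"
    "\<And>a. unital s a \<Longrightarrow> q a = (\<Sum>e\<in>Box s C'. c' e * mon s a e)"
    by (auto simp: laurent_def)
  let ?q = "\<lambda>a. \<Sum>e\<in>Box s C. \<Sum>e'\<in>Box s C'. (c e * c' e') * mon s a (\<lambda>j. e j + e' j)"
  have "(\<lambda>j. e j + e' j) \<in> Box s (C + C')" if "e \<in> Box s C" "e' \<in> Box s C'" for e e'
    using that unfolding Box_def by (auto intro: order_trans[OF abs_triangle_ineq add_mono])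
  then have "laurent s (C + C') ?q"
    by (intro laurent_sum laurent_cmult laurent_mon) auto
  moreover have "p a * q a = ?q a" if "unital s a" for a
    using that by (auto simp: c sum_product mon_add intro!: sum.cong)
  ultimately show ?thesis by (simp add: laurent_def)
qed

lemma laurent_power: "laurent s C q \<Longrightarrow> laurent s (k * C) (\<lambda>a. q a ^ k)"
  by (induction k) (auto intro: laurent_const laurent_mult)

definition curve :: "nat \<Rightarrow> (nat \<Rightarrow> real) \<Rightarrow> (nat \<Rightarrow> complex) \<Rightarrow> real \<Rightarrow> nat \<Rightarrow> complex" where
  "curve j M a t = (\<lambda>i. if i < j then of_real (t powr M i) else a i)"

lemma powr_powi: "t > 0 \<Longrightarrow> (of_real (t powr x) :: complex) powi k = of_real (t powr (of_int k * x))"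
proof -
  assume t: "t > 0"
  have "(t powr x) powi k = t powr (of_int k * x)"
    using t by (simp add: powr_real_of_int' powr_powr mult.commute flip: powr_real_of_int')
  then show ?thesis by (metis of_real_power_int)
qed

lemma mon_curve: "t > 0 \<Longrightarrow> mon s (curve s M a t) e = of_real (t powr wt s M e)"
proof -
  assume t: "t > 0"
  have "mon s (curve s M a t) e = (\<Prod>j<s. of_real (t powr (of_int (e j) * M j)))"
    unfolding mon_def using t by (intro prod.cong) (auto simp: curve_def powr_powi)
  also have "\<dots> = of_real (t powr wt s M e)"
    using t by (simp add: wt_def powr_sum flip: of_real_prod)
  finally show ?thesis .
qed

definition box_independent :: "nat \<Rightarrow> (nat \<Rightarrow> real) \<Rightarrow> nat \<Rightarrow> bool" where
  "box_independent s M B \<longleftrightarrow> (\<forall>e\<in>Box s B. wt s M e = 0 \<longrightarrow> e = (\<lambda>_. 0))"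

lemma wt_diff: "wt s M (\<lambda>j. e j - e' j) = wt s M e - wt s M e'"
  by (simp add: wt_def sum_subtractf left_diff_distrib)

lemma wt_inj_on_Box:
  assumes "box_independent s M (2 * C)"
  shows "inj_on (wt s M) (Box s C)"
proof (rule inj_onI)
  fix e e' assume e: "e \<in> Box s C" "e' \<in> Box s C" "wt s M e = wt s M e'"
  have "(\<lambda>j. e j - e' j) \<in> Box s (2 * C)"
    using e(1,2) by (auto simp: Box_def) (smt (verit))
  then have "(\<lambda>j. e j - e' j) = (\<lambda>_. 0)"
    using assms e(3) by (simp add: box_independent_def wt_diff)
  then show "e = e'" by (metis (no_types, opaque_lifting) ext eq_iff_diff_eq_0)
qed

text \<open>Differences of vectors in the box lie in the doubled box, so by independence distinct
  monomials keep distinct exponents on the curve. Nothing cancels, and zeros at arbitrarily large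
  \<open>t\<close> force all coefficients to vanish.\<close>

lemma laurent_zero:
  assumes "laurent s C q" "box_independent s M (2 * C)"
    and "\<exists>\<^sub>F t in at_top. q (curve s M a0 t) = 0" and "unital s a"
  shows "q a = 0"
proof -
  from assms(1) obtain c where c: "\<And>a. unital s a \<Longrightarrow> q a = (\<Sum>e\<in>Box s C. c e * mon s a e)"
    by (auto simp: laurent_def)
  note inj = wt_inj_on_Box[OF assms(2)]
  define c' where "c' v = c (the_inv_into (Box s C) (wt s M) v)" for v
  have "c e = 0" if "e \<in> Box s C" for e
  proof (rule ccontr)
    assume "c e \<noteq> 0"
    then have "\<forall>\<^sub>F t in at_top. (\<Sum>v\<in>wt s M ` Box s C. c' v * of_real (t powr v)) \<noteq> 0"
      using that inj by (intro generalized_poly_eventually_nonzero[of _ "wt s M e"])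
        (auto simp: finite_Box c'_def the_inv_into_f_f)
    then have "\<forall>\<^sub>F t in at_top. q (curve s M a0 t) \<noteq> 0"
      using eventually_gt_at_top[of 0]
    proof eventually_elim
      case (elim t)
      have "unital s (curve s M a0 t)" using elim by (simp add: unital_def curve_def)
      then have "q (curve s M a0 t) = (\<Sum>e\<in>Box s C. c e * of_real (t powr wt s M e))"
        using elim by (simp add: c mon_curve)
      also have "\<dots> = (\<Sum>v\<in>wt s M ` Box s C. c' v * of_real (t powr v))"
        using inj by (simp add: sum.reindex c'_def the_inv_into_f_f)
      finally show ?case using elim by simp
    qed
    then show False using assms(3) by (simp add: frequently_def)
  qed
  then show ?thesis using c[OF assms(4)] by simp
qed

section \<open>Integrality and interpolation in one variable\<close>

lemma poly_eqI_nonzero: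
  fixes p q :: "complex poly"
  assumes "\<And>x. x \<noteq> 0 \<Longrightarrow> poly p x = poly q x"
  shows "p = q"
proof -
  have "poly (monom 1 1 * (p - q)) x = 0" for x
    using assms[of x] by (cases "x = 0") (auto simp: poly_monom)
  then have "monom 1 1 * (p - q) = 0" by (metis poly_all_0_iff_0)
  then show ?thesis by (simp add: monom_eq_0_iff)
qed

text \<open>Polynomials over a field are integrally closed: after cancelling the gcd, the monic
  equation makes \<open>Q'\<close> divide \<open>P' ^ d\<close>, although the two are
  coprime.\<close>

lemma dvd_if_integral:
  fixes P Q :: "complex poly"
  assumes Q: "Q \<noteq> 0" and c: "c 0 = 1"
    and eq: "(\<Sum>k\<le>d. c k * P ^ (d - k) * Q ^ k) = 0"
  shows "Q dvd P"
proof -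
  define g where "g = gcd P Q"
  have g: "g \<noteq> 0" using Q by (simp add: g_def)
  obtain P' Q' where PQ: "P = P' * g" "Q = Q' * g" "coprime P' Q'"
    using gcd_coprime_exists[of P Q] g unfolding g_def by blast
  have "0 = (\<Sum>k\<le>d. c k * P ^ (d - k) * Q ^ k)" using eq by simp
  also have "\<dots> = (\<Sum>k\<le>d. g ^ d * (c k * P' ^ (d - k) * Q' ^ k))"
  proof (intro sum.cong refl)
    fix k assume "k \<in> {..d}"
    then have "g ^ d = g ^ (d - k) * g ^ k" by (simp flip: power_add)
    then show "c k * P ^ (d - k) * Q ^ k = g ^ d * (c k * P' ^ (d - k) * Q' ^ k)"
      by (simp add: PQ power_mult_distrib)
  qed
  also have "\<dots> = g ^ d * (\<Sum>k\<le>d. c k * P' ^ (d - k) * Q' ^ k)"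
    by (simp add: sum_distrib_left)
  finally have "(\<Sum>k\<le>d. c k * P' ^ (d - k) * Q' ^ k) = 0" using g by simp
  then have "P' ^ d + (\<Sum>k\<in>{..d} - {0}. c k * P' ^ (d - k) * Q' ^ k) = 0"
    by (subst (asm) sum.remove[of _ 0]) (auto simp: c)
  moreover have "Q' dvd (\<Sum>k\<in>{..d} - {0}. c k * P' ^ (d - k) * Q' ^ k)"
    by (intro dvd_sum) (auto intro: dvd_mult dvd_power)
  ultimately have "Q' dvd P' ^ d"
    by (simp add: eq_neg_iff_add_eq_0[symmetric])
  moreover have "coprime Q' (P' ^ d)" using PQ(3) by (simp add: coprime_commute)
  ultimately have "is_unit Q'" using coprime_absorb_left by blast
  then have "Q' * g dvd P' * g" by (rule mult_dvd_mono[OF unit_imp_dvd dvd_refl])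
  then show ?thesis unfolding PQ(1,2)[symmetric] .
qed

lemma lagrange_interpolation:
  fixes A :: "complex set"
  assumes "finite A" "card A = Suc L"
  obtains l where "\<And>\<alpha>. degree (l \<alpha>) \<le> L"
    and "\<And>H. degree H \<le> L \<Longrightarrow> H = (\<Sum>\<alpha>\<in>A. smult (poly H \<alpha>) (l \<alpha>))"
proof
  define l where "l \<alpha> = (if \<alpha> \<in> A then \<Prod>\<beta>\<in>A - {\<alpha>}. smult (inverse (\<alpha> - \<beta>)) [:-\<beta>, 1:] else 0)" for \<alpha>
  show deg: "degree (l \<alpha>) \<le> L" for \<alpha>
  proof (cases "\<alpha> \<in> A")
    case True
    have "degree (l \<alpha>) \<le> (\<Sum>\<beta>\<in>A - {\<alpha>}. degree (smult (inverse (\<alpha> - \<beta>)) [:-\<beta>, 1:]))"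
      using degree_prod_sum_le[of "A - {\<alpha>}" "\<lambda>\<beta>. smult (inverse (\<alpha> - \<beta>)) [:-\<beta>, 1:]"]
        assms(1) True by (simp add: l_def comp_def)
    also have "\<dots> \<le> (\<Sum>\<beta>\<in>A - {\<alpha>}. 1)" by (intro sum_mono) auto
    also have "\<dots> = L" using assms True by simp
    finally show ?thesis .
  qed (simp add: l_def)
  have val: "poly (l \<alpha>) \<beta> = (if \<alpha> = \<beta> then 1 else 0)" if "\<alpha> \<in> A" "\<beta> \<in> A" for \<alpha> \<beta>
  proof (cases "\<alpha> = \<beta>")
    case True
    have "inverse (\<alpha> - x) * (\<alpha> - x) = 1" if "x \<in> A - {\<alpha>}" for x
      using that by (intro left_inverse) auto
    then have "poly (smult (inverse (\<alpha> - x)) [:-x, 1:]) \<alpha> = 1" if "x \<in> A - {\<alpha>}" for x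
      using that by (simp add: algebra_simps)
    then show ?thesis using True that unfolding l_def by (simp only: poly_prod if_True) (simp add: prod.neutral)
  next
    case False
    then show ?thesis using that assms(1) by (auto simp: l_def poly_prod)
  qed
  show "H = (\<Sum>\<alpha>\<in>A. smult (poly H \<alpha>) (l \<alpha>))" (is "_ = ?S") if "degree H \<le> L" for H
  proof (rule ccontr)
    assume "H \<noteq> ?S"
    then have nz: "H - ?S \<noteq> 0" by simp
    have "degree ?S \<le> L"
      by (intro degree_sum_le assms(1) order_trans[OF degree_smult_le] deg)
    then have "degree (H - ?S) \<le> L" using that by (intro degree_diff_le)
    moreover have "A \<subseteq> {x. poly (H - ?S) x = 0}"
    proof safe
      fix \<beta> assume "\<beta> \<in> A"
      then have "(\<Sum>\<alpha>\<in>A. poly H \<alpha> * poly (l \<alpha>) \<beta>) = (\<Sum>\<alpha>\<in>A. if \<alpha> = \<beta> then poly H \<alpha> else 0)"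
        by (intro sum.cong) (auto simp: val)
      then show "poly (H - ?S) \<beta> = 0" using \<open>\<beta> \<in> A\<close> assms(1) by (simp add: poly_sum)
    qed
    then have "card A \<le> card {x. poly (H - ?S) x = 0}"
      by (intro card_mono poly_roots_finite nz)
    ultimately show False using card_poly_roots_bound[OF nz] assms(2) by simp
  qed
qed

lemma laurent_slice:
  assumes "laurent s C q" "unital s a" "j < s"
  obtains P where "degree P \<le> 2 * C" "\<And>x. x \<noteq> 0 \<Longrightarrow> x ^ C * q (a(j := x)) = poly P x"
proof -
  from assms(1) obtain c where c: "\<And>a. unital s a \<Longrightarrow> q a = (\<Sum>e\<in>Box s C. c e * mon s a e)"
    by (auto simp: laurent_def)
  define k where "k e = c e * (\<Prod>i\<in>{..<s} - {j}. a i powi e i)" for e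
  define P where "P = (\<Sum>e\<in>Box s C. monom (k e) (nat (e j + int C)))"
  show ?thesis
  proof
    show "degree P \<le> 2 * C" unfolding P_def
    proof (intro degree_sum_le finite_Box order_trans[OF degree_monom_le])
      fix e assume "e \<in> Box s C"
      then have "\<bar>e j\<bar> \<le> int C" using assms(3) by (auto simp: Box_def)
      then show "nat (e j + int C) \<le> 2 * C" by linarith
    qed
    fix x :: complex assume x: "x \<noteq> 0"
    have "unital s (a(j := x))" using assms(2) x by (simp add: unital_def)
    then have "x ^ C * q (a(j := x)) = (\<Sum>e\<in>Box s C. c e * (x ^ C * mon s (a(j := x)) e))"
      by (simp add: c sum_distrib_left mult_ac)
    also have "\<dots> = (\<Sum>e\<in>Box s C. poly (monom (k e) (nat (e j + int C))) x)"
    proof (intro sum.cong refl)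
      fix e assume "e \<in> Box s C"
      then have e: "0 \<le> e j + int C" using assms(3) by (auto simp: Box_def)
      have "mon s (a(j := x)) e = x powi e j * (\<Prod>i\<in>{..<s} - {j}. a i powi e i)"
        using assms(3) by (simp add: mon_def prod.remove[of _ j])
      moreover have "x ^ C * x powi e j = x ^ nat (e j + int C)"
      proof -
        have "x ^ nat (e j + int C) = x powi (e j + int C)" using e by (simp add: power_int_def)
        also have "\<dots> = x powi e j * x ^ C" using x by (simp add: power_int_add)
        finally show ?thesis by simp
      qed
      ultimately show "c e * (x ^ C * mon s (a(j := x)) e) = poly (monom (k e) (nat (e j + int C))) x"
        by (simp add: k_def poly_monom)
    qed
    also have "\<dots> = poly P x" by (simp add: P_def poly_sum)
    finally show "x ^ C * q (a(j := x)) = poly P x" .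
  qed
qed

text \<open>The quotient \<open>U / V\<close> is integral over the Laurent polynomials in the variable \<open>a j\<close>.\<close>

lemma integral_slice:
  assumes lp: "laurent s C U" "laurent s C V" "laurent s C W" "laurent s C F"
    and \<gamma>: "\<gamma> 0 = (1::complex)" and d: "d > 0"
    and eq: "\<And>a. unital s a \<Longrightarrow> (\<Sum>k\<le>d. \<gamma> k * W a ^ k * U a ^ (d - k) * V a ^ k) = F a * V a ^ d"
    and a: "unital s a" "j < s" and x0: "x0 \<noteq> 0" "V (a(j := x0)) \<noteq> 0"
  obtains H where "degree H \<le> 3 * C" "\<And>x. x \<noteq> 0 \<Longrightarrow> x ^ C * U (a(j := x)) = poly H x * V (a(j := x))"
proof -
  obtain PU where PU: "degree PU \<le> 2 * C" "\<And>x. x \<noteq> 0 \<Longrightarrow> x ^ C * U (a(j := x)) = poly PU x"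
    using laurent_slice[OF lp(1) a] by blast
  obtain PV where PV: "degree PV \<le> 2 * C" "\<And>x. x \<noteq> 0 \<Longrightarrow> x ^ C * V (a(j := x)) = poly PV x"
    using laurent_slice[OF lp(2) a] by blast
  obtain PW where PW: "\<And>x. x \<noteq> 0 \<Longrightarrow> x ^ C * W (a(j := x)) = poly PW x"
    using laurent_slice[OF lp(3) a] by blast
  obtain PF where PF: "\<And>x. x \<noteq> 0 \<Longrightarrow> x ^ C * F (a(j := x)) = poly PF x"
    using laurent_slice[OF lp(4) a] by blast
  \<comment> \<open>The extra power gives every summand the same factor
    \<open>x ^ (2 * C * d)\<close>: \<open>2 * C\<close> for each factor \<open>P\<close>, and
    \<open>C\<close> for each of the paired factors \<open>PW\<close> and \<open>PV\<close>.\<close>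
  define P where "P = monom 1 C * PU"
  have PV0: "PV \<noteq> 0" using PV(2)[OF x0(1)] x0 by auto
  have ident: "(\<Sum>k\<le>d. smult (\<gamma> k) (PW ^ k) * P ^ (d - k) * PV ^ k) = monom 1 (C * (d - 1)) * PF * PV ^ d"
  proof (rule poly_eqI_nonzero)
    fix x :: complex assume x: "x \<noteq> 0"
    let ?a = "a(j := x)"
    have u: "unital s ?a" using a x by (simp add: unital_def)
    have "poly (\<Sum>k\<le>d. smult (\<gamma> k) (PW ^ k) * P ^ (d - k) * PV ^ k) x
        = (\<Sum>k\<le>d. x ^ (2 * C * d) * (\<gamma> k * W ?a ^ k * U ?a ^ (d - k) * V ?a ^ k))"
      unfolding poly_sum
    proof (intro sum.cong refl)
      fix k assume k: "k \<in> {..d}"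
      have "poly (smult (\<gamma> k) (PW ^ k) * P ^ (d - k) * PV ^ k) x
          = \<gamma> k * (x ^ C * W ?a) ^ k * (x ^ C * (x ^ C * U ?a)) ^ (d - k) * (x ^ C * V ?a) ^ k"
        by (simp add: P_def poly_monom PU(2) PV(2) PW x)
      also have "\<dots> = (x ^ C) ^ (k + k + ((d - k) + (d - k))) * (\<gamma> k * W ?a ^ k * U ?a ^ (d - k) * V ?a ^ k)"
        unfolding power_mult_distrib power_add by (simp only: mult_ac)
      also have "k + k + ((d - k) + (d - k)) = 2 * d" using k by simp
      also have "(x ^ C) ^ (2 * d) = x ^ (2 * C * d)"
        by (simp add: power_mult[symmetric] mult_ac)
      finally show "poly (smult (\<gamma> k) (PW ^ k) * P ^ (d - k) * PV ^ k) x
          = x ^ (2 * C * d) * (\<gamma> k * W ?a ^ k * U ?a ^ (d - k) * V ?a ^ k)" .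
    qed
    also have "\<dots> = x ^ (2 * C * d) * (F ?a * V ?a ^ d)"
      using eq[OF u] by (simp flip: sum_distrib_left)
    also have "x ^ (2 * C * d) = x ^ (C * (d - 1)) * x ^ C * x ^ (C * d)"
    proof -
      have "C * (d - 1) + C + C * d = 2 * C * d" using d by (cases d) (simp_all add: algebra_simps)
      then show ?thesis by (metis power_add)
    qed
    also have "x ^ (C * (d - 1)) * x ^ C * x ^ (C * d) * (F ?a * V ?a ^ d)
        = x ^ (C * (d - 1)) * (x ^ C * F ?a) * (x ^ C * V ?a) ^ d"
      unfolding power_mult_distrib power_mult[of x C d] by (simp only: mult_ac)
    also have "\<dots> = poly (monom 1 (C * (d - 1)) * PF * PV ^ d) x"
      by (simp add: PF PV(2) x poly_monom)
    finally show "poly (\<Sum>k\<le>d. smult (\<gamma> k) (PW ^ k) * P ^ (d - k) * PV ^ k) x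
        = poly (monom 1 (C * (d - 1)) * PF * PV ^ d) x" .
  qed
  \<comment> \<open>The right-hand side joins the coefficient of \<open>PV ^ d\<close>; as
    \<open>d > 0\<close>, the equation remains monic in \<open>P\<close>.\<close>
  define c where "c k = (if k = d then smult (\<gamma> d) (PW ^ d) - monom 1 (C * (d - 1)) * PF
      else smult (\<gamma> k) (PW ^ k))" for k
  have "(\<Sum>k\<le>d. c k * P ^ (d - k) * PV ^ k)
      = (\<Sum>k\<le>d. smult (\<gamma> k) (PW ^ k) * P ^ (d - k) * PV ^ k
          - (if k = d then monom 1 (C * (d - 1)) * PF * PV ^ d else 0))"
    by (intro sum.cong) (auto simp: c_def left_diff_distrib)
  also have "\<dots> = 0" unfolding sum_subtractf ident by simp
  finally have "PV dvd P"
    using d \<gamma> by (intro dvd_if_integral[OF PV0, of c]) (auto simp: c_def)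
  then obtain H where H: "P = PV * H" by (elim dvdE)
  show ?thesis
  proof
    show "degree H \<le> 3 * C"
    proof (cases "H = 0")
      case False
      have "degree H \<le> degree P" using H PV0 False by (simp add: degree_mult_eq)
      also have "\<dots> \<le> C + 2 * C"
        unfolding P_def using PU(1) by (intro order_trans[OF degree_mult_le] add_mono degree_monom_le)
      finally show ?thesis by simp
    qed simp
    fix x :: complex assume x: "x \<noteq> 0"
    have "x ^ C * (x ^ C * U (a(j := x))) = poly P x" by (simp add: P_def poly_monom PU(2) x)
    also have "\<dots> = x ^ C * (poly H x * V (a(j := x)))" by (simp add: H x flip: PV(2))
    finally show "x ^ C * U (a(j := x)) = poly H x * V (a(j := x))" using x by simp
  qed
qed

section \<open>Expansions in real powers along a curve\<close>

definition gen_poly :: "nat \<Rightarrow> nat \<Rightarrow> (nat \<Rightarrow> real) \<Rightarrow> (real \<Rightarrow> complex) \<Rightarrow> bool" where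
  "gen_poly s L M p \<longleftrightarrow>
    (\<exists>c. \<forall>\<^sub>F t in at_top. p t = (\<Sum>e\<in>Box s L. c e * of_real (t powr wt s M e)))"

lemma gen_poly_cong:
  assumes "gen_poly s L M p" "\<forall>\<^sub>F t in at_top. p t = q t"
  shows "gen_poly s L M q"
proof -
  obtain c where "\<forall>\<^sub>F t in at_top. p t = (\<Sum>e\<in>Box s L. c e * of_real (t powr wt s M e))"
    using assms(1) by (auto simp: gen_poly_def)
  with assms(2) have "\<forall>\<^sub>F t in at_top. q t = (\<Sum>e\<in>Box s L. c e * of_real (t powr wt s M e))"
    by eventually_elim simp
  then show ?thesis by (auto simp: gen_poly_def)
qed

lemma gen_poly_monomial:
  assumes "e \<in> Box s L"
  shows "gen_poly s L M (\<lambda>t. k * of_real (t powr wt s M e))"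
  unfolding gen_poly_def
proof (intro exI always_eventually allI)
  fix t
  have "(\<Sum>e'\<in>Box s L. (if e' = e then k else 0) * complex_of_real (t powr wt s M e'))
      = (\<Sum>e'\<in>Box s L. if e' = e then k * of_real (t powr wt s M e) else 0)"
    by (intro sum.cong) auto
  then show "k * of_real (t powr wt s M e)
      = (\<Sum>e'\<in>Box s L. (if e' = e then k else 0) * complex_of_real (t powr wt s M e'))"
    using assms by (simp add: finite_Box)
qed

lemma gen_poly_add:
  assumes "gen_poly s L M p" "gen_poly s L M q"
  shows "gen_poly s L M (\<lambda>t. p t + q t)"
proof -
  obtain c c' where
    "\<forall>\<^sub>F t in at_top. p t = (\<Sum>e\<in>Box s L. c e * of_real (t powr wt s M e))"
    "\<forall>\<^sub>F t in at_top. q t = (\<Sum>e\<in>Box s L. c' e * of_real (t powr wt s M e))"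
    using assms by (auto simp: gen_poly_def)
  then have "\<forall>\<^sub>F t in at_top. p t + q t = (\<Sum>e\<in>Box s L. (c e + c' e) * of_real (t powr wt s M e))"
    by eventually_elim (simp add: sum.distrib ring_distribs)
  then show ?thesis by (auto simp: gen_poly_def)
qed

lemma gen_poly_0: "gen_poly s L M (\<lambda>_. 0)"
  using gen_poly_monomial[OF zero_in_Box, of s L M 0] by simp

lemma gen_poly_sum:
  assumes "\<And>i. i \<in> I \<Longrightarrow> gen_poly s L M (q i)"
  shows "gen_poly s L M (\<lambda>t. \<Sum>i\<in>I. q i t)"
  using assms by (induction I rule: infinite_finite_induct) (auto intro: gen_poly_0 gen_poly_add)

lemma gen_poly_mult_poly:
  assumes p: "gen_poly j L M p" and l: "degree l \<le> L"
  shows "gen_poly (Suc j) L M (\<lambda>t. p t * poly l (of_real (t powr M j)))"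
proof -
  obtain c where c: "\<forall>\<^sub>F t in at_top. p t = (\<Sum>e\<in>Box j L. c e * of_real (t powr wt j M e))"
    using p by (auto simp: gen_poly_def)
  let ?q = "\<lambda>t. \<Sum>e\<in>Box j L. \<Sum>k\<le>L. (c e * coeff l k) * of_real (t powr wt (Suc j) M (e(j := int k)))"
  have "gen_poly (Suc j) L M ?q"
    by (intro gen_poly_sum gen_poly_monomial) (auto simp: Box_def less_Suc_eq)
  moreover have "\<forall>\<^sub>F t in at_top. ?q t = p t * poly l (of_real (t powr M j))"
    using c eventually_gt_at_top[of 0]
  proof eventually_elim
    case (elim t)
    have "poly l (of_real (t powr M j)) = (\<Sum>k\<le>L. coeff l k * of_real (t powr (of_int (int k) * M j)))"
      using arg_cong[OF poly_as_sum_of_monoms'[OF l], of "\<lambda>p. poly p (of_real (t powr M j))"] elim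
      by (simp add: poly_sum poly_monom powr_power mult.commute flip: of_real_power)
    moreover have "wt (Suc j) M (e(j := int k)) = wt j M e + of_int (int k) * M j" for e k
      by (simp add: wt_def)
    ultimately show ?case using elim
      by (simp add: sum_product powr_add mult_ac)
  qed
  ultimately show ?thesis by (rule gen_poly_cong)
qed

lemma curve_upd: "curve j M (a(j := x)) t = (curve j M a t)(j := x)"
  by (auto simp: curve_def)

lemma curve_Suc: "curve (Suc j) M a t = (curve j M a t)(j := of_real (t powr M j))"
  by (auto simp: curve_def less_Suc_eq)

lemma unital_curve: "unital s a \<Longrightarrow> t > 0 \<Longrightarrow> unital s (curve j M a t)"
  by (simp add: unital_def curve_def)

text \<open>Grouped by powers of \<open>t\<close>, the restriction of \<open>V\<close> with
  coordinate \<open>j\<close> set to \<open>x\<close> has coefficients \<open>P v\<close> polynomial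
  in \<open>x\<close>, up to the factor \<open>x ^ C\<close>. They cannot all vanish, since
  \<open>x = t powr M j\<close> gives the longer curve; the bad \<open>x\<close> are roots of a
  single nonzero \<open>P v\<close>.\<close>

lemma curve_specialization_finite:
  assumes V: "laurent s C V" and a: "unital s a" "j < s"
    and ev: "\<forall>\<^sub>F t in at_top. V (curve (Suc j) M a t) \<noteq> 0"
  shows "finite {x. x \<noteq> 0 \<and> \<not> (\<forall>\<^sub>F t in at_top. V (curve j M (a(j := x)) t) \<noteq> 0)}"
proof -
  obtain c where c: "\<And>a. unital s a \<Longrightarrow> V a = (\<Sum>e\<in>Box s C. c e * mon s a e)"
    using V by (auto simp: laurent_def)
  define k where "k e = c e * (\<Prod>i\<in>{j<..<s}. a i powi e i)" for e
  define P where "P v = (\<Sum>e\<in>{e \<in> Box s C. wt j M e = v}. monom (k e) (nat (e j + int C)))" for v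
  let ?W = "wt j M ` Box s C"
  have *: "x ^ C * V (curve j M (a(j := x)) t) = (\<Sum>v\<in>?W. poly (P v) x * of_real (t powr v))"
    if x: "x \<noteq> 0" and t: "t > 0" for x t
  proof -
    let ?b = "curve j M (a(j := x)) t"
    have u: "unital s ?b" using a x t by (simp add: unital_def curve_def)
    have "x ^ C * V ?b = (\<Sum>e\<in>Box s C. poly (monom (k e) (nat (e j + int C))) x * of_real (t powr wt j M e))"
      unfolding c[OF u] sum_distrib_left
    proof (intro sum.cong refl)
      fix e assume "e \<in> Box s C"
      then have e: "0 \<le> e j + int C" using a by (auto simp: Box_def)
      have split: "prod f {..<s} = prod f {..<j} * f j * prod f {j<..<s}" for f :: "nat \<Rightarrow> complex"
      proof -
        have "{..<s} = {..<j} \<union> insert j {j<..<s}" using a by auto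
        then have "prod f {..<s} = prod f ({..<j} \<union> insert j {j<..<s})" by (rule arg_cong)
        also have "\<dots> = prod f {..<j} * prod f (insert j {j<..<s})" by (rule prod.union_disjoint) auto
        finally show ?thesis by simp
      qed
      have "mon s ?b e = mon j ?b e * ?b j powi e j * (\<Prod>i\<in>{j<..<s}. ?b i powi e i)"
        unfolding mon_def by (rule split)
      also have "mon j ?b e = of_real (t powr wt j M e)" using t by (rule mon_curve)
      also have "?b j = x" by (simp add: curve_def)
      also have "(\<Prod>i\<in>{j<..<s}. ?b i powi e i) = (\<Prod>i\<in>{j<..<s}. a i powi e i)"
        by (intro prod.cong) (auto simp: curve_def)
      finally have "mon s ?b e = of_real (t powr wt j M e) * x powi e j * (\<Prod>i\<in>{j<..<s}. a i powi e i)" .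
      moreover have "x ^ nat (e j + int C) = x powi e j * x ^ C"
      proof -
        have "x ^ nat (e j + int C) = x powi (e j + int C)" using e by (simp add: power_int_def)
        also have "\<dots> = x powi e j * x ^ C" using x by (simp add: power_int_add)
        finally show ?thesis .
      qed
      ultimately show "x ^ C * (c e * mon s ?b e)
          = poly (monom (k e) (nat (e j + int C))) x * of_real (t powr wt j M e)"
        by (simp add: k_def poly_monom mult_ac)
    qed
    also have "\<dots> = (\<Sum>v\<in>?W. \<Sum>e\<in>{e \<in> Box s C. wt j M e = v}.
        poly (monom (k e) (nat (e j + int C))) x * of_real (t powr wt j M e))"
      by (rule sum.image_gen[OF finite_Box])
    also have "\<dots> = (\<Sum>v\<in>?W. poly (P v) x * of_real (t powr v))"
      by (intro sum.cong refl) (simp add: P_def poly_sum sum_distrib_right)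
    finally show ?thesis .
  qed
  obtain t where t: "t > 0" "V (curve (Suc j) M a t) \<noteq> 0"
    using eventually_happens[OF eventually_conj[OF ev eventually_gt_at_top[of 0]]] by auto
  have "\<exists>v\<in>?W. P v \<noteq> 0"
  proof (rule ccontr)
    assume "\<not> ?thesis"
    then have "of_real (t powr M j) ^ C * V (curve j M (a(j := of_real (t powr M j))) t) = 0"
      using t by (subst *) (auto intro!: sum.neutral)
    then show False using t by (simp add: curve_upd curve_Suc)
  qed
  then obtain v where v: "v \<in> ?W" "P v \<noteq> 0" by blast
  have "{x. x \<noteq> 0 \<and> \<not> (\<forall>\<^sub>F t in at_top. V (curve j M (a(j := x)) t) \<noteq> 0)} \<subseteq> {x. poly (P v) x = 0}"
  proof (safe, rule ccontr)
    fix x :: complex assume x: "x \<noteq> 0" "poly (P v) x \<noteq> 0"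
      and n: "\<not> (\<forall>\<^sub>F t in at_top. V (curve j M (a(j := x)) t) \<noteq> 0)"
    have "\<forall>\<^sub>F t in at_top. (\<Sum>v\<in>?W. poly (P v) x * of_real (t powr v)) \<noteq> 0"
      using v x by (intro generalized_poly_eventually_nonzero[of _ v]) (auto simp: finite_Box)
    then have "\<forall>\<^sub>F t in at_top. V (curve j M (a(j := x)) t) \<noteq> 0"
      using eventually_gt_at_top[of 0]
    proof eventually_elim
      case (elim t)
      show ?case using elim(1) unfolding *[OF x(1) elim(2), symmetric] by simp
    qed
    then show False using n by simp
  qed
  then show ?thesis by (rule finite_subset) (rule poly_roots_finite[OF v(2)])
qed

text \<open>The monomial factor clears negative exponents, so that an integral quotient becomes an
  ordinary polynomial in each variable, of degree at most \<open>3 * C\<close>.\<close>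

definition normalized_quotient ::
    "nat \<Rightarrow> nat \<Rightarrow> ((nat \<Rightarrow> complex) \<Rightarrow> complex) \<Rightarrow> ((nat \<Rightarrow> complex) \<Rightarrow> complex) \<Rightarrow> (nat \<Rightarrow> complex) \<Rightarrow> complex" where
  "normalized_quotient s C U V a = (\<Prod>j<s. a j ^ C) * (U a / V a)"

text \<open>Lagrange interpolation one variable at a time: the quotient is a polynomial of bounded
  degree in each variable, and generic interpolation nodes avoid the zeros of \<open>V\<close>.\<close>

lemma quotient_along_curve:
  assumes lp: "laurent s C U" "laurent s C V" "laurent s C W" "laurent s C F"
    and \<gamma>: "\<gamma> 0 = (1::complex)" and d: "d > 0"
    and eq: "\<And>a. unital s a \<Longrightarrow> (\<Sum>k\<le>d. \<gamma> k * W a ^ k * U a ^ (d - k) * V a ^ k) = F a * V a ^ d"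
    and "j \<le> s" "unital s a" "\<forall>\<^sub>F t in at_top. V (curve j M a t) \<noteq> 0"
  shows "gen_poly j (3 * C) M (\<lambda>t. normalized_quotient s C U V (curve j M a t))"
  using assms(8-10)
proof (induction j arbitrary: a)
  case 0
  have "gen_poly 0 (3 * C) M (\<lambda>t. normalized_quotient s C U V a * of_real (t powr wt 0 M (\<lambda>_. 0)))"
    by (rule gen_poly_monomial) simp
  then show ?case
    by (rule gen_poly_cong)
       (use eventually_gt_at_top[of 0] in eventually_elim, simp add: wt_def curve_def)
next
  case (Suc j)
  let ?L = "3 * C" and ?Q = "normalized_quotient s C U V"
  let ?bad = "{x. x \<noteq> 0 \<and> \<not> (\<forall>\<^sub>F t in at_top. V (curve j M (a(j := x)) t) \<noteq> 0)}"
  have "finite ?bad"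
    using Suc.prems by (intro curve_specialization_finite[OF lp(2)]) auto
  then have "infinite (UNIV - insert 0 ?bad)"
    by (simp add: Diff_infinite_finite infinite_UNIV_char_0)
  then obtain A where A: "finite A" "card A = Suc ?L" "A \<subseteq> UNIV - insert 0 ?bad"
    using infinite_arbitrarily_large by blast
  then have good: "\<alpha> \<noteq> 0" "\<forall>\<^sub>F t in at_top. V (curve j M (a(j := \<alpha>)) t) \<noteq> 0" if "\<alpha> \<in> A" for \<alpha>
    using that by auto
  obtain l where l: "\<And>\<alpha>. degree (l \<alpha>) \<le> ?L"
    "\<And>H. degree H \<le> ?L \<Longrightarrow> H = (\<Sum>\<alpha>\<in>A. smult (poly H \<alpha>) (l \<alpha>))"
    using lagrange_interpolation[OF A(1,2)] by blast
  have nz: "\<forall>\<^sub>F t in at_top. \<forall>\<alpha>\<in>A. V (curve j M (a(j := \<alpha>)) t) \<noteq> 0"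
    using good(2) by (intro eventually_ball_finite[OF A(1)]) auto
  have "gen_poly (Suc j) ?L M
      (\<lambda>t. \<Sum>\<alpha>\<in>A. ?Q (curve j M (a(j := \<alpha>)) t) * poly (l \<alpha>) (of_real (t powr M j)))"
  proof (intro gen_poly_sum gen_poly_mult_poly Suc.IH l(1))
    fix \<alpha> assume \<alpha>: "\<alpha> \<in> A"
    show "unital s (a(j := \<alpha>))" using Suc.prems(2) good(1)[OF \<alpha>] by (simp add: unital_def)
    show "\<forall>\<^sub>F t in at_top. V (curve j M (a(j := \<alpha>)) t) \<noteq> 0" by (rule good(2)[OF \<alpha>])
  qed (use Suc.prems in simp)
  moreover have "\<forall>\<^sub>F t in at_top. (\<Sum>\<alpha>\<in>A. ?Q (curve j M (a(j := \<alpha>)) t) * poly (l \<alpha>) (of_real (t powr M j)))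
      = ?Q (curve (Suc j) M a t)"
    using eventually_gt_at_top[of 0] Suc.prems(3) nz
  proof eventually_elim
    case (elim t)
    define b where "b = curve j M a t"
    define x where "x = complex_of_real (t powr M j)"
    have x: "x \<noteq> 0" using elim by (simp add: x_def)
    have b: "unital s b" using elim Suc.prems by (simp add: b_def unital_curve)
    have Vx: "V (b(j := x)) \<noteq> 0" unfolding b_def x_def curve_Suc[symmetric] by (rule elim(2))
    obtain H where H: "degree H \<le> ?L" "\<And>x. x \<noteq> 0 \<Longrightarrow> x ^ C * U (b(j := x)) = poly H x * V (b(j := x))"
      using integral_slice[OF lp \<gamma> d eq b Suc_le_lessD[OF Suc.prems(1)] x Vx] by blast
    \<comment> \<open>With the other coordinates fixed, their powers are a constant factor; the
      slice is a polynomial determined by its values at the \<open>3 * C + 1\<close> nodes.\<close>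
    define H' where "H' = smult (\<Prod>i\<in>{..<s} - {j}. b i ^ C) H"
    have Q: "?Q (b(j := y)) = poly H' y" if "y \<noteq> 0" "V (b(j := y)) \<noteq> 0" for y
    proof -
      have "(\<Prod>i<s. (b(j := y)) i ^ C) = y ^ C * (\<Prod>i\<in>{..<s} - {j}. b i ^ C)"
        using Suc.prems(1) by (simp add: prod.remove[of _ j])
      then have "?Q (b(j := y)) = (\<Prod>i\<in>{..<s} - {j}. b i ^ C) * (y ^ C * U (b(j := y))) / V (b(j := y))"
        by (simp add: normalized_quotient_def)
      then show ?thesis using that by (simp add: H(2) H'_def)
    qed
    have "poly H' x = (\<Sum>\<alpha>\<in>A. poly H' \<alpha> * poly (l \<alpha>) x)"
      using arg_cong[OF l(2)[of H'], of "\<lambda>p. poly p x"] H(1)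
      by (simp add: poly_sum H'_def order_trans[OF degree_smult_le])
    then show ?case
      using Q[OF x Vx] Q good(1) elim(3)
      by (simp add: curve_upd curve_Suc b_def x_def)
  qed
  ultimately show ?case by (rule gen_poly_cong)
qed

text \<open>On the curve, \<open>t powr \<kappa>\<close> times \<open>\<eta>(t)\<close> has two
  expansions in real powers, which agree coefficientwise. So each \<open>n + \<kappa>\<close> is the
  weight of a vector in \<open>Box s (3 * C)\<close>, and undoing the shift by
  \<open>(C, ..., C)\<close> costs another \<open>C\<close>.\<close>

lemma support_of_integral_quotient:
  assumes lp: "laurent s C U" "laurent s C V" "laurent s C W" "laurent s C F"
    and \<gamma>: "\<gamma> 0 = (1::complex)" and d: "d > 0"
    and eq: "\<And>a. unital s a \<Longrightarrow> (\<Sum>k\<le>d. \<gamma> k * W a ^ k * U a ^ (d - k) * V a ^ k) = F a * V a ^ d"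
    and a: "unital s a" and V0: "\<forall>\<^sub>F t in at_top. V (curve s M a t) \<noteq> 0"
    and \<eta>: "\<forall>\<^sub>F t in at_top. U (curve s M a t) = poly \<eta> (of_real t) * V (curve s M a t)"
    and n: "coeff \<eta> n \<noteq> 0"
  shows "\<exists>e\<in>Box s (4 * C). real n = wt s M e"
proof -
  obtain c where c: "\<forall>\<^sub>F t in at_top. normalized_quotient s C U V (curve s M a t)
      = (\<Sum>e\<in>Box s (3 * C). c e * of_real (t powr wt s M e))"
    using quotient_along_curve[OF lp \<gamma> d eq order_refl a V0] by (auto simp: gen_poly_def)
  define \<kappa> where "\<kappa> = wt s M (\<lambda>j. if j < s then int C else 0)"
  define A where "A = (\<lambda>n. real n + \<kappa>) ` {..degree \<eta>}"
  define B where "B = wt s M ` Box s (3 * C)"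
  define c1 where "c1 v = (if v \<in> A then coeff \<eta> (nat \<lfloor>v - \<kappa>\<rfloor>) else 0)" for v
  define c2 where "c2 v = (if v \<in> B then \<Sum>e\<in>{e \<in> Box s (3 * C). wt s M e = v}. c e else 0)" for v
  have fin: "finite (A \<union> B)" by (simp add: A_def B_def finite_Box)
  have "\<forall>\<^sub>F t in at_top. (\<Sum>v\<in>A \<union> B. (c1 v - c2 v) * of_real (t powr v)) = 0"
    using c V0 \<eta> eventually_gt_at_top[of 0]
  proof eventually_elim
    case (elim t)
    have "(\<Prod>j<s. curve s M a t j ^ C) = mon s (curve s M a t) (\<lambda>j. if j < s then int C else 0)"
      by (simp add: mon_def)
    also have "\<dots> = of_real (t powr \<kappa>)" using elim by (simp add: mon_curve \<kappa>_def)
    finally have "normalized_quotient s C U V (curve s M a t) = of_real (t powr \<kappa>) * poly \<eta> (of_real t)"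
      using elim by (simp add: normalized_quotient_def)
    also have "\<dots> = (\<Sum>n\<le>degree \<eta>. coeff \<eta> n * of_real (t powr (real n + \<kappa>)))"
      using elim by (simp add: poly_altdef sum_distrib_left powr_add powr_realpow mult_ac)
    also have "\<dots> = (\<Sum>v\<in>A. c1 v * of_real (t powr v))"
      unfolding A_def by (subst sum.reindex) (auto simp: inj_on_def c1_def A_def)
    also have "\<dots> = (\<Sum>v\<in>A \<union> B. c1 v * of_real (t powr v))"
      using fin by (intro sum.mono_neutral_left) (auto simp: c1_def)
    finally have 1: "normalized_quotient s C U V (curve s M a t) = (\<Sum>v\<in>A \<union> B. c1 v * of_real (t powr v))" .
    have "(\<Sum>e\<in>Box s (3 * C). c e * of_real (t powr wt s M e))
        = (\<Sum>v\<in>B. \<Sum>e\<in>{e \<in> Box s (3 * C). wt s M e = v}. c e * of_real (t powr wt s M e))"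
      unfolding B_def by (rule sum.image_gen[OF finite_Box])
    also have "\<dots> = (\<Sum>v\<in>B. c2 v * of_real (t powr v))"
      by (intro sum.cong refl) (simp add: c2_def sum_distrib_right)
    also have "\<dots> = (\<Sum>v\<in>A \<union> B. c2 v * of_real (t powr v))"
      using fin by (intro sum.mono_neutral_left) (auto simp: c2_def)
    finally show ?case using 1 elim by (simp add: left_diff_distrib sum_subtractf)
  qed
  then have "\<not> (\<forall>\<^sub>F t in at_top. (\<Sum>v\<in>A \<union> B. (c1 v - c2 v) * of_real (t powr v)) \<noteq> 0)"
    using eventually_happens eventually_conj trivial_limit_at_top_linorder by fastforce
  then have c12: "c1 v = c2 v" if "v \<in> A \<union> B" for v
    using generalized_poly_eventually_nonzero[OF fin that, of "\<lambda>v. c1 v - c2 v"] by auto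
  have nA: "real n + \<kappa> \<in> A" using n le_degree by (auto simp: A_def)
  then have "c1 (real n + \<kappa>) = coeff \<eta> n" by (simp add: c1_def)
  with n c12[of "real n + \<kappa>"] nA have "real n + \<kappa> \<in> B" by (auto simp: c2_def split: if_splits)
  then obtain e where e: "e \<in> Box s (3 * C)" "real n + \<kappa> = wt s M e" by (auto simp: B_def)
  show ?thesis
  proof
    show "real n = wt s M (\<lambda>j. e j - (if j < s then int C else 0))"
      using e(2) by (simp add: wt_diff \<kappa>_def)
    show "(\<lambda>j. e j - (if j < s then int C else 0)) \<in> Box s (4 * C)"
      using e(1) by (auto simp: Box_def abs_le_iff)
  qed
qed

section \<open>Lifting the equation\<close>

definition box_rep :: "nat \<Rightarrow> (nat \<Rightarrow> real) \<Rightarrow> nat \<Rightarrow> nat \<Rightarrow> bool" where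
  "box_rep s M C n \<longleftrightarrow> (\<exists>e\<in>Box s C. real n = wt s M e)"

lemma box_rep_0: "box_rep s M C 0"
  unfolding box_rep_def by (rule bexI[of _ "\<lambda>_. 0"]) (simp_all add: wt_def)

lemma box_rep_add:
  assumes "box_rep s M C n" "box_rep s M C' n'"
  shows "box_rep s M (C + C') (n + n')"
proof -
  obtain e e' where e: "e \<in> Box s C" "real n = wt s M e" "e' \<in> Box s C'" "real n' = wt s M e'"
    using assms by (auto simp: box_rep_def)
  have "(\<lambda>j. e j + e' j) \<in> Box s (C + C')"
    using e(1,3) unfolding Box_def by (auto intro: order_trans[OF abs_triangle_ineq add_mono])
  moreover have "real (n + n') = wt s M (\<lambda>j. e j + e' j)"
    using e by (simp add: wt_def sum.distrib ring_distribs)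
  ultimately show ?thesis by (auto simp: box_rep_def)
qed

lemma laurent_lift:
  assumes "\<And>n. coeff p n \<noteq> 0 \<Longrightarrow> box_rep s M C n"
  obtains q where "laurent s C q" "\<And>a t. t > 0 \<Longrightarrow> q (curve s M a t) = poly p (of_real t)"
proof -
  obtain e where e: "\<And>n. coeff p n \<noteq> 0 \<Longrightarrow> e n \<in> Box s C \<and> real n = wt s M (e n)"
    using assms unfolding box_rep_def by metis
  define I where "I = {n. coeff p n \<noteq> 0}"
  define q where "q a = (\<Sum>n\<in>I. coeff p n * mon s a (e n))" for a
  show ?thesis
  proof
    show "laurent s C q" unfolding q_def
      by (intro laurent_sum laurent_cmult laurent_mon) (use e in \<open>auto simp: I_def\<close>)
    fix a :: "nat \<Rightarrow> complex" and t :: real assume t: "t > 0"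
    have "poly p (of_real t) = (\<Sum>n\<in>I. coeff p n * of_real t ^ n)"
      unfolding poly_altdef I_def by (rule sum.mono_neutral_right) (auto intro: le_degree)
    also have "\<dots> = q (curve s M a t)" unfolding q_def
    proof (intro sum.cong refl)
      fix n assume "n \<in> I"
      then have "wt s M (e n) = real n" using e by (simp add: I_def)
      then show "coeff p n * of_real t ^ n = coeff p n * mon s (curve s M a t) (e n)"
        using t by (simp add: mon_curve powr_realpow)
    qed
    finally show "q (curve s M a t) = poly p (of_real t)" ..
  qed
qed

lemma poly_eventually_nonzero:
  fixes p :: "complex poly"
  assumes "p \<noteq> 0"
  shows "\<forall>\<^sub>F t in at_top. poly p (of_real t) \<noteq> 0"
proof -
  have "finite (of_real -` {x. poly p x = 0} :: real set)"
    by (intro finite_vimageI poly_roots_finite assms inj_of_real)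
  then obtain b where b: "\<forall>t\<in>of_real -` {x. poly p x = 0}. t \<le> b"
    by (meson bdd_above.unfold bdd_above_finite)
  show ?thesis
    using eventually_gt_at_top[of b] by eventually_elim (use b in force)
qed

text \<open>The exponents of \<open>\<eta>\<close> are still unknown, so its numerator
  \<open>\<psi> * T\<close> and denominator \<open>\<phi> ^ J\<close> are lifted instead. The
  equation cleared of denominators fits into a box of size \<open>2 * d * K\<close> and holds on the
  curve; independence in the doubled box extends it to the torus, where integrality applies.\<close>

lemma lifting:
  fixes \<eta> \<psi> \<phi> T F :: "complex poly"
  assumes eq: "(\<Sum>k\<le>d. smult (\<gamma> k) (monom 1 (k * m)) * \<eta> ^ (d - k)) = F"
    and \<gamma>: "\<gamma> 0 = 1" and d: "d > 0" and \<phi>: "\<phi> \<noteq> 0" and T: "\<psi> * T = \<eta> * \<phi> ^ J"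
    and rep: "\<And>n. coeff F n \<noteq> 0 \<Longrightarrow> box_rep s M C n" "\<And>n. coeff \<psi> n \<noteq> 0 \<Longrightarrow> box_rep s M C n"
      "\<And>n. coeff \<phi> n \<noteq> 0 \<Longrightarrow> box_rep s M C n" "box_rep s M C m"
      "\<And>n. coeff T n \<noteq> 0 \<Longrightarrow> box_rep s M (J * C) n"
    and indep: "box_independent s M (4 * d * ((J + 1) * C))"
    and n: "coeff \<eta> n \<noteq> 0"
  shows "box_rep s M (4 * ((J + 1) * C)) n"
proof -
  define K where "K = (J + 1) * C"
  obtain qF where qF: "laurent s C qF" "\<And>a t. t > 0 \<Longrightarrow> qF (curve s M a t) = poly F (of_real t)"
    using laurent_lift[OF rep(1)] by blast
  obtain q\<psi> where q\<psi>: "laurent s C q\<psi>" "\<And>a t. t > 0 \<Longrightarrow> q\<psi> (curve s M a t) = poly \<psi> (of_real t)"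
    using laurent_lift[OF rep(2)] by blast
  obtain q\<phi> where q\<phi>: "laurent s C q\<phi>" "\<And>a t. t > 0 \<Longrightarrow> q\<phi> (curve s M a t) = poly \<phi> (of_real t)"
    using laurent_lift[OF rep(3)] by blast
  obtain qT where qT: "laurent s (J * C) qT" "\<And>a t. t > 0 \<Longrightarrow> qT (curve s M a t) = poly T (of_real t)"
    using laurent_lift[OF rep(5)] by blast
  have "coeff (monom 1 m :: complex poly) n \<noteq> 0 \<Longrightarrow> box_rep s M C n" for n
    using rep(4) by (auto split: if_splits)
  then obtain W where W: "laurent s C W" "\<And>a t. t > 0 \<Longrightarrow> W (curve s M a t) = poly (monom 1 m) (of_real t)"
    using laurent_lift[of "monom 1 m" s M C] by blast
  define U where "U a = q\<psi> a * qT a" for a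
  define V where "V a = q\<phi> a ^ J" for a
  have CK: "C \<le> K" "C + J * C \<le> K" "J * C \<le> K" by (auto simp: K_def)
  have lp: "laurent s K U" "laurent s K V" "laurent s K W" "laurent s K qF"
    unfolding U_def V_def
    using laurent_mono[OF laurent_mult[OF q\<psi>(1) qT(1)] CK(2)] laurent_mono[OF laurent_power[OF q\<phi>(1)] CK(3)]
      laurent_mono[OF W(1) CK(1)] laurent_mono[OF qF(1) CK(1)] by auto
  have ident: "(\<Sum>k\<le>d. \<gamma> k * W a ^ k * U a ^ (d - k) * V a ^ k) = qF a * V a ^ d"
    if a: "unital s a" for a
  proof -
    define Z where "Z a = (\<Sum>k\<le>d. \<gamma> k * (W a ^ k * U a ^ (d - k) * V a ^ k)) + (- 1) * (qF a * V a ^ d)" for a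
    have "laurent s (2 * d * K) Z"
      unfolding Z_def
    proof (intro laurent_add laurent_sum laurent_cmult)
      fix k assume "k \<in> {..d}"
      then have "k * K + (d - k) * K + k * K \<le> 2 * d * K"
        by (simp flip: add_mult_distrib)
      then show "laurent s (2 * d * K) (\<lambda>a. W a ^ k * U a ^ (d - k) * V a ^ k)"
        by (rule laurent_mono[rotated]) (intro laurent_mult laurent_power lp)
    next
      have "K + d * K \<le> 2 * d * K" using d by (cases d) simp_all
      then show "laurent s (2 * d * K) (\<lambda>a. qF a * V a ^ d)"
        by (rule laurent_mono[rotated]) (intro laurent_mult laurent_power lp)
    qed
    moreover have "box_independent s M (2 * (2 * d * K))"
      using indep by (simp add: K_def mult.assoc)
    moreover have "\<exists>\<^sub>F t in at_top. Z (curve s M (\<lambda>_. 1) t) = 0"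
    proof (intro eventually_frequently)
      show "\<forall>\<^sub>F t in at_top. Z (curve s M (\<lambda>_. 1) t) = 0"
        using eventually_gt_at_top[of 0]
      proof eventually_elim
        case (elim t)
        define x where "x = complex_of_real t"
        have U: "U (curve s M (\<lambda>_. 1) t) = poly \<eta> x * poly \<phi> x ^ J"
          using elim arg_cong[OF T, of "\<lambda>p. poly p x"] by (simp add: U_def q\<psi> qT x_def)
        have V: "V (curve s M (\<lambda>_. 1) t) = poly \<phi> x ^ J" using elim by (simp add: V_def q\<phi> x_def)
        have "(\<Sum>k\<le>d. \<gamma> k * (W (curve s M (\<lambda>_. 1) t) ^ k * U (curve s M (\<lambda>_. 1) t) ^ (d - k) * V (curve s M (\<lambda>_. 1) t) ^ k))
            = (\<Sum>k\<le>d. \<gamma> k * (x ^ (k * m)) * poly \<eta> x ^ (d - k)) * (poly \<phi> x ^ J) ^ d"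
          unfolding sum_distrib_right
        proof (intro sum.cong refl)
          fix k assume "k \<in> {..d}"
          then have "(poly \<phi> x ^ J) ^ d = (poly \<phi> x ^ J) ^ (d - k) * (poly \<phi> x ^ J) ^ k"
            by (simp flip: power_add)
          moreover have "W (curve s M (\<lambda>_. 1) t) ^ k = x ^ (k * m)"
            using elim by (simp add: W x_def poly_monom power_mult[symmetric] mult.commute)
          ultimately show "\<gamma> k * (W (curve s M (\<lambda>_. 1) t) ^ k * U (curve s M (\<lambda>_. 1) t) ^ (d - k) * V (curve s M (\<lambda>_. 1) t) ^ k)
              = \<gamma> k * x ^ (k * m) * poly \<eta> x ^ (d - k) * (poly \<phi> x ^ J) ^ d"
            unfolding U V by (simp add: power_mult_distrib)
        qed
        also have "\<dots> = qF (curve s M (\<lambda>_. 1) t) * V (curve s M (\<lambda>_. 1) t) ^ d"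
          unfolding V using elim arg_cong[OF eq, of "\<lambda>p. poly p x"]
          by (simp add: qF x_def poly_sum poly_monom mult.assoc)
        finally show ?case by (simp add: Z_def)
      qed
    qed simp
    ultimately have "Z a = 0" by (rule laurent_zero) (rule a)
    then show ?thesis by (simp add: Z_def mult.assoc)
  qed
  have u1: "unital s (\<lambda>_. 1)" by (simp add: unital_def)
  have "\<exists>e\<in>Box s (4 * K). real n = wt s M e"
  proof (rule support_of_integral_quotient[OF lp \<gamma> d ident u1 _ _ n])
    show "\<forall>\<^sub>F t in at_top. V (curve s M (\<lambda>_. 1) t) \<noteq> 0"
      using poly_eventually_nonzero[OF \<phi>] eventually_gt_at_top[of 0]
      by eventually_elim (simp add: V_def q\<phi>)
    show "\<forall>\<^sub>F t in at_top. U (curve s M (\<lambda>_. 1) t) = poly \<eta> (of_real t) * V (curve s M (\<lambda>_. 1) t)"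
      using eventually_gt_at_top[of 0]
    proof eventually_elim
      case (elim t)
      then show ?case using arg_cong[OF T, of "\<lambda>p. poly p (of_real t)"]
        by (simp add: U_def V_def q\<phi> q\<psi> qT)
    qed
  qed
  then show ?thesis by (simp add: box_rep_def K_def)
qed

section \<open>Generators of the exponents\<close>

text \<open>Generators are fractions. Controlling their denominators and numerators over
  \<open>S\<close> lets a bound in terms of generators be translated back to the given
  exponents.\<close>

definition gens_from :: "nat set \<Rightarrow> nat \<Rightarrow> nat \<Rightarrow> (nat \<Rightarrow> real) \<Rightarrow> bool" where
  "gens_from S X s M \<longleftrightarrow> (\<forall>j<s. \<exists>D b. 1 \<le> D \<and> D \<le> X \<and> (\<forall>i\<in>S. \<bar>b i\<bar> \<le> int X) \<and>
    real D * M j = (\<Sum>i\<in>S. of_int (b i) * real i))"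

definition skip :: "nat \<Rightarrow> nat \<Rightarrow> nat" where
  "skip k j = (if j < k then j else Suc j)"

lemma sum_skip:
  fixes f :: "nat \<Rightarrow> 'a::comm_monoid_add"
  assumes "k \<le> s"
  shows "(\<Sum>j<Suc s. f j) = f k + (\<Sum>j<s. f (skip k j))"
proof -
  have "bij_betw (skip k) {..<s} ({..<Suc s} - {k})"
  proof (rule bij_betwI')
    show "\<exists>x\<in>{..<s}. y = skip k x" if "y \<in> {..<Suc s} - {k}" for y
      using that assms by (intro bexI[of _ "if y < k then y else y - 1"]) (auto simp: skip_def)
  qed (use assms in \<open>auto simp: skip_def split: if_splits\<close>)
  then have "(\<Sum>j<s. f (skip k j)) = (\<Sum>j\<in>{..<Suc s} - {k}. f j)"
    by (rule sum.reindex_bij_betw)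
  then show ?thesis using assms by (simp only: sum.remove[of "{..<Suc s}" k f] finite_lessThan lessThan_iff less_Suc_eq_le)
qed

text \<open>A relation \<open>e\<close> with \<open>e k \<noteq> 0\<close> expresses
  \<open>M k\<close> by the other generators; dividing these by \<open>e k\<close> keeps all
  coordinates integral. Each step removes a generator, so there are at most \<open>s\<close>. The
  independence \<open>\<Phi>\<close> required depends on the current bound, hence the iterated
  growth function.\<close>

lemma eliminate_relations:
  fixes \<Phi> :: "nat \<Rightarrow> nat"
  assumes \<Phi>: "\<And>X. X > 0 \<Longrightarrow> \<Phi> X > 0"
    and "gens_from S X s M" "\<And>n. n \<in> Q \<Longrightarrow> box_rep s M X n" "X > 0"
  obtains s' X' M' where "s' \<le> s" "X' \<le> ((\<lambda>X. 2 * X * \<Phi> X) ^^ s) X" "X' > 0" "gens_from S X' s' M'"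
    "\<And>n. n \<in> Q \<Longrightarrow> box_rep s' M' X' n" "box_independent s' M' (\<Phi> X')"
proof -
  let ?g = "\<lambda>X. 2 * X * \<Phi> X"
  have infl: "X \<le> ?g X" for X using \<Phi>[of X] by (cases "X = 0") auto
  have iter: "X \<le> (?g ^^ k) X" for k X
    by (induction k) (auto intro: order_trans infl)
  have "\<exists>s' X' M'. s' \<le> s \<and> X' \<le> (?g ^^ s) X \<and> X' > 0 \<and> gens_from S X' s' M' \<and>
      (\<forall>n\<in>Q. box_rep s' M' X' n) \<and> box_independent s' M' (\<Phi> X')"
    using assms(2-4)
  proof (induction s arbitrary: M X)
    case 0
    have "box_independent 0 M (\<Phi> X)" by (auto simp: box_independent_def Box_def)
    with 0 show ?case by (intro exI[of _ 0] exI[of _ X] exI[of _ M]) auto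
  next
    case (Suc s)
    show ?case
    proof (cases "box_independent (Suc s) M (\<Phi> X)")
      case True
      with Suc.prems iter[of X "Suc s"] show ?thesis
        by (intro exI[of _ "Suc s"] exI[of _ X] exI[of _ M]) (simp del: funpow.simps)
    next
      case False
      then obtain e where e: "e \<in> Box (Suc s) (\<Phi> X)" "wt (Suc s) M e = 0" "e \<noteq> (\<lambda>_. 0)"
        by (auto simp: box_independent_def)
      then obtain k where k: "k < Suc s" "e k \<noteq> 0"
        by (auto simp: Box_def fun_eq_iff) (meson not_less)
      define M' where "M' j = M (skip k j) / of_int (e k)" for j
      have skip: "j < s \<Longrightarrow> skip k j < Suc s" for j by (simp add: skip_def)
      have gens: "gens_from S (?g X) s M'"
        unfolding gens_from_def
      proof (intro allI impI)
        fix j assume "j < s"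
        then obtain D b where Db: "1 \<le> D" "D \<le> X" "\<And>i. i \<in> S \<Longrightarrow> \<bar>b i\<bar> \<le> int X"
          "real D * M (skip k j) = (\<Sum>i\<in>S. of_int (b i) * real i)"
          using Suc.prems(1) skip[of j] unfolding gens_from_def by blast
        have ek: "nat \<bar>e k\<bar> \<le> \<Phi> X" using e(1) k by (auto simp: Box_def)
        show "\<exists>D b. 1 \<le> D \<and> D \<le> ?g X \<and> (\<forall>i\<in>S. \<bar>b i\<bar> \<le> int (?g X)) \<and>
            real D * M' j = (\<Sum>i\<in>S. of_int (b i) * real i)"
        proof (intro exI conjI ballI)
          \<comment> \<open>Denominators are positive, so the sign of \<open>e k\<close> moves into
            the numerators.\<close>
          show "1 \<le> D * nat \<bar>e k\<bar>" using Db(1) k(2) by simp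
          show "D * nat \<bar>e k\<bar> \<le> ?g X" using mult_le_mono[OF Db(2) ek] by simp
          fix i assume "i \<in> S"
          then have "\<bar>sgn (e k) * b i\<bar> \<le> int X" using Db(3)[of i] k(2) by (simp add: abs_mult)
          then show "\<bar>sgn (e k) * b i\<bar> \<le> int (?g X)" using infl[of X] by linarith
        next
          have "real (D * nat \<bar>e k\<bar>) * M' j = of_int (sgn (e k)) * (real D * M (skip k j))"
            using k(2) by (auto simp: M'_def sgn_if abs_if)
          also have "\<dots> = (\<Sum>i\<in>S. of_int (sgn (e k) * b i) * real i)"
            unfolding Db(4) by (simp add: sum_distrib_left mult.assoc)
          finally show "real (D * nat \<bar>e k\<bar>) * M' j = (\<Sum>i\<in>S. of_int (sgn (e k) * b i) * real i)" .
        qed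
      qed
      have rep: "box_rep s M' (?g X) n" if nQ: "n \<in> Q" for n
      proof -
        obtain c where c: "c \<in> Box (Suc s) X" "real n = wt (Suc s) M c"
          using Suc.prems(2)[OF nQ] by (auto simp: box_rep_def)
        \<comment> \<open>Substituting for \<open>M k\<close> leaves the coordinates
          \<open>c j - c k * e j / e k\<close>; the new generators absorb the division by
          \<open>e k\<close>.\<close>
        define c' where "c' j = (if j < s then c (skip k j) * e k - c k * e (skip k j) else 0)" for j
        have "c' \<in> Box s (?g X)"
          unfolding Box_def
        proof (intro CollectI conjI allI impI)
          fix j assume j: "j < s"
          have "\<bar>c (skip k j)\<bar> \<le> int X" "\<bar>c k\<bar> \<le> int X" "\<bar>e k\<bar> \<le> int (\<Phi> X)" "\<bar>e (skip k j)\<bar> \<le> int (\<Phi> X)"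
            using c(1) e(1) k(1) skip[OF j] by (auto simp: Box_def)
          then have "\<bar>c (skip k j) * e k\<bar> \<le> int X * int (\<Phi> X)" "\<bar>c k * e (skip k j)\<bar> \<le> int X * int (\<Phi> X)"
            unfolding abs_mult by (intro mult_mono; simp)+
          then have "\<bar>c' j\<bar> \<le> 2 * (int X * int (\<Phi> X))" using j by (simp add: c'_def)
          then show "\<bar>c' j\<bar> \<le> int (?g X)" by simp
        qed (simp add: c'_def)
        moreover have "real n = wt s M' c'"
        proof -
          define R where "R f = (\<Sum>j<s. of_int (f (skip k j)) * M (skip k j))" for f :: "nat \<Rightarrow> int"
          have ks: "k \<le> s" using k by simp
          have w: "wt (Suc s) M f = of_int (f k) * M k + R f" for f
            unfolding wt_def R_def by (rule sum_skip[OF ks])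
          have "wt s M' c' = (\<Sum>j<s. (of_int (c (skip k j)) * of_int (e k) - of_int (c k) * of_int (e (skip k j))) * (M (skip k j) / of_int (e k)))"
            unfolding wt_def by (intro sum.cong) (simp_all add: c'_def M'_def)
          also have "\<dots> = (\<Sum>j<s. of_int (c (skip k j)) * M (skip k j) - of_int (c k) / of_int (e k) * (of_int (e (skip k j)) * M (skip k j)))"
            using k(2) by (intro sum.cong refl) (simp add: field_simps)
          also have "\<dots> = R c - of_int (c k) / of_int (e k) * R e"
            unfolding R_def by (simp add: sum_subtractf sum_distrib_left)
          also have "R e = - (of_int (e k) * M k)" using e(2) w[of e] by simp
          finally show ?thesis using c(2) w[of c] k(2) by simp
        qed
        ultimately show ?thesis by (auto simp: box_rep_def)
      qed
      have pos: "?g X > 0" using Suc.prems(3) \<Phi> by simp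
      from Suc.IH[OF gens rep pos] obtain s' X' M' where
        "s' \<le> s" "X' \<le> (?g ^^ s) (?g X)" "X' > 0" "gens_from S X' s' M'"
        "\<forall>n\<in>Q. box_rep s' M' X' n" "box_independent s' M' (\<Phi> X')" by blast
      moreover have "(?g ^^ Suc s) X = (?g ^^ s) (?g X)" by (simp only: funpow_Suc_right comp_apply)
      moreover have "s' \<le> Suc s" using calculation(1) by simp
      ultimately show ?thesis by metis
    qed
  qed
  then show ?thesis using that by blast
qed

text \<open>A form of the bound free of generators: a rational combination of \<open>S\<close> with
  common denominator \<open>D\<close>. Only finitely many \<open>n\<close> qualify, in number
  bounded by \<open>C\<close> and \<open>card S\<close>.\<close>

definition comb :: "nat set \<Rightarrow> nat \<Rightarrow> nat \<Rightarrow> bool" where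
  "comb S C n \<longleftrightarrow> (\<exists>D b. 1 \<le> D \<and> D \<le> C \<and> (\<forall>i\<in>S. \<bar>b i\<bar> \<le> int C) \<and>
    int D * int n = (\<Sum>i\<in>S. b i * int i))"

lemma comb_0: "C \<ge> 1 \<Longrightarrow> comb S C 0"
  unfolding comb_def by (intro exI[of _ 1] exI[of _ "\<lambda>_. 0"]) auto

lemma comb_superset:
  assumes "comb S C n" "S \<subseteq> S'" "finite S'"
  shows "comb S' C n"
proof -
  obtain D b where Db: "1 \<le> D" "D \<le> C" "\<And>i. i \<in> S \<Longrightarrow> \<bar>b i\<bar> \<le> int C"
    "int D * int n = (\<Sum>i\<in>S. b i * int i)" using assms(1) by (auto simp: comb_def)
  have "(\<Sum>i\<in>S. b i * int i) = (\<Sum>i\<in>S'. (if i \<in> S then b i else 0) * int i)"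
    using assms by (intro sum.mono_neutral_cong_left) auto
  then show ?thesis unfolding comb_def using Db
    by (intro exI[of _ D] exI[of _ "\<lambda>i. if i \<in> S then b i else 0"]) auto
qed

text \<open>All denominators of the generators are at most \<open>X\<close>, so
  \<open>fact X\<close> is a common multiple of them; the numerators add up over the
  \<open>s\<close> generators.\<close>

lemma comb_of_box_rep:
  assumes S: "finite S" and gens: "gens_from S X s M" and rep: "box_rep s M C n"
  shows "comb S ((s * C * X + 1) * fact X) n"
proof -
  obtain e where e: "e \<in> Box s C" "real n = wt s M e" using rep by (auto simp: box_rep_def)
  obtain D b where Db: "\<And>j. j < s \<Longrightarrow> 1 \<le> D j \<and> D j \<le> X"
    "\<And>j i. j < s \<Longrightarrow> i \<in> S \<Longrightarrow> \<bar>b j i\<bar> \<le> int X"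
    "\<And>j. j < s \<Longrightarrow> real (D j) * M j = (\<Sum>i\<in>S. of_int (b j i) * real i)"
    using gens unfolding gens_from_def by metis
  define w where "w j = fact X div D j" for j
  have w: "w j * D j = fact X" if "j < s" for j
    using Db(1)[OF that] dvd_fact[of "D j" X] by (simp add: w_def)
  define c where "c i = (\<Sum>j<s. e j * int (w j) * b j i)" for i
  have "real_of_int (int (fact X) * int n) = of_int (\<Sum>i\<in>S. c i * int i)"
  proof -
    have "real_of_int (int (fact X) * int n) = (\<Sum>j<s. of_int (e j) * (real (fact X) * M j))"
      using e(2) by (simp add: wt_def sum_distrib_left mult_ac)
    also have "\<dots> = (\<Sum>j<s. \<Sum>i\<in>S. of_int (e j) * of_int (int (w j)) * of_int (b j i) * real i)"
    proof (intro sum.cong refl)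
      fix j assume "j \<in> {..<s}"
      then have j: "j < s" by simp
      have "real (fact X) * M j = real (w j) * (real (D j) * M j)"
        unfolding w[OF j, symmetric] by simp
      then show "of_int (e j) * (real (fact X) * M j)
          = (\<Sum>i\<in>S. of_int (e j) * of_int (int (w j)) * of_int (b j i) * real i)"
        unfolding Db(3)[OF j] by (simp add: sum_distrib_left mult.assoc)
    qed
    also have "\<dots> = (\<Sum>i\<in>S. \<Sum>j<s. of_int (e j) * of_int (int (w j)) * of_int (b j i) * real i)"
      by (rule sum.swap)
    also have "\<dots> = of_int (\<Sum>i\<in>S. c i * int i)"
      by (simp add: c_def sum_distrib_right)
    finally show ?thesis .
  qed
  then have eq: "int (fact X) * int n = (\<Sum>i\<in>S. c i * int i)" by (simp only: of_int_eq_iff)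
  have c: "\<bar>c i\<bar> \<le> int ((s * C * X + 1) * fact X)" if i: "i \<in> S" for i
  proof -
    have "\<bar>c i\<bar> \<le> (\<Sum>j<s. int C * int (fact X) * int X)"
      unfolding c_def
    proof (rule order_trans[OF sum_abs sum_mono])
      fix j assume "j \<in> {..<s}"
      then have j: "j < s" by simp
      have "w j \<le> w j * D j" using Db(1)[OF j] by simp
      then have "w j \<le> fact X" using w[OF j] by simp
      moreover have "\<bar>e j\<bar> \<le> int C" using e(1) j by (simp add: Box_def)
      ultimately have "\<bar>e j\<bar> * int (w j) * \<bar>b j i\<bar> \<le> int C * int (fact X) * int X"
        using Db(2)[OF j i] by (intro mult_mono) (simp_all del: of_nat_fact)
      then show "\<bar>e j * int (w j) * b j i\<bar> \<le> int C * int (fact X) * int X"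
        by (simp add: abs_mult)
    qed
    also have "\<dots> = int (s * C * X * fact X)" by simp
    also have "\<dots> \<le> int ((s * C * X + 1) * fact X)" by (simp only: of_nat_le_iff) simp
    finally show ?thesis .
  qed
  show ?thesis unfolding comb_def
    by (intro exI[of _ "fact X"] exI[of _ c] conjI ballI c eq) simp_all
qed

section \<open>Computability of the bound\<close>

text \<open>The inductive class speaks of functions on all lists; allowing agreement on lists of
  length \<open>n\<close> makes it stable under rewriting of the arguments.\<close>

definition gr :: "nat \<Rightarrow> (nat list \<Rightarrow> nat) \<Rightarrow> bool" where
  "gr n f \<longleftrightarrow> (\<exists>F. general_recursive n F \<and> (\<forall>xs. length xs = n \<longrightarrow> F xs = f xs))"

lemma gr_cong: "gr n f \<Longrightarrow> (\<And>xs. length xs = n \<Longrightarrow> f xs = g xs) \<Longrightarrow> gr n g"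
  by (auto simp: gr_def)

lemma gr_proj: "i < n \<Longrightarrow> gr n (\<lambda>xs. xs ! i)"
  by (auto simp: gr_def intro: general_recursive.proj)

lemma gr_comp:
  assumes "gr (length gs) f" "\<forall>g\<in>set gs. gr n g"
  shows "gr n (\<lambda>xs. f (map (\<lambda>g. g xs) gs))"
proof -
  obtain F where F: "general_recursive (length gs) F" "\<And>xs. length xs = length gs \<Longrightarrow> F xs = f xs"
    using assms(1) by (auto simp: gr_def)
  have "\<exists>G. \<forall>g\<in>set gs. general_recursive n (G g) \<and> (\<forall>xs. length xs = n \<longrightarrow> G g xs = g xs)"
    using assms(2) unfolding gr_def by (rule bchoice)
  then obtain G where G: "\<And>g. g \<in> set gs \<Longrightarrow> general_recursive n (G g)"
    "\<And>g xs. g \<in> set gs \<Longrightarrow> length xs = n \<Longrightarrow> G g xs = g xs" by blast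
  have "general_recursive n (\<lambda>xs. F (map (\<lambda>g. g xs) (map G gs)))"
    using F G by (intro general_recursive.comp) auto
  moreover have "F (map (\<lambda>g. g xs) (map G gs)) = f (map (\<lambda>g. g xs) gs)" if "length xs = n" for xs
  proof -
    have "map (\<lambda>g. g xs) (map G gs) = map (\<lambda>g. g xs) gs" using that G(2) by simp
    moreover have "F (map (\<lambda>g. g xs) gs) = f (map (\<lambda>g. g xs) gs)" by (rule F(2)) simp
    ultimately show ?thesis by (simp only:)
  qed
  ultimately show ?thesis by (auto simp: gr_def)
qed

lemma gr_comp1: "gr 1 (\<lambda>ys. f (ys ! 0)) \<Longrightarrow> gr n a \<Longrightarrow> gr n (\<lambda>xs. f (a xs))"
  using gr_comp[of "[a]" "\<lambda>ys. f (ys ! 0)" n] by simp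

lemma gr_comp2:
  "gr 2 (\<lambda>ys. f (ys ! 0) (ys ! 1)) \<Longrightarrow> gr n a \<Longrightarrow> gr n b \<Longrightarrow> gr n (\<lambda>xs. f (a xs) (b xs))"
  using gr_comp[of "[a, b]" "\<lambda>ys. f (ys ! 0) (ys ! 1)" n] by (simp add: numeral_2_eq_2)

lemma gr_comp3:
  "gr 3 (\<lambda>ys. f (ys ! 0) (ys ! 1) (ys ! 2)) \<Longrightarrow> gr n a \<Longrightarrow> gr n b \<Longrightarrow> gr n c \<Longrightarrow>
    gr n (\<lambda>xs. f (a xs) (b xs) (c xs))"
  using gr_comp[of "[a, b, c]" "\<lambda>ys. f (ys ! 0) (ys ! 1) (ys ! 2)" n]
  by (simp add: numeral_3_eq_3 numeral_2_eq_2)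

lemma gr_Suc: "gr n f \<Longrightarrow> gr n (\<lambda>xs. Suc (f xs))"
proof (rule gr_comp1[of Suc])
  show "gr 1 (\<lambda>ys. Suc (ys ! 0))"
    unfolding gr_def by (rule exI, rule conjI, rule general_recursive.succ) (auto simp: length_Suc_conv)
qed

lemma gr_const: "gr n (\<lambda>_. k)"
proof (induction k)
  case 0
  show ?case by (auto simp: gr_def intro: general_recursive.zero)
qed (rule gr_Suc)

text \<open>Primitive recursion runs on the head of the list. Composition with \<open>k\<close> and
  all projections permits an arbitrary recursion count that leaves the parameters in place.\<close>

lemma gr_rec:
  assumes f: "gr n f" and g: "gr (Suc (Suc n)) (\<lambda>ys. g (ys ! 0) (ys ! 1) (tl (tl ys)))" and k: "gr n k"
  shows "gr n (\<lambda>xs. rec_nat (f xs) (\<lambda>i r. g i r xs) (k xs))"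
proof -
  obtain F where F: "general_recursive n F" "\<And>xs. length xs = n \<Longrightarrow> F xs = f xs"
    using f by (auto simp: gr_def)
  obtain G where G: "general_recursive (Suc (Suc n)) G"
    "\<And>i r xs. length xs = n \<Longrightarrow> G (i # r # xs) = g i r xs"
    using g by (auto simp: gr_def)
  have "general_recursive (Suc n) (\<lambda>xs. rec_nat (F (tl xs)) (\<lambda>k r. G (k # r # tl xs)) (hd xs))"
    by (rule general_recursive.prim_rec[OF F(1) G(1)])
  moreover have "rec_nat (F xs) (\<lambda>k r. G (k # r # xs)) i = rec_nat (f xs) (\<lambda>i r. g i r xs) i"
    if "length xs = n" for i xs
    by (induction i) (simp_all add: F G that)
  ultimately have 1: "gr (Suc n) (\<lambda>xs. rec_nat (f (tl xs)) (\<lambda>i r. g i r (tl xs)) (hd xs))"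
    unfolding gr_def by (intro exI[of _ "\<lambda>xs. rec_nat (F (tl xs)) (\<lambda>k r. G (k # r # tl xs)) (hd xs)"]) auto
  let ?gs = "k # map (\<lambda>i xs. xs ! i) [0..<n]"
  have "gr n (\<lambda>xs. rec_nat (f (tl (map (\<lambda>g. g xs) ?gs))) (\<lambda>i r. g i r (tl (map (\<lambda>g. g xs) ?gs))) (hd (map (\<lambda>g. g xs) ?gs)))"
    using 1 k by (intro gr_comp) (auto intro: gr_proj)
  then show ?thesis
  proof (rule gr_cong)
    fix xs :: "nat list" assume "length xs = n"
    then have "tl (map (\<lambda>g. g xs) ?gs) = xs" by (auto simp: comp_def intro: map_nth)
    then show "rec_nat (f (tl (map (\<lambda>g. g xs) ?gs))) (\<lambda>i r. g i r (tl (map (\<lambda>g. g xs) ?gs))) (hd (map (\<lambda>g. g xs) ?gs))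
        = rec_nat (f xs) (\<lambda>i r. g i r xs) (k xs)" by simp
  qed
qed

lemma gr_add2: "gr 2 (\<lambda>ys. ys ! 0 + ys ! 1)"
proof -
  have "gr 2 (\<lambda>xs. rec_nat (xs ! 1) (\<lambda>i r. Suc r) (xs ! 0))"
    by (intro gr_rec gr_proj gr_Suc) simp_all
  then show ?thesis
  proof (rule gr_cong)
    fix xs :: "nat list"
    have "rec_nat b (\<lambda>i r. Suc r) a = a + b" for a b :: nat by (induction a) simp_all
    then show "rec_nat (xs ! 1) (\<lambda>i r. Suc r) (xs ! 0) = xs ! 0 + xs ! 1" .
  qed
qed

lemma gr_add: "gr n f \<Longrightarrow> gr n g \<Longrightarrow> gr n (\<lambda>xs. f xs + g xs)"
  by (rule gr_comp2[OF gr_add2])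

lemma nth_tl_tl: "length ys = Suc (Suc n) \<Longrightarrow> i < n \<Longrightarrow> tl (tl ys) ! i = ys ! Suc (Suc i)"
  by (cases ys; cases "tl ys") auto

lemma gr_tl_tl:
  assumes "gr n f"
  shows "gr (Suc (Suc n)) (\<lambda>ys. f (tl (tl ys)))"
proof -
  have "gr (Suc (Suc n)) (\<lambda>ys. f (map (\<lambda>g. g ys) (map (\<lambda>i ys. ys ! Suc (Suc i)) [0..<n])))"
    using assms by (intro gr_comp) (auto intro: gr_proj)
  then show ?thesis
  proof (rule gr_cong)
    fix ys :: "nat list" assume ys: "length ys = Suc (Suc n)"
    then have "map (\<lambda>g. g ys) (map (\<lambda>i ys. ys ! Suc (Suc i)) [0..<n]) = tl (tl ys)"
      by (intro nth_equalityI) (auto simp: nth_tl_tl)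
    then show "f (map (\<lambda>g. g ys) (map (\<lambda>i ys. ys ! Suc (Suc i)) [0..<n])) = f (tl (tl ys))" by simp
  qed
qed

lemma gr_mult2: "gr 2 (\<lambda>ys. ys ! 0 * ys ! 1)"
proof -
  have "gr 2 (\<lambda>xs. rec_nat 0 (\<lambda>i r. r + xs ! 1) (xs ! 0))"
    by (intro gr_rec gr_proj gr_add gr_const gr_tl_tl) simp_all
  then show ?thesis
  proof (rule gr_cong)
    fix xs :: "nat list"
    have "rec_nat 0 (\<lambda>i r. r + b) a = a * b" for a b :: nat by (induction a) simp_all
    then show "rec_nat 0 (\<lambda>i r. r + xs ! 1) (xs ! 0) = xs ! 0 * xs ! 1" .
  qed
qed

lemma gr_mult: "gr n f \<Longrightarrow> gr n g \<Longrightarrow> gr n (\<lambda>xs. f xs * g xs)"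
  by (rule gr_comp2[OF gr_mult2])

lemma gr_iterate:
  assumes "gr n f" "gr (Suc n) (\<lambda>ys. s (ys ! 0) (tl ys))" "gr n k"
  shows "gr n (\<lambda>xs. ((\<lambda>x. s x xs) ^^ k xs) (f xs))"
proof -
  have "gr (Suc (Suc n)) (\<lambda>ys. s (map (\<lambda>g. g ys) (map (\<lambda>i ys. ys ! Suc i) [0..<Suc n]) ! 0)
      (tl (map (\<lambda>g. g ys) (map (\<lambda>i ys. ys ! Suc i) [0..<Suc n]))))"
    using assms(2) by (intro gr_comp[of _ "\<lambda>ys. s (ys ! 0) (tl ys)"]) (auto intro: gr_proj)
  then have "gr (Suc (Suc n)) (\<lambda>ys. s (ys ! 1) (tl (tl ys)))"
  proof (rule gr_cong)
    fix ys :: "nat list" assume ys: "length ys = Suc (Suc n)"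
    then have "map (\<lambda>g. g ys) (map (\<lambda>i ys. ys ! Suc i) [0..<Suc n]) = tl ys"
      by (intro nth_equalityI) (auto simp: nth_tl simp del: upt_Suc)
    then show "s (map (\<lambda>g. g ys) (map (\<lambda>i ys. ys ! Suc i) [0..<Suc n]) ! 0)
        (tl (map (\<lambda>g. g ys) (map (\<lambda>i ys. ys ! Suc i) [0..<Suc n]))) = s (ys ! 1) (tl (tl ys))"
      using ys by (simp add: nth_tl)
  qed
  then have "gr n (\<lambda>xs. rec_nat (f xs) (\<lambda>i r. s r xs) (k xs))"
    using assms by (intro gr_rec) auto
  then show ?thesis
  proof (rule gr_cong)
    fix xs :: "nat list"
    have "rec_nat a (\<lambda>i r. s r xs) j = ((\<lambda>x. s x xs) ^^ j) a" for a j by (induction j) simp_all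
    then show "rec_nat (f xs) (\<lambda>i r. s r xs) (k xs) = ((\<lambda>x. s x xs) ^^ k xs) (f xs)" .
  qed
qed

lemma gr_power: "gr n f \<Longrightarrow> gr n g \<Longrightarrow> gr n (\<lambda>xs. f xs ^ g xs)"
proof (rule gr_comp2[of "(^)"])
  have "gr 2 (\<lambda>xs. rec_nat 1 (\<lambda>i r. r * xs ! 0) (xs ! 1))"
    by (intro gr_rec gr_proj gr_mult gr_const gr_tl_tl) simp_all
  then show "gr 2 (\<lambda>ys. ys ! 0 ^ ys ! 1)"
  proof (rule gr_cong)
    fix xs :: "nat list"
    have "rec_nat 1 (\<lambda>i r. r * b) a = b ^ a" for a b :: nat by (induction a) (simp_all add: mult.commute)
    then show "rec_nat 1 (\<lambda>i r. r * xs ! 0) (xs ! 1) = xs ! 0 ^ xs ! 1" .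
  qed
qed

lemma gr_fact: "gr n f \<Longrightarrow> gr n (\<lambda>xs. fact (f xs))"
proof (rule gr_comp1[of fact])
  have "gr 1 (\<lambda>xs. rec_nat 1 (\<lambda>i r. Suc i * r) (xs ! 0))"
    by (intro gr_rec gr_proj gr_mult gr_const gr_Suc) simp_all
  then show "gr 1 (\<lambda>ys. fact (ys ! 0))"
  proof (rule gr_cong)
    fix xs :: "nat list"
    have "rec_nat 1 (\<lambda>i r. Suc i * r) a = fact a" for a :: nat by (induction a) simp_all
    then show "rec_nat 1 (\<lambda>i r. Suc i * r) (xs ! 0) = fact (xs ! 0)" .
  qed
qed

text \<open>With the cut at \<open>q\<close> and \<open>m \<le> K * q\<close>, the expansion has
  length \<open>2 * K\<close> and its exponents lie in a sumset of size at most
  \<open>(l + 1) ^ (2 * K)\<close>. Exponents below the cut must be smaller than \<open>m\<close>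
  divided by the sum of both, which is the next candidate for \<open>K\<close>.\<close>

definition scale_bound :: "nat \<Rightarrow> nat" where
  "scale_bound l = ((\<lambda>K. 2 * K + (l + 1) ^ (2 * K)) ^^ l) 1"

text \<open>Here \<open>c\<close> bounds the combinations for \<open>\<psi>\<close>. The iteration
  starts from the box of \<open>initial_generators\<close>, its factor
  \<open>4 * D * (J + 1) * X\<close> is the independence needed by \<open>lifting\<close>, and the
  result is the constant of \<open>comb_of_box_rep\<close> for a box of size
  \<open>4 * (J + 1) * X\<close>.\<close>

definition coeff_bound_step :: "nat \<Rightarrow> nat \<Rightarrow> nat \<Rightarrow> nat" where
  "coeff_bound_step D l c =
    (let J = 2 * scale_bound l; X = ((\<lambda>X. 2 * X * (4 * D * (J + 1) * X)) ^^ l) (c * fact D * fact c)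
     in (l * 4 * (J + 1) * X * X + 1) * fact X)"

fun coeff_bound :: "nat \<Rightarrow> nat \<Rightarrow> nat" where
  "coeff_bound D 0 = 1"
| "coeff_bound D (Suc l) = coeff_bound_step D (Suc l) (coeff_bound D l)"

text \<open>\<open>l + 2 ^ l\<close> bounds the outer degree, and \<open>c * (2 * c + 1) ^ l\<close>
  counts denominators and numerator vectors. The summand 3 covers the change of the constant term
  and the case of at most two terms.\<close>

definition terms_bound :: "nat \<Rightarrow> nat" where
  "terms_bound l =
    (let c = coeff_bound (l + 2 ^ l) l in 3 + c * (2 * c + 1) ^ l)"

lemma gr_scale_bound: "gr n f \<Longrightarrow> gr n (\<lambda>xs. scale_bound (f xs))"
proof (rule gr_comp1[of scale_bound])
  show "gr 1 (\<lambda>ys. scale_bound (ys ! 0))"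
    unfolding scale_bound_def
  proof (intro gr_iterate gr_const gr_proj)
    have "gr 2 (\<lambda>ys. 2 * ys ! 0 + (ys ! 1 + 1) ^ (2 * ys ! 0))"
      by (intro gr_add gr_mult gr_power gr_const gr_proj) simp_all
    then show "gr (Suc 1) (\<lambda>ys. 2 * ys ! 0 + (tl ys ! 0 + 1) ^ (2 * ys ! 0))"
      unfolding numeral_2_eq_2 One_nat_def by (rule gr_cong) (simp add: nth_tl)
  qed simp
qed

lemma gr_coeff_bound_step:
  "gr n f \<Longrightarrow> gr n g \<Longrightarrow> gr n h \<Longrightarrow> gr n (\<lambda>xs. coeff_bound_step (f xs) (g xs) (h xs))"
proof (rule gr_comp3[of coeff_bound_step])
  have it: "gr 3 (\<lambda>xs. ((\<lambda>X. 2 * X * (4 * xs ! 0 * (2 * scale_bound (xs ! 1) + 1) * X)) ^^ (xs ! 1))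
      (xs ! 2 * fact (xs ! 0) * fact (xs ! 2)))"
  proof (rule gr_iterate)
    show "gr 3 (\<lambda>xs. xs ! 2 * fact (xs ! 0) * fact (xs ! 2))"
      by (intro gr_mult gr_fact gr_proj) simp_all
    have "gr 4 (\<lambda>ys. 2 * ys ! 0 * (4 * ys ! 1 * (2 * scale_bound (ys ! 2) + 1) * ys ! 0))"
      by (intro gr_mult gr_add gr_const gr_proj gr_scale_bound) simp_all
    moreover have "Suc 3 = 4" by simp
    ultimately show "gr (Suc 3) (\<lambda>ys. 2 * ys ! 0 * (4 * tl ys ! 0 * (2 * scale_bound (tl ys ! 1) + 1) * ys ! 0))"
      by (simp only:) (rule gr_cong, simp_all add: nth_tl numeral_2_eq_2)
  qed (simp add: gr_proj)
  show "gr 3 (\<lambda>ys. coeff_bound_step (ys ! 0) (ys ! 1) (ys ! 2))"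
    unfolding coeff_bound_step_def Let_def
    by (intro gr_mult gr_add gr_fact gr_const gr_proj gr_scale_bound it) simp_all
qed

lemma gr_coeff_bound: "gr n f \<Longrightarrow> gr n g \<Longrightarrow> gr n (\<lambda>xs. coeff_bound (f xs) (g xs))"
proof (rule gr_comp2[of coeff_bound])
  have "gr 2 (\<lambda>xs. rec_nat 1 (\<lambda>i r. coeff_bound_step (xs ! 0) (Suc i) r) (xs ! 1))"
    by (intro gr_rec gr_proj gr_coeff_bound_step gr_const gr_tl_tl gr_Suc) simp_all
  then show "gr 2 (\<lambda>ys. coeff_bound (ys ! 0) (ys ! 1))"
  proof (rule gr_cong)
    fix xs :: "nat list"
    have "rec_nat 1 (\<lambda>i r. coeff_bound_step D (Suc i) r) l = coeff_bound D l" for D l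
      by (induction l) simp_all
    then show "rec_nat 1 (\<lambda>i r. coeff_bound_step (xs ! 0) (Suc i) r) (xs ! 1) = coeff_bound (xs ! 0) (xs ! 1)" .
  qed
qed

lemma computable_terms_bound: "computable terms_bound"
proof -
  have "gr 1 (\<lambda>xs. terms_bound (xs ! 0))"
    unfolding terms_bound_def Let_def
    by (intro gr_add gr_mult gr_power gr_const gr_proj gr_coeff_bound) simp_all
  then show ?thesis by (force simp: gr_def computable_def)
qed

section \<open>Exponents of the inner polynomial\<close>

fun sumset :: "nat set \<Rightarrow> nat \<Rightarrow> nat set" where
  "sumset S 0 = {0}"
| "sumset S (Suc J) = (\<lambda>(a, b). a + b) ` (insert 0 S \<times> sumset S J)"

lemma finite_sumset: "finite S \<Longrightarrow> finite (sumset S J)"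
  by (induction J) auto

lemma card_sumset: "finite S \<Longrightarrow> card (sumset S J) \<le> (card S + 1) ^ J"
proof (induction J)
  case (Suc J)
  have "card (sumset S (Suc J)) \<le> card (insert 0 S \<times> sumset S J)"
    unfolding sumset.simps using Suc.prems by (intro card_image_le) (simp add: finite_sumset)
  also have "\<dots> \<le> (card S + 1) * (card S + 1) ^ J"
    unfolding card_cartesian_product
    using Suc by (intro mult_le_mono) (auto simp: card_insert_if)
  finally show ?case by simp
qed simp

lemma coeff_mult_support:
  assumes "coeff (p * q) n \<noteq> 0"
  obtains i j where "n = i + j" "coeff p i \<noteq> 0" "coeff q j \<noteq> 0"
proof -
  have "(\<Sum>i\<le>n. coeff p i * coeff q (n - i)) \<noteq> 0" using assms by (simp add: coeff_mult)
  then obtain i where "i \<in> {..n}" "coeff p i * coeff q (n - i) \<noteq> 0"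
    by (rule sum.not_neutral_contains_not_neutral)
  then show ?thesis by (intro that[of i "n - i"]) auto
qed

lemma support_power_mult:
  assumes "\<And>n. coeff p n \<noteq> 0 \<Longrightarrow> n \<in> insert 0 S" "\<And>n. coeff r n \<noteq> 0 \<Longrightarrow> n \<in> sumset S k"
  shows "coeff (p ^ j * r) n \<noteq> 0 \<Longrightarrow> n \<in> sumset S (j + k)"
proof (induction j arbitrary: n)
  case 0
  then show ?case using assms(2) by simp
next
  case (Suc j)
  have "coeff (p * (p ^ j * r)) n \<noteq> 0" using Suc.prems by (simp add: mult.assoc)
  then obtain i i' where i: "n = i + i'" "coeff p i \<noteq> 0" "coeff (p ^ j * r) i' \<noteq> 0"
    by (rule coeff_mult_support)
  then have "(i, i') \<in> insert 0 S \<times> sumset S (j + k)" using assms(1) Suc.IH by blast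
  then show ?case using i(1) by force
qed

lemma box_rep_sumset:
  assumes "\<And>i. i \<in> S \<Longrightarrow> box_rep s M C i"
  shows "n \<in> sumset S J \<Longrightarrow> box_rep s M (J * C) n"
proof (induction J arbitrary: n)
  case 0
  then show ?case by (simp add: box_rep_0)
next
  case (Suc J)
  then obtain a b where "n = a + b" "a = 0 \<or> a \<in> S" "b \<in> sumset S J" by auto
  then show ?case using box_rep_add[of s M C a "J * C" b] assms Suc.IH box_rep_0 by auto
qed

text \<open>A multiplicative pigeonhole: \<open>A i\<close> holds the exponents \<open>r\<close>
  with \<open>m \<le> \<kappa> i * r\<close>. An exponent below its minimum that is not negligible
  joins \<open>A (Suc i)\<close>, so the sets grow until they would exceed \<open>S\<close>;
  \<open>q0\<close> keeps them nonempty.\<close>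

lemma scale_gap:
  assumes S: "finite S" "card S \<le> l" and q0: "q0 \<in> S" "m \<le> q0"
  obtains q K where "q \<in> S" "K \<le> scale_bound l" "m \<le> K * q"
    "\<And>r. r \<in> S \<Longrightarrow> r < q \<Longrightarrow> (2 * K + (l + 1) ^ (2 * K)) * r < m"
proof -
  define g where "g K = 2 * K + (l + 1) ^ (2 * K)" for K
  define \<kappa> where "\<kappa> i = (g ^^ i) 1" for i
  have mono: "\<kappa> i \<le> \<kappa> j" if "i \<le> j" for i j
    using that by (rule lift_Suc_mono_le[rotated]) (simp add: \<kappa>_def g_def)
  define A where "A i = {r \<in> S. m \<le> \<kappa> i * r}" for i
  define q where "q i = Min (A i)" for i
  have A: "finite (A i)" "q0 \<in> A i" for i
  proof -
    have "1 \<le> \<kappa> i" using mono[of 0 i] by (simp add: \<kappa>_def)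
    from mult_le_mono1[OF this, of q0] have "q0 \<le> \<kappa> i * q0" unfolding mult_1 .
    then have "m \<le> \<kappa> i * q0" using q0(2) by (rule order_trans[rotated])
    then show "q0 \<in> A i" using q0 by (simp add: A_def)
  qed (use S in \<open>simp add: A_def\<close>)
  have q: "q i \<in> A i" "\<And>r. r \<in> A i \<Longrightarrow> q i \<le> r" for i
    using A[of i] by (auto simp: q_def intro!: Min_in)
  have "\<exists>i\<le>l. \<forall>r\<in>S. r < q i \<longrightarrow> g (\<kappa> i) * r < m"
  proof (rule ccontr)
    assume bad: "\<not> ?thesis"
    have "i \<le> Suc l \<Longrightarrow> card (A i) > i" for i
    proof (induction i)
      case 0
      have "A 0 \<noteq> {}" using A by auto
      then show ?case using A(1)[of 0] by (simp add: card_gt_0_iff)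
    next
      case (Suc i)
      then obtain r where r: "r \<in> S" "r < q i" "m \<le> g (\<kappa> i) * r"
        using bad by (metis Suc_le_mono not_less)
      then have "r \<in> A (Suc i)" by (simp add: A_def \<kappa>_def)
      moreover have "r \<notin> A i" using q(2)[of r i] r(2) by auto
      moreover have "A i \<subseteq> A (Suc i)"
        using mono[of i "Suc i"] by (auto simp: A_def intro: order_trans[OF _ mult_le_mono1])
      ultimately have "card (A i) < card (A (Suc i))" by (intro psubset_card_mono A) auto
      then show ?case using Suc by simp
    qed
    from this[of "Suc l"] have "l < card (A (Suc l))" by simp
    also have "\<dots> \<le> card S" by (intro card_mono S) (auto simp: A_def)
    finally show False using S by simp
  qed
  then obtain i where i: "i \<le> l" "\<And>r. r \<in> S \<Longrightarrow> r < q i \<Longrightarrow> g (\<kappa> i) * r < m" by blast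
  show ?thesis
  proof (rule that[of "q i" "\<kappa> i"])
    show "q i \<in> S" "m \<le> \<kappa> i * q i" using q(1)[of i] by (auto simp: A_def)
    have "\<kappa> l = scale_bound l" unfolding \<kappa>_def scale_bound_def g_def ..
    then show "\<kappa> i \<le> scale_bound l" using mono[OF i(1)] by simp
    show "(2 * \<kappa> i + (l + 1) ^ (2 * \<kappa> i)) * r < m" if "r \<in> S" "r < q i" for r
      using i(2)[OF that] by (simp add: g_def)
  qed
qed

lemma coeff_bound_pos: "D \<ge> 1 \<Longrightarrow> coeff_bound D l \<ge> 1"
proof (induction l)
  case (Suc l)
  have "1 \<le> (fact X :: nat)" for X by (simp add: Suc_le_eq)
  then show ?case by (simp add: coeff_bound_step_def Let_def Suc_le_eq)
qed simp

text \<open>The elements of \<open>S\<close> divided by one common factorial generate everything: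
  \<open>fact Dm\<close> is divisible by \<open>d\<close>, which makes
  \<open>m = (d * m) / d\<close> an integral combination, and \<open>fact c\<close> absorbs the
  denominators of \<open>comb\<close>.\<close>

lemma initial_generators:
  assumes S: "finite S" "d * m \<in> S" and d: "1 \<le> d" "d \<le> Dm" and c: "c \<ge> 1"
  obtains M where "gens_from S (c * fact Dm * fact c) (card S) M"
    "\<And>n. n = m \<or> n \<in> S \<or> comb S c n \<Longrightarrow> box_rep (card S) M (c * fact Dm * fact c) n"
proof -
  define D :: nat where "D = fact Dm * fact c"
  have D: "D \<ge> 1" using fact_gt_zero[where 'a=nat] by (simp add: D_def Suc_le_eq)
  define X where "X = c * D"
  have DX: "D \<le> X" using c by (simp add: X_def)
  obtain idx where idx: "bij_betw idx {..<card S} S"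
    using ex_bij_betw_nat_finite[OF S(1)] by (auto simp: atLeast0LessThan)
  define M where "M j = real (idx j) / real D" for j
  have sum_idx: "(\<Sum>j<card S. f (idx j)) = (\<Sum>i\<in>S. f i)" for f :: "nat \<Rightarrow> real"
    by (rule sum.reindex_bij_betw[OF idx])
  have idxS: "idx j \<in> S" if "j < card S" for j using idx that by (auto simp: bij_betw_def)
  have rep: "box_rep (card S) M X n"
    if "\<And>i. i \<in> S \<Longrightarrow> \<bar>b i\<bar> \<le> int X" "real D * real n = (\<Sum>i\<in>S. of_int (b i) * real i)" for n b
  proof -
    have "(\<lambda>j. if j < card S then b (idx j) else 0) \<in> Box (card S) X"
      using that(1) idxS by (auto simp: Box_def)
    moreover have "real n = wt (card S) M (\<lambda>j. if j < card S then b (idx j) else 0)"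
    proof -
      have "wt (card S) M (\<lambda>j. if j < card S then b (idx j) else 0) = (\<Sum>j<card S. of_int (b (idx j)) * real (idx j) / real D)"
        unfolding wt_def by (intro sum.cong) (auto simp: M_def)
      also have "\<dots> = (\<Sum>i\<in>S. of_int (b i) * real i) / real D"
        by (simp add: sum_idx[of "\<lambda>i. of_int (b i) * real i / real D"] sum_divide_distrib)
      also have "\<dots> = real n" unfolding that(2)[symmetric] using D by simp
      finally show ?thesis by simp
    qed
    ultimately show ?thesis by (auto simp: box_rep_def)
  qed
  have single: "(\<Sum>i\<in>S. of_int (if i = k then x else 0) * real i) = of_int x * real k" if "k \<in> S" for k x
  proof -
    have "(\<Sum>i\<in>S. of_int (if i = k then x else 0) * real i) = (\<Sum>i\<in>S. if i = k then of_int x * real k else 0)"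
      by (intro sum.cong) auto
    then show ?thesis using that S(1) by simp
  qed
  have "gens_from S X (card S) M"
    unfolding gens_from_def
  proof (intro allI impI)
    fix j assume j: "j < card S"
    show "\<exists>D b. 1 \<le> D \<and> D \<le> X \<and> (\<forall>i\<in>S. \<bar>b i\<bar> \<le> int X) \<and> real D * M j = (\<Sum>i\<in>S. of_int (b i) * real i)"
      using D DX single[OF idxS[OF j], of 1]
      by (intro exI[of _ D] exI[of _ "\<lambda>i. if i = idx j then 1 else 0"]) (auto simp: M_def)
  qed
  moreover have "box_rep (card S) M X n" if n: "n = m \<or> n \<in> S \<or> comb S c n" for n
    using n
  proof (elim disjE)
    assume nm: "n = m"
    have "d dvd D" using d dvd_fact[of d Dm] by (simp add: D_def)
    then obtain k where k: "D = d * k" by (elim dvdE)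
    then have "k \<le> D" using d by simp
    then have kX: "k \<le> X" using DX by simp
    show ?thesis unfolding nm
    proof (rule rep[of "\<lambda>i. if i = d * m then int k else 0"])
      show "real D * real m = (\<Sum>i\<in>S. of_int (if i = d * m then int k else 0) * real i)"
        unfolding single[OF S(2)] by (simp add: k)
    qed (use kX in simp)
  next
    assume "n \<in> S"
    then show ?thesis
      using DX single[of n "int D"] by (intro rep[of "\<lambda>i. if i = n then int D else 0"]) auto
  next
    assume "comb S c n"
    then obtain E b where Eb: "1 \<le> E" "E \<le> c" "\<And>i. i \<in> S \<Longrightarrow> \<bar>b i\<bar> \<le> int c"
      "int E * int n = (\<Sum>i\<in>S. b i * int i)" by (auto simp: comb_def)
    have "E dvd D" using Eb dvd_fact[of E c] by (simp add: D_def)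
    then obtain k where k: "D = E * k" by (elim dvdE)
    then have kD: "k \<le> D" using Eb by simp
    show ?thesis
    proof (rule rep[of "\<lambda>i. b i * int k"])
      fix i assume "i \<in> S"
      then have "\<bar>b i\<bar> * int k \<le> int c * int D" using Eb(3) kD by (intro mult_mono) auto
      then show "\<bar>b i * int k\<bar> \<le> int X" by (simp add: abs_mult X_def)
    next
      have "real E * real n = (\<Sum>i\<in>S. of_int (b i) * real i)"
        using arg_cong[OF Eb(4), of real_of_int] by simp
      then have "real D * real n = real k * (\<Sum>i\<in>S. of_int (b i) * real i)" by (simp add: k)
      then show "real D * real n = (\<Sum>i\<in>S. of_int (b i * int k) * real i)"
        by (simp add: sum_distrib_left mult_ac)
    qed
  qed
  ultimately show ?thesis using that by (simp add: X_def D_def mult.assoc)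
qed

text \<open>The exponents of \<open>F\<close> below \<open>q\<close> are negligible against \<open>m\<close>; they form \<open>\<phi>\<close>, which is a \<open>d\<close>-th
  power \<open>\<psi>\<^sup>d\<close> with fewer exponents, and \<open>\<eta> = \<psi> T / \<phi>\<^sup>J\<close> can be lifted to several variables.\<close>

lemma support_comb:
  fixes \<eta> F :: "complex poly"
  assumes "finite S" "card S \<le> l" "1 \<le> d" "d \<le> Dm" "1 \<le> m" "d * m \<in> S"
    and "\<gamma> 0 = 1" "\<gamma> 1 = 0" "coeff \<eta> 0 = 1" "degree \<eta> \<le> m"
    and "\<And>n. coeff F n \<noteq> 0 \<Longrightarrow> n \<in> insert 0 S"
    and "(\<Sum>k\<le>d. smult (\<gamma> k) (monom 1 (k * m)) * \<eta> ^ (d - k)) = F"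
    and "coeff \<eta> n \<noteq> 0" "0 \<notin> S"
  shows "comb S (coeff_bound Dm l) n"
  using assms
proof (induction l arbitrary: S m \<gamma> \<eta> F n)
  case 0
  then show ?case by simp
next
  case (Suc l)
  note S = Suc.prems(1,2,14) and d = Suc.prems(3,4) and m = Suc.prems(5,6) and \<gamma> = Suc.prems(7,8)
    and \<eta> = Suc.prems(9,10) and F = Suc.prems(11) and eq = Suc.prems(12)
  \<comment> \<open>The exponent \<open>d * m\<close> in \<open>S\<close> is at least
    \<open>m\<close>, as needed to start the search for a cut.\<close>
  have "m \<le> d * m" using d by simp
  then obtain q K where qK: "q \<in> S" "K \<le> scale_bound (Suc l)" "m \<le> K * q"
    "\<And>r. r \<in> S \<Longrightarrow> r < q \<Longrightarrow> (2 * K + (Suc l + 1) ^ (2 * K)) * r < m"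
    using scale_gap[OF S(1,2) m(2)] by metis
  \<comment> \<open>Then \<open>2 * m \<le> J * q\<close>, so powers of \<open>\<epsilon>\<close>
    beyond \<open>J\<close> lie beyond order \<open>2 * m\<close>.\<close>
  define J where "J = 2 * K"
  define \<phi> where "\<phi> = poly_cutoff q F"
  define \<epsilon> where "\<epsilon> = F - \<phi>"
  define \<delta> where "\<delta> = degree \<phi>"
  have q0: "q > 0" using qK(1) S(3) by (cases q) auto
  have c\<phi>: "coeff \<phi> i = (if i < q then coeff F i else 0)" for i by (simp add: \<phi>_def coeff_poly_cutoff)
  have c\<epsilon>: "coeff \<epsilon> i = (if i < q then 0 else coeff F i)" for i by (simp add: \<epsilon>_def c\<phi>)
  \<comment> \<open>Since \<open>\<gamma> 1 = 0\<close>, the lower-order terms of the equation start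
    with \<open>k = 2\<close>.\<close>
  have dvdF: "[:0, 1:] ^ (2 * m) dvd F - \<eta> ^ d"
  proof -
    have *: "F - \<eta> ^ d = (\<Sum>k\<in>{..d} - {0}. smult (\<gamma> k) (monom 1 (k * m)) * \<eta> ^ (d - k))"
      unfolding eq[symmetric] using \<gamma>(1) by (simp add: sum.remove[of "{..d}" 0])
    have "[:0, 1:] ^ (2 * m) dvd smult (\<gamma> k) (monom 1 (k * m)) * \<eta> ^ (d - k)" if "k \<in> {..d} - {0}" for k
    proof (cases "k = 1")
      case False
      then have "2 \<le> k" using that by simp
      then have "2 * m \<le> k * m" by (rule mult_le_mono1)
      then have "[:0, 1:] ^ (2 * m) dvd ([:0, 1:] ^ (k * m) :: complex poly)" by (rule le_imp_power_dvd)
      also have "[:0, 1:] ^ (k * m) dvd smult (\<gamma> k) (monom 1 (k * m) :: complex poly)"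
        by (simp add: monom_altdef dvd_smult)
      finally show ?thesis by (rule dvd_mult2)
    qed (use \<gamma> in simp)
    then show ?thesis unfolding * by (rule dvd_sum)
  qed
  have F0: "coeff F 0 = 1"
  proof -
    have "[:0, 1:] dvd ([:0, 1:] ^ (2 * m) :: complex poly)"
      using m(1) by (intro dvd_power) simp
    then have "[:0, 1:] dvd F - \<eta> ^ d" using dvdF by (rule dvd_trans)
    then obtain G where "F - \<eta> ^ d = [:0, 1:] * G" by (elim dvdE)
    then have "coeff (F - \<eta> ^ d) 0 = 0" by simp
    then show ?thesis using \<eta>(1) by (simp add: coeff_0_power)
  qed
  have \<phi>0: "coeff \<phi> 0 = 1" using q0 F0 by (simp add: c\<phi>)
  have supp\<phi>: "i \<in> insert 0 S" if "coeff \<phi> i \<noteq> 0" for i using that F[of i] by (auto simp: c\<phi> split: if_splits)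
  have supp\<epsilon>: "i \<in> insert 0 S" if "coeff \<epsilon> i \<noteq> 0" for i using that F[of i] by (auto simp: c\<epsilon> split: if_splits)
  have \<phi>nz: "\<phi> \<noteq> 0" using \<phi>0 by auto
  have \<delta>: "\<delta> < q" "\<delta> = 0 \<or> \<delta> \<in> S"
  proof -
    have "coeff \<phi> \<delta> \<noteq> 0" using \<phi>nz by (simp add: \<delta>_def)
    then show "\<delta> < q" "\<delta> = 0 \<or> \<delta> \<in> S" using supp\<phi>[of \<delta>] by (auto simp: c\<phi> split: if_splits)
  qed
  define E where "E = sumset S J"
  have E: "finite E" "card E \<le> (Suc l + 1) ^ J"
  proof -
    show "finite E" unfolding E_def by (rule finite_sumset[OF S(1)])
    have "card E \<le> (card S + 1) ^ J" unfolding E_def by (rule card_sumset[OF S(1)])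
    also have "\<dots> \<le> (Suc l + 1) ^ J" using S(2) by (intro power_mono) auto
    finally show "card E \<le> (Suc l + 1) ^ J" .
  qed
  obtain T where T: "coeff T 0 = 1" "\<And>n. coeff T n \<noteq> 0 \<Longrightarrow> n \<in> E" "T ^ d * \<phi> = (\<eta> * \<phi> ^ J) ^ d"
  proof -
    have 1: "0 < d" using d by simp
    have 2: "degree \<phi> \<le> \<delta>" by (simp add: \<delta>_def)
    have 3: "[:0, 1:] ^ (2 * m) dvd \<eta> ^ d - \<phi> - \<epsilon>"
      using dvdF by (simp add: \<epsilon>_def dvd_diff_commute)
    \<comment> \<open>The cut \<open>q\<close> may exceed \<open>2 * m\<close>, the precision of the
      expansion; the minimum covers both cases.\<close>
    have 4: "[:0, 1:] ^ min q (2 * m) dvd \<epsilon>"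
    proof -
      have "\<epsilon> = monom 1 q * poly_shift q F"
        by (intro poly_eqI) (auto simp: c\<epsilon> coeff_monom_mult coeff_poly_shift)
      then have "[:0, 1:] ^ q dvd \<epsilon>" by (simp add: monom_altdef)
      then show ?thesis by (rule dvd_trans[OF le_imp_power_dvd, rotated]) simp
    qed
    have 5: "2 * m \<le> Suc J * min q (2 * m)"
    proof (cases "q \<le> 2 * m")
      case True
      have "2 * m \<le> J * q" using qK(3) by (simp add: J_def)
      then show ?thesis using True by simp
    qed simp
    have 6: "n \<in> E" if "j \<le> J" "coeff (\<epsilon> ^ j * \<phi> ^ (J - j)) n \<noteq> 0" for j n
    proof -
      have "i \<in> sumset S (J - j)" if "coeff (\<phi> ^ (J - j)) i \<noteq> 0" for i
        using support_power_mult[of \<phi> S 1 0 "J - j" i] supp\<phi> that by simp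
      then have "n \<in> sumset S (j + (J - j))"
        using support_power_mult[of \<epsilon> S "\<phi> ^ (J - j)" "J - j" j n] supp\<epsilon> that(2) by blast
      then show ?thesis using that(1) by (simp add: E_def)
    qed
    have 7: "(J + card E) * \<delta> < m"
    proof (cases "\<delta> = 0")
      case False
      then have "(2 * K + (Suc l + 1) ^ (2 * K)) * \<delta> < m" using qK(4) \<delta> by blast
      moreover have "(J + card E) * \<delta> \<le> (2 * K + (Suc l + 1) ^ (2 * K)) * \<delta>"
        using E(2) by (intro mult_le_mono1 add_mono) (simp_all add: J_def)
      ultimately show ?thesis by linarith
    qed (use m in simp)
    have 8: "min q (2 * m) \<le> 2 * m" "0 < min q (2 * m)" using q0 m by simp_all
    show ?thesis
      by (rule root_expansion_exact[OF 1 \<phi>0 2 \<eta> 3 4 8 5 E(1) 6 7]) (assumption, assumption, rule that)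
  qed
  have d0: "0 < d" using d by simp
  have "coeff (\<eta> * \<phi> ^ J) 0 = 1" using \<eta> \<phi>0 by (simp add: coeff_mult_0 coeff_0_power)
  then obtain \<psi> where \<psi>: "\<psi> * T = \<eta> * \<phi> ^ J" "\<psi> ^ d = \<phi>" "coeff \<psi> 0 = 1"
    by (rule root_of_small_part[OF d0 T(3,1)])
  have \<psi>nz: "\<psi> \<noteq> 0" using \<psi>(3) by auto
  have deg: "d * degree \<psi> = \<delta>" unfolding \<delta>_def \<psi>(2)[symmetric] using \<psi>nz by (simp add: degree_power_eq)
  define c where "c = coeff_bound Dm l"
  have c1: "c \<ge> 1" unfolding c_def using d by (intro coeff_bound_pos) simp
  have comb\<psi>: "comb S c i" if i: "coeff \<psi> i \<noteq> 0" for i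
  proof (cases "\<delta> = 0")
    case True
    have "d * degree \<psi> = 0" using True deg by simp
    then have "i = 0" using i d le_degree[of \<psi> i] by simp
    then show ?thesis using c1 by (simp add: comb_0)
  next
    case False
    let ?S = "{r \<in> S. r \<le> \<delta>}"
    have "q \<notin> ?S" using \<delta>(1) by simp
    then have "?S \<subset> S" using qK(1) by blast
    then have "card ?S < card S" using S(1) by (rule psubset_card_mono[rotated])
    then have card: "card ?S \<le> l" using S(2) by simp
    \<comment> \<open>\<open>\<psi> ^ d = \<phi>\<close> has the shape of the original equation,
      with only the term \<open>k = 0\<close>. Its exponents omit \<open>q\<close>, and its degree
      \<open>d * degree \<psi> = \<delta>\<close> lies in \<open>?S\<close>, so the induction
      hypothesis applies.\<close>
    have "comb ?S (coeff_bound Dm l) i"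
    proof (rule Suc.IH[where m = "degree \<psi>" and \<gamma> = "\<lambda>k. if k = 0 then 1 else 0" and F = \<phi>])
      show "1 \<le> degree \<psi>" using deg False by (cases "degree \<psi>") auto
      show "d * degree \<psi> \<in> ?S" using deg \<delta>(2) False by simp
      show "j \<in> insert 0 ?S" if "coeff \<phi> j \<noteq> 0" for j
        using supp\<phi>[OF that] le_degree[OF that] by (auto simp: \<delta>_def)
      have "(\<Sum>k\<le>d. smult (if k = 0 then 1 else 0) (monom 1 (k * degree \<psi>)) * \<psi> ^ (d - k))
          = (\<Sum>k\<le>d. if k = 0 then \<psi> ^ d else 0)"
        by (intro sum.cong) auto
      then show "(\<Sum>k\<le>d. smult (if k = 0 then 1 else 0) (monom 1 (k * degree \<psi>)) * \<psi> ^ (d - k)) = \<phi>"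
        using \<psi>(2) by simp
    qed (use S card d \<psi> i in auto)
    then show ?thesis unfolding c_def by (rule comb_superset) (use S in auto)
  qed
  define Jb where "Jb = 2 * scale_bound (Suc l)"
  have JJ: "J \<le> Jb" using qK(2) by (simp add: J_def Jb_def)
  define X0 where "X0 = c * fact Dm * fact c"
  define \<Phi> where "\<Phi> X = 4 * Dm * (Jb + 1) * X" for X
  have X0: "X0 > 0" using c1 by (simp add: X0_def)
  obtain M0 where M0: "gens_from S X0 (card S) M0"
    "\<And>n. n = m \<or> n \<in> S \<or> comb S c n \<Longrightarrow> box_rep (card S) M0 X0 n"
    using initial_generators[OF S(1) m(2) d c1] unfolding X0_def by blast
  have \<Phi>pos: "X > 0 \<Longrightarrow> \<Phi> X > 0" for X using d by (simp add: \<Phi>_def)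
  obtain s X M where sXM: "s \<le> card S" "X \<le> ((\<lambda>X. 2 * X * \<Phi> X) ^^ card S) X0" "X > 0" "gens_from S X s M"
    "\<And>n. n \<in> {n. n = m \<or> n \<in> S \<or> comb S c n} \<Longrightarrow> box_rep s M X n" "box_independent s M (\<Phi> X)"
    using eliminate_relations[of \<Phi> S X0 "card S" M0 "{n. n = m \<or> n \<in> S \<or> comb S c n}"] \<Phi>pos M0 X0 by blast
  have repS: "box_rep s M X i" if "i \<in> insert 0 S" for i
    using that sXM(5)[of i] box_rep_0 by auto
  have "box_rep s M (4 * ((J + 1) * X)) n"
  proof (rule lifting[OF eq \<gamma>(1) _ \<phi>nz \<psi>(1) _ _ _ _ _ _ Suc.prems(13)])
    show "box_rep s M X i" if "coeff F i \<noteq> 0" for i using repS F that by blast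
    show "box_rep s M X i" if "coeff \<psi> i \<noteq> 0" for i using sXM(5) comb\<psi>[OF that] by blast
    show "box_rep s M X i" if "coeff \<phi> i \<noteq> 0" for i using repS supp\<phi> that by blast
    show "box_rep s M X m" using sXM(5) by blast
    show "box_rep s M (J * X) i" if "coeff T i \<noteq> 0" for i
      using T(2)[OF that] unfolding E_def by (rule box_rep_sumset[rotated]) (use repS in blast)
    have "4 * d * ((J + 1) * X) \<le> \<Phi> X"
      unfolding \<Phi>_def using d JJ by (simp only: mult.assoc) (intro mult_le_mono; simp)
    then show "box_independent s M (4 * d * ((J + 1) * X))"
      using sXM(6) Box_mono unfolding box_independent_def by blast
  qed (use d in auto)
  then have "comb S ((s * (4 * ((J + 1) * X)) * X + 1) * fact X) n"
    by (rule comb_of_box_rep[OF S(1) sXM(4)])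
  moreover have "(s * (4 * ((J + 1) * X)) * X + 1) * fact X \<le> coeff_bound Dm (Suc l)"
  proof -
    define Y where "Y = ((\<lambda>X. 2 * X * \<Phi> X) ^^ Suc l) X0"
    have infl: "X \<le> 2 * X * \<Phi> X" for X using \<Phi>pos[of X] by (cases "X = 0") auto
    have "((\<lambda>X. 2 * X * \<Phi> X) ^^ i) X0 \<le> ((\<lambda>X. 2 * X * \<Phi> X) ^^ j) X0" if "i \<le> j" for i j
      using that by (rule lift_Suc_mono_le[rotated]) (simp only: funpow.simps comp_apply infl)
    from this[OF S(2)] have XY: "X \<le> Y" using sXM(2) unfolding Y_def by simp
    have "s * (4 * ((J + 1) * X)) * X + 1 \<le> Suc l * (4 * ((Jb + 1) * Y)) * Y + 1"
      using sXM(1) S(2) JJ XY by (intro add_mono mult_le_mono) auto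
    then have "(s * (4 * ((J + 1) * X)) * X + 1) * fact X \<le> (Suc l * (4 * ((Jb + 1) * Y)) * Y + 1) * fact Y"
      using fact_mono_nat[OF XY] by (rule mult_le_mono)
    also have "\<dots> = coeff_bound_step Dm (Suc l) c"
      unfolding coeff_bound_step_def Let_def Y_def \<Phi>_def X0_def Jb_def by (simp only: mult.assoc)
    finally show ?thesis by (simp only: coeff_bound.simps c_def)
  qed
  ultimately show ?case
    unfolding comb_def by (meson of_nat_mono order_trans)
qed

section \<open>Number of terms\<close>

lemma card_comb:
  assumes "finite S"
  shows "finite {n. comb S C n}" "card {n. comb S C n} \<le> C * (2 * C + 1) ^ card S"
proof -
  define P where "P = {1..C} \<times> PiE S (\<lambda>_. {- int C..int C})"
  define f where "f = (\<lambda>(D, b). nat ((\<Sum>i\<in>S. b i * int i) div int D))"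
  have fin: "finite P" unfolding P_def using assms by (intro finite_cartesian_product finite_PiE) auto
  have sub: "{n. comb S C n} \<subseteq> f ` P"
  proof
    fix n assume "n \<in> {n. comb S C n}"
    then obtain D b where Db: "1 \<le> D" "D \<le> C" "\<And>i. i \<in> S \<Longrightarrow> \<bar>b i\<bar> \<le> int C"
      "int D * int n = (\<Sum>i\<in>S. b i * int i)" by (auto simp: comb_def)
    have "(\<Sum>i\<in>S. restrict b S i * int i) = int D * int n" unfolding Db(4) by (intro sum.cong) auto
    then have "f (D, restrict b S) = n" using Db(1) by (simp add: f_def)
    moreover have "(D, restrict b S) \<in> P"
      using Db(1-3) by (auto simp: P_def abs_le_iff PiE_def) (smt (verit) Db(3))+
    ultimately show "n \<in> f ` P" by (metis image_eqI)
  qed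
  show "finite {n. comb S C n}" using sub fin by (meson finite_imageI finite_subset)
  have "card {n. comb S C n} \<le> card (f ` P)" using sub fin by (intro card_mono) auto
  also have "\<dots> \<le> card P" by (rule card_image_le[OF fin])
  also have "\<dots> = C * (2 * C + 1) ^ card S"
    using assms by (simp add: P_def card_PiE card_cartesian_product nat_add_distrib nat_mult_distrib)
  finally show "card {n. comb S C n} \<le> C * (2 * C + 1) ^ card S" .
qed

lemma num_terms_smult: "c \<noteq> 0 \<Longrightarrow> num_terms (smult c p) = num_terms (p :: complex poly)"
  by (simp add: num_terms_def)

lemma num_terms_add_const: "num_terms (p + [:c:]) \<le> num_terms p + 1"
proof -
  have "{m. coeff (p + [:c:]) m \<noteq> 0} \<subseteq> insert 0 {m. coeff p m \<noteq> 0}"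
  proof
    fix m assume "m \<in> {m. coeff (p + [:c:]) m \<noteq> 0}"
    then show "m \<in> insert 0 {m. coeff p m \<noteq> 0}" by (cases m) auto
  qed
  then have "num_terms (p + [:c:]) \<le> card (insert 0 {m. coeff p m \<noteq> 0})"
    unfolding num_terms_def by (intro card_mono) (auto simp: finite_support)
  also have "\<dots> \<le> num_terms p + 1"
    by (simp add: num_terms_def card_insert_if finite_support)
  finally show ?thesis .
qed

lemma num_terms_reversed:
  fixes p :: "complex poly"
  shows "num_terms p = num_terms (reflect_poly p)"
proof -
  have "bij_betw (\<lambda>i. degree p - i) {m. coeff p m \<noteq> 0} {m. coeff (reflect_poly p) m \<noteq> 0}"
  proof (rule bij_betwI')
    show "(degree p - x = degree p - y) = (x = y)" if "x \<in> {m. coeff p m \<noteq> 0}" "y \<in> {m. coeff p m \<noteq> 0}" for x y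
      using that le_degree[of p x] le_degree[of p y] by auto
    show "degree p - x \<in> {m. coeff (reflect_poly p) m \<noteq> 0}" if "x \<in> {m. coeff p m \<noteq> 0}" for x
      using that le_degree[of p x] by (auto simp: coeff_reflect_poly)
    show "\<exists>x\<in>{m. coeff p m \<noteq> 0}. y = degree p - x" if "y \<in> {m. coeff (reflect_poly p) m \<noteq> 0}" for y
      using that by (intro bexI[of _ "degree p - y"]) (auto simp: coeff_reflect_poly split: if_splits)
  qed
  then show ?thesis unfolding num_terms_def by (rule bij_betw_same_card)
qed

text \<open>Substituting \<open>x = 1/t\<close> and multiplying by
  \<open>t ^ (degree g * degree h)\<close> produces the equation that \<open>support_comb\<close>
  starts from; it is monic in the reversed \<open>h\<close> when \<open>g\<close> is monic.\<close>

lemma reversed_composition: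
  fixes g h :: "complex poly"
  assumes "degree h > 0"
  shows "reflect_poly (g \<circ>\<^sub>p h) =
    (\<Sum>k\<le>degree g. smult (coeff g (degree g - k)) (monom 1 (k * degree h)) * reflect_poly h ^ (degree g - k))"
    (is "?l = ?r")
proof (rule poly_eqI_nonzero)
  fix x :: complex assume x: "x \<noteq> 0"
  let ?d = "degree g" and ?m = "degree h"
  have "poly ?l x = x ^ (?d * ?m) * poly g (poly h (inverse x))"
    using x assms by (simp add: poly_reflect_poly_nz degree_pcompose poly_pcompose)
  also have "\<dots> = (\<Sum>i\<le>?d. x ^ (?d * ?m) * (coeff g i * poly h (inverse x) ^ i))"
    by (simp add: poly_altdef[of g] sum_distrib_left)
  also have "\<dots> = (\<Sum>k\<le>?d. x ^ (?d * ?m) * (coeff g (?d - k) * poly h (inverse x) ^ (?d - k)))"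
    by (rule sum.reindex_bij_witness[of _ "\<lambda>i. ?d - i" "\<lambda>i. ?d - i"]) auto
  also have "\<dots> = poly ?r x"
    unfolding poly_sum
  proof (intro sum.cong refl)
    fix k assume "k \<in> {..?d}"
    then have "?d * ?m = k * ?m + ?m * (?d - k)" by (metis add_mult_distrib atMost_iff le_add_diff_inverse mult.commute)
    then have "x ^ (?d * ?m) = x ^ (k * ?m) * (x ^ ?m) ^ (?d - k)" by (simp add: power_add power_mult)
    then show "x ^ (?d * ?m) * (coeff g (?d - k) * poly h (inverse x) ^ (?d - k))
        = poly (smult (coeff g (?d - k)) (monom 1 (k * ?m)) * reflect_poly h ^ (?d - k)) x"
      using x by (simp add: poly_monom poly_reflect_poly_nz power_mult_distrib)
  qed
  finally show "poly ?l x = poly ?r x" .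
qed

lemma num_terms_normalized:
  fixes g h :: "complex poly"
  assumes h: "lead_coeff h = 1" "degree h > 0" and g: "lead_coeff g = 1" "degree g > 0" "coeff g (degree g - 1) = 0"
    and deg: "degree g \<le> Dm" and l: "num_terms (g \<circ>\<^sub>p h) \<le> l"
  shows "num_terms h \<le> coeff_bound Dm l * (2 * coeff_bound Dm l + 1) ^ l"
proof -
  define d where "d = degree g"
  define m where "m = degree h"
  define F where "F = reflect_poly (g \<circ>\<^sub>p h)"
  \<comment> \<open>As \<open>F(0) = 1\<close>, dropping the exponent \<open>0\<close> makes room
    for \<open>d * m\<close> within \<open>l\<close> elements.\<close>
  define S where "S = insert (d * m) ({n. coeff F n \<noteq> 0} - {0})"
  have dm: "1 \<le> d" "d \<le> Dm" "1 \<le> m" using g h deg by (auto simp: d_def m_def)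
  have "lead_coeff (g \<circ>\<^sub>p h) = 1" using g h by (simp add: lead_coeff_comp)
  then have F0: "coeff F 0 = 1" by (simp add: F_def)
  have finS: "finite S" by (simp add: S_def finite_support)
  have cardS: "card S \<le> l"
  proof -
    have "card S \<le> Suc (card ({n. coeff F n \<noteq> 0} - {0}))"
      by (simp add: S_def card_insert_if finite_support)
    also have "\<dots> = num_terms F"
      unfolding num_terms_def using F0 by (intro card_Suc_Diff1 finite_support) simp
    also have "\<dots> \<le> l" using l by (simp add: F_def flip: num_terms_reversed)
    finally show ?thesis .
  qed
  have S0: "0 \<notin> S" using dm by (simp add: S_def)
  have eq: "(\<Sum>k\<le>d. smult (coeff g (d - k)) (monom 1 (k * m)) * reflect_poly h ^ (d - k)) = F"
    unfolding F_def d_def m_def by (rule reversed_composition[OF h(2), symmetric])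
  have "comb S (coeff_bound Dm l) n" if "coeff (reflect_poly h) n \<noteq> 0" for n
    by (rule support_comb[OF finS cardS dm _ _ _ _ _ _ eq that S0])
       (use g h in \<open>auto simp: d_def m_def S_def degree_reflect_poly_le\<close>)
  then have sub: "{n. coeff (reflect_poly h) n \<noteq> 0} \<subseteq> {n. comb S (coeff_bound Dm l) n}" by blast
  have "num_terms h = num_terms (reflect_poly h)" by (rule num_terms_reversed)
  also have "\<dots> \<le> card {n. comb S (coeff_bound Dm l) n}"
    unfolding num_terms_def using sub by (intro card_mono card_comb(1) finS)
  also have "\<dots> \<le> coeff_bound Dm l * (2 * coeff_bound Dm l + 1) ^ card S"
    by (rule card_comb(2)[OF finS])
  also have "\<dots> \<le> coeff_bound Dm l * (2 * coeff_bound Dm l + 1) ^ l"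
    using cardS by (intro mult_le_mono2 power_increasing) auto
  finally show ?thesis .
qed

lemma coeff_pcompose_shift_top:
  "degree p \<le> k \<Longrightarrow> coeff (p \<circ>\<^sub>p [:c, 1:]) k = coeff (p :: complex poly) k"
proof (induction p arbitrary: k)
  case (pCons a q)
  have deg: "degree (q \<circ>\<^sub>p [:c, 1:]) = degree q" by (simp add: degree_pcompose)
  show ?case
  proof (cases k)
    case 0
    then have "q = 0" using pCons.prems by (cases "q = 0") auto
    then show ?thesis by (simp add: pcompose_pCons)
  next
    case (Suc k')
    then have "degree q \<le> k'" using pCons.prems by (cases "q = 0") auto
    then show ?thesis using pCons.IH[of k'] deg by (simp add: Suc pcompose_pCons coeff_eq_0)
  qed
qed simp

text \<open>The effect of a shift on the subleading coefficient is linear in \<open>c\<close>, so a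
  suitable shift makes that coefficient vanish.\<close>

lemma coeff_pcompose_shift:
  "degree p \<le> Suc k \<Longrightarrow>
    coeff (p \<circ>\<^sub>p [:c, 1:]) k = coeff (p :: complex poly) k + of_nat (Suc k) * c * coeff p (Suc k)"
proof (induction p arbitrary: k)
  case (pCons a q)
  then have deg: "degree q \<le> k" by (cases "q = 0") auto
  have top: "coeff (q \<circ>\<^sub>p [:c, 1:]) k = coeff q k" by (rule coeff_pcompose_shift_top[OF deg])
  show ?case
  proof (cases k)
    case 0
    then show ?thesis using top by (simp add: pcompose_pCons)
  next
    case (Suc k')
    then have "coeff (q \<circ>\<^sub>p [:c, 1:]) k' = coeff q k' + of_nat k * c * coeff q k"
      using pCons.IH[of k'] deg by simp
    then show ?thesis using top by (simp add: Suc pcompose_pCons algebra_simps)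
  qed
qed simp

text \<open>Two normalisations are needed: \<open>h1\<close> vanishes at \<open>0\<close> for the
  bound on the outer degree, and \<open>h2\<close> is shifted so that \<open>g2\<close> has no
  subleading coefficient. Compensating in \<open>g\<close> keeps the composition up to a constant
  factor, and passing from \<open>h2\<close> back to \<open>h\<close> adds at most one term.\<close>

lemma num_terms_bound:
  fixes g h :: "complex poly"
  assumes g: "degree g > 0" and h: "degree h > 0" and l: "num_terms (g \<circ>\<^sub>p h) \<le> l"
  shows "num_terms h \<le> terms_bound l"
proof -
  define a where "a = lead_coeff h"
  define b where "b = coeff h 0"
  define m where "m = degree h"
  define h1 where "h1 = smult (inverse a) (h - [:b:])"
  have a: "a \<noteq> 0" using h by (auto simp: a_def)
  have hh1: "h = smult a h1 + [:b:]" using a by (simp add: h1_def)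
  have m0: "m > 0" using h by (simp add: m_def)
  have degh1: "degree h1 = m"
  proof -
    have "degree (h - [:b:]) = m"
      unfolding diff_conv_add_uminus m_def using h by (intro degree_add_eq_left) simp
    then show ?thesis using a by (simp add: h1_def)
  qed
  obtain k where k: "m = Suc k" using m0 by (cases m) auto
  have h1: "lead_coeff h1 = 1"
  proof -
    have "coeff h (Suc k) = a" by (simp add: a_def m_def flip: k)
    then show ?thesis using a unfolding degh1 k by (simp add: h1_def)
  qed
  have h10: "coeff h1 0 = 0" by (simp add: h1_def b_def)
  define g1 where "g1 = g \<circ>\<^sub>p [:b, a:]"
  have g1h1: "g1 \<circ>\<^sub>p h1 = g \<circ>\<^sub>p h"
  proof -
    have "[:b, a:] \<circ>\<^sub>p h1 = h" by (subst hh1) (simp add: pcompose_pCons)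
    then show ?thesis by (simp add: g1_def flip: pcompose_assoc)
  qed
  have degg1: "degree g1 = degree g" using a by (simp add: g1_def degree_pcompose)
  define d where "d = degree g"
  define c where "c = coeff_bound (l + 2 ^ l) l"
  have bound: "terms_bound l = 3 + c * (2 * c + 1) ^ l" by (simp add: terms_bound_def c_def Let_def)
  show ?thesis
  proof (cases "h1 = monom 1 m")
    case True
    then have "{n. coeff h1 n \<noteq> 0} = {m}" by auto
    then have "num_terms h1 = 1" by (simp add: num_terms_def)
    then have "num_terms h \<le> 2"
      using num_terms_add_const[of "smult a h1" b] a by (simp add: num_terms_smult flip: hh1)
    then show ?thesis by (simp add: bound)
  next
    case False
    have d: "d \<le> l + 2 ^ l"
      using outer_degree_bound[of h1 g1 l] h1 h10 degh1 degg1 g g1h1 l m0 False by (simp add: d_def)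
    define e where "e = lead_coeff g1"
    have "g1 \<noteq> 0" using degg1 g by auto
    then have e: "e \<noteq> 0" unfolding e_def by (rule leading_coeff_neq_0)
    define \<beta> where "\<beta> = coeff g1 (d - 1) / (of_nat d * e)"
    define g2 where "g2 = smult (inverse e) (g1 \<circ>\<^sub>p [:- \<beta>, 1:])"
    define h2 where "h2 = h1 + [:\<beta>:]"
    have degg2: "degree g2 = d" using e degg1 by (simp add: g2_def degree_pcompose d_def)
    have leadg2: "lead_coeff g2 = 1"
      using e by (simp add: g2_def lead_coeff_comp e_def lead_coeff_smult)
    have degh2: "degree h2 = m" unfolding h2_def using degh1 m0 by (simp add: degree_add_eq_left)
    have leadh2: "lead_coeff h2 = 1"
      using h1 unfolding degh2 degh1 k by (simp add: h2_def)
    have sub: "coeff g2 (d - 1) = 0"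
    proof -
      have d1: "Suc (d - 1) = d" using g by (simp add: d_def)
      have "coeff (g1 \<circ>\<^sub>p [:- \<beta>, 1:]) (d - 1) = coeff g1 (d - 1) + of_nat d * (- \<beta>) * coeff g1 d"
        using coeff_pcompose_shift[of g1 "d - 1" "- \<beta>"] degg1 unfolding d1 by (simp add: d_def)
      also have "coeff g1 d = e" using degg1 by (simp add: e_def d_def)
      also have "coeff g1 (d - 1) + of_nat d * (- \<beta>) * e = 0"
        using e g by (simp add: \<beta>_def d_def field_simps)
      finally show ?thesis by (simp add: g2_def)
    qed
    have "g2 \<circ>\<^sub>p h2 = smult (inverse e) (g \<circ>\<^sub>p h)"
    proof -
      have "[:- \<beta>, 1:] \<circ>\<^sub>p h2 = h1" by (simp add: h2_def pcompose_pCons)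
      then show ?thesis by (simp add: g2_def pcompose_smult g1h1 flip: pcompose_assoc)
    qed
    then have "num_terms (g2 \<circ>\<^sub>p h2) \<le> l" using l e by (simp add: num_terms_smult)
    then have "num_terms h2 \<le> c * (2 * c + 1) ^ l"
      using num_terms_normalized[of h2 g2 "l + 2 ^ l" l] leadh2 degh2 m0 leadg2 degg2 sub g d
      by (simp add: c_def d_def)
    moreover have "num_terms h \<le> num_terms h2 + 1"
    proof -
      have "h = smult a h2 + [:b - a * \<beta>:]" by (subst hh1) (simp add: h2_def smult_add_right)
      then show ?thesis using num_terms_add_const[of "smult a h2" "b - a * \<beta>"] a by (simp add: num_terms_smult)
    qed
    ultimately show ?thesis by (simp add: bound)
  qed
qed

theorem theorem1:
  "\<exists>B :: nat \<Rightarrow> nat. computable B \<and>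
    (\<forall>(l :: nat) (g :: complex poly) (h :: complex poly).
       degree g > 0 \<longrightarrow> degree h > 0 \<longrightarrow> num_terms (pcompose g h) \<le> l \<longrightarrow>
       num_terms h \<le> B l)"
  using computable_terms_bound num_terms_bound by blast

end
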